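(* Let $n\geq 2$ be an integer and let $\mathrm{D}_{2n}$ be the dihedral group of order $2n$. Then the following statements are equivalent: (1) $\mathrm{D}_{2n}$ is an NNN-group; (2) $\mathrm{D}_{2n}$ is an NNND-group; (3) $n\geq 6$ is even, and $n\neq 8$.
   Context: All groups and digraphs are finite; digraphs are simple. The dihedral group is $\mathrm{D}_{2n}=\langle a,b \mid a^n=b^2=1,\ b^{-1}ab=a^{-1}\rangle$. For a finite group $G$ and a subset $S\subseteq G$ with $1\notin S$, the Cayley digraph $\mathrm{Cay}(G,S)$ has vertex set $G$ and arc set $\{(g,sg) : g\in G,\ s\in S\}$ ($S$ is not required to generate $G$); if $S=S^{-1}$ it is called a Cayley graph (a graph is viewed as a digraph in which each edge is replaced by the two opposite arcs). For a digraph $\Gamma$, $\mathrm{Aut}(\Gamma)$ is the group of permutations of its vertex set preserving the arc set. For $g\in G$ let $R(g):x\mapsto xg$, and let $R(G)=\{R(g): g\in G\}$, a subgroup of $\mathrm{Aut}(\mathrm{Cay}(G,S))$. A subgroup of $\mathrm{Aut}(\mathrm{Cay}(G,S))$ is regular if it acts transitively on $G$ and only its identity element fixes a vertex. $\mathrm{Cay}(G,S)$ is called normal if $R(G)$ is a normal subgroup of $\mathrm{Aut}(\mathrm{Cay}(G,S))$. $\mathrm{Cay}(G,S)$ is called NNN if it is normal and $\mathrm{Aut}(\mathrm{Cay}(G,S))$ has a regular subgroup isomorphic to $G$ that is not normal in $\mathrm{Aut}(\mathrm{Cay}(G,S))$. A group $G$ is an NNND-group if there exists an NNN Cayley digraph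 on $G$, and an NNN-group if there exists an NNN Cayley graph on $G$. *)

theory Defs
  imports "HOL-Algebra.Algebra" "Graph_Theory.Pair_Digraph"
begin

text \<open>
  For \<open>n \<ge> 1\<close>, the pair \<open>(i, s)\<close> stands for \<open>a\<^sup>i b\<^sup>s\<close> (exponent of \<open>b\<close> being 1 iff \<open>s\<close> is true) in
  the group presented by \<open>a\<^sup>n = b\<^sup>2 = 1\<close>, \<open>b\<^sup>-\<^sup>1 a b = a\<^sup>-\<^sup>1\<close>; the product is read off from
  \<open>b a\<^sup>j = a\<^sup>-\<^sup>j b\<close>. The lemmas below show that this is that group and that its order is \<open>2n\<close>.
\<close>

definition dihedral :: "nat \<Rightarrow> (int \<times> bool) monoid" where
  "dihedral n =
    \<lparr>carrier = {0..<int n} \<times> UNIV,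
     monoid.mult = (\<lambda>(i, s) (j, t). ((if s then i - j else i + j) mod int n, s \<noteq> t)),
     one = (0, False)\<rparr>"

definition dihedral_a :: "nat \<Rightarrow> int \<times> bool" where
  "dihedral_a n = (1 mod int n, False)"

definition dihedral_b :: "int \<times> bool" where
  "dihedral_b = (0, True)"

lemma dihedral_group:
  assumes "n \<ge> 1"
  shows "group (dihedral n)"
proof (rule groupI, goal_cases)
  case (3 x y z)
  then show ?case
    by (auto simp: dihedral_def mod_simps algebra_simps split: prod.splits)
next
  case (5 x)
  then obtain i s where x: "x = (i, s)" "0 \<le> i" "i < int n"
    by (auto simp: dihedral_def)
  show ?case
    by (rule bexI[of _ "(if s then i else (- i) mod int n, s)"])
      (use x assms in \<open>auto simp: dihedral_def mod_simps\<close>)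
qed (use assms in \<open>auto simp: dihedral_def\<close>)

lemma dihedral_order: "order (dihedral n) = 2 * n"
  by (simp add: order_def dihedral_def card_cartesian_product)

lemma dihedral_a_pow:
  assumes "n \<ge> 1"
  shows "dihedral_a n [^]\<^bsub>dihedral n\<^esub> (k :: nat) = (int k mod int n, False)"
proof (induction k)
  case 0
  then show ?case by (simp add: nat_pow_def dihedral_def)
next
  case (Suc k)
  interpret group "dihedral n" by (rule dihedral_group[OF assms])
  show ?case
    unfolding nat_pow_Suc Suc by (simp add: dihedral_def dihedral_a_def mod_simps algebra_simps)
qed

lemma dihedral_relations:
  assumes "n \<ge> 1"
  shows "dihedral_a n \<in> carrier (dihedral n)" "dihedral_b \<in> carrier (dihedral n)"
    and "dihedral_a n [^]\<^bsub>dihedral n\<^esub> n = \<one>\<^bsub>dihedral n\<^esub>"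
    and "dihedral_b [^]\<^bsub>dihedral n\<^esub> (2 :: nat) = \<one>\<^bsub>dihedral n\<^esub>"
    and "inv\<^bsub>dihedral n\<^esub> dihedral_b \<otimes>\<^bsub>dihedral n\<^esub> dihedral_a n \<otimes>\<^bsub>dihedral n\<^esub> dihedral_b
      = inv\<^bsub>dihedral n\<^esub> (dihedral_a n)"
proof -
  interpret group "dihedral n" by (rule dihedral_group[OF assms])
  show a: "dihedral_a n \<in> carrier (dihedral n)" and b: "dihedral_b \<in> carrier (dihedral n)"
    using assms by (auto simp: dihedral_a_def dihedral_b_def dihedral_def)
  show "dihedral_a n [^]\<^bsub>dihedral n\<^esub> n = \<one>\<^bsub>dihedral n\<^esub>"
    unfolding dihedral_a_pow[OF assms] by (simp add: dihedral_def)
  have bb: "dihedral_b \<otimes>\<^bsub>dihedral n\<^esub> dihedral_b = \<one>\<^bsub>dihedral n\<^esub>"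
    by (simp add: dihedral_def dihedral_b_def)
  then show "dihedral_b [^]\<^bsub>dihedral n\<^esub> (2 :: nat) = \<one>\<^bsub>dihedral n\<^esub>"
    using b by (simp add: numeral_2_eq_2)
  have ib: "inv\<^bsub>dihedral n\<^esub> dihedral_b = dihedral_b"
    using bb b b by (rule inv_equality)
  have "dihedral_b \<otimes>\<^bsub>dihedral n\<^esub> dihedral_a n \<otimes>\<^bsub>dihedral n\<^esub> dihedral_b \<otimes>\<^bsub>dihedral n\<^esub> dihedral_a n
      = \<one>\<^bsub>dihedral n\<^esub>"
    by (simp add: dihedral_def dihedral_b_def dihedral_a_def mod_simps)
  then show "inv\<^bsub>dihedral n\<^esub> dihedral_b \<otimes>\<^bsub>dihedral n\<^esub> dihedral_a n \<otimes>\<^bsub>dihedral n\<^esub> dihedral_b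
      = inv\<^bsub>dihedral n\<^esub> (dihedral_a n)"
    unfolding ib using a b inv_equality by (metis m_closed)
qed

lemma dihedral_generate:
  assumes "n \<ge> 1"
  shows "generate (dihedral n) {dihedral_a n, dihedral_b} = carrier (dihedral n)"
proof
  interpret group "dihedral n" by (rule dihedral_group[OF assms])
  let ?gen = "generate (dihedral n) {dihedral_a n, dihedral_b}"
  show "?gen \<subseteq> carrier (dihedral n)"
    using dihedral_relations(1,2)[OF assms] by (intro generate_incl) auto
  have pow: "dihedral_a n [^]\<^bsub>dihedral n\<^esub> (k :: nat) \<in> ?gen" for k
    by (induction k) (auto intro: generate.intros)
  show "carrier (dihedral n) \<subseteq> ?gen"
  proof
    fix x assume "x \<in> carrier (dihedral n)"
    then obtain i s where x: "x = (i, s)" "0 \<le> i" "i < int n"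
      by (auto simp: dihedral_def)
    have i: "(i, False) \<in> ?gen"
      using pow[of "nat i"] x unfolding dihedral_a_pow[OF assms] by simp
    have "(i, False) \<otimes>\<^bsub>dihedral n\<^esub> dihedral_b \<in> ?gen"
      by (rule generate.eng[OF i]) (auto intro: generate.intros)
    then have "(i, True) \<in> ?gen"
      using x by (simp add: dihedral_def dihedral_b_def)
    with i x show "x \<in> ?gen" by (cases s) auto
  qed
qed

lemma dihedral_universal:
  fixes H (structure)
  assumes "n \<ge> 1" "group H" and xy: "x \<in> carrier H" "y \<in> carrier H"
    and rel: "x [^] n = \<one>" "y [^] (2 :: nat) = \<one>" "inv y \<otimes> x \<otimes> y = inv x"
  shows "\<exists>h \<in> hom (dihedral n) H. h (dihedral_a n) = x \<and> h dihedral_b = y"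
proof -
  interpret H: group H by fact
  have xmod: "x [^] (k mod int n) = x [^] k" for k :: int
  proof -
    have "x [^] k = x [^] (int n * (k div int n) + k mod int n)" by simp
    also have "\<dots> = (x [^] int n) [^] (k div int n) \<otimes> x [^] (k mod int n)"
      using xy H.int_pow_mult H.int_pow_pow by metis
    also have "\<dots> = x [^] (k mod int n)"
      using rel xy by (simp add: int_pow_int)
    finally show ?thesis ..
  qed
  have yy: "y \<otimes> y = \<one>" using rel xy by (simp add: numeral_2_eq_2)
  then have iy: "inv y = y" using xy by (simp add: H.inv_equality)
  have conj: "y \<otimes> x [^] (j :: int) \<otimes> y = x [^] (- j)" for j
  proof -
    have nat_conj: "y \<otimes> z [^] (k :: nat) \<otimes> y = (y \<otimes> z \<otimes> y) [^] k" if "z \<in> carrier H" for z k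
    proof (induction k)
      case 0
      then show ?case using yy xy by simp
    next
      case (Suc k)
      have "y \<otimes> z [^] Suc k \<otimes> y = y \<otimes> z [^] k \<otimes> (y \<otimes> y) \<otimes> z \<otimes> y"
        using that xy unfolding yy by (simp add: H.m_assoc)
      also have "\<dots> = (y \<otimes> z [^] k \<otimes> y) \<otimes> (y \<otimes> z \<otimes> y)"
        using that xy by (simp add: H.m_assoc)
      finally show ?case using Suc by simp
    qed
    have yxy: "y \<otimes> x \<otimes> y = inv x" using rel iy by simp
    then have yxy': "y \<otimes> inv x \<otimes> y = x"
      using xy yy iy by (metis H.inv_closed H.inv_inv H.inv_mult_group H.m_closed H.m_assoc)
    show ?thesis
    proof (cases j)
      case (nonneg k)
      then show ?thesis using nat_conj[OF xy(1), of k] yxy xy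
        by (simp add: int_pow_int H.int_pow_neg_int H.nat_pow_inv)
    next
      case (neg k)
      then show ?thesis using nat_conj[of "inv x" "Suc k"] yxy' xy
        by (simp only: H.int_pow_neg_int minus_minus int_pow_int H.nat_pow_inv H.inv_closed)
    qed
  qed
  have yx: "y \<otimes> x [^] j = x [^] (- j) \<otimes> y" for j :: int
  proof -
    have "y \<otimes> x [^] j = y \<otimes> x [^] j \<otimes> (y \<otimes> y)" using xy yy by simp
    also have "\<dots> = (y \<otimes> x [^] j \<otimes> y) \<otimes> y" using xy by (simp add: H.m_assoc)
    finally show ?thesis by (simp only: conj)
  qed
  define h where "h = (\<lambda>(i :: int, s). x [^] i \<otimes> (if s then y else \<one>))"
  have "h \<in> hom (dihedral n) H"
  proof (rule homI)
    fix u v assume "u \<in> carrier (dihedral n)" "v \<in> carrier (dihedral n)"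
    obtain i s j t where uv: "u = (i, s)" "v = (j, t)" by (cases u; cases v)
    have "x [^] i \<otimes> y \<otimes> (x [^] j \<otimes> w) = x [^] (i - j) \<otimes> (y \<otimes> w)" if "w \<in> carrier H" for w
    proof -
      have "x [^] i \<otimes> y \<otimes> (x [^] j \<otimes> w) = x [^] i \<otimes> (y \<otimes> x [^] j) \<otimes> w"
        using xy that by (simp add: H.m_assoc)
      also have "\<dots> = (x [^] i \<otimes> x [^] (- j)) \<otimes> (y \<otimes> w)"
        unfolding yx using xy that by (simp add: H.m_assoc)
      finally show ?thesis using xy by (simp flip: H.int_pow_mult)
    qed
    note this[of y] this[of \<one>]
    then show "h (u \<otimes>\<^bsub>dihedral n\<^esub> v) = h u \<otimes> h v"
      using xy yy by (auto simp: uv h_def dihedral_def xmod H.int_pow_mult H.m_assoc)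
  qed (auto simp: h_def xy)
  moreover have "h (dihedral_a n) = x" "h dihedral_b = y"
    using xy by (auto simp: h_def dihedral_a_def dihedral_b_def xmod)
  ultimately show ?thesis by blast
qed

definition Cay :: "('a, 'm) monoid_scheme \<Rightarrow> 'a set \<Rightarrow> 'a pair_pre_digraph" where
  "Cay G S = \<lparr>pverts = carrier G, parcs = {(g, s \<otimes>\<^bsub>G\<^esub> g) | g s. g \<in> carrier G \<and> s \<in> S}\<rparr>"

text \<open>
  The operation of \<^const>\<open>BijGroup\<close> is \<open>g \<circ> f\<close> (maps applied on the left), so \<open>g \<mapsto> right_mult G g\<close>
  reverses products; its image is nevertheless a subgroup isomorphic to \<open>G\<close>.
\<close>

definition Aut :: "'v pair_pre_digraph \<Rightarrow> ('v \<Rightarrow> 'v) monoid" where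
  "Aut \<Gamma> = BijGroup (pverts \<Gamma>)
    \<lparr>carrier := {f \<in> Bij (pverts \<Gamma>).
       \<forall>u \<in> pverts \<Gamma>. \<forall>v \<in> pverts \<Gamma>. (f u, f v) \<in> parcs \<Gamma> \<longleftrightarrow> (u, v) \<in> parcs \<Gamma>}\<rparr>"

definition right_mult :: "('a, 'm) monoid_scheme \<Rightarrow> 'a \<Rightarrow> 'a \<Rightarrow> 'a" where
  "right_mult G g = (\<lambda>x \<in> carrier G. x \<otimes>\<^bsub>G\<^esub> g)"

definition right_regular :: "('a, 'm) monoid_scheme \<Rightarrow> ('a \<Rightarrow> 'a) set" where
  "right_regular G = right_mult G ` carrier G"

definition regular_subgroup :: "('v \<Rightarrow> 'v) set \<Rightarrow> 'v pair_pre_digraph \<Rightarrow> bool" where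
  "regular_subgroup P \<Gamma> \<longleftrightarrow>
     subgroup P (Aut \<Gamma>) \<and>
     (\<forall>u \<in> pverts \<Gamma>. \<forall>v \<in> pverts \<Gamma>. \<exists>f \<in> P. f u = v) \<and>
     (\<forall>f \<in> P. (\<exists>v \<in> pverts \<Gamma>. f v = v) \<longrightarrow> f = \<one>\<^bsub>Aut \<Gamma>\<^esub>)"

definition normal_Cayley :: "('a, 'm) monoid_scheme \<Rightarrow> 'a set \<Rightarrow> bool" where
  "normal_Cayley G S \<longleftrightarrow> right_regular G \<lhd> Aut (Cay G S)"

definition NNN_Cayley :: "('a, 'm) monoid_scheme \<Rightarrow> 'a set \<Rightarrow> bool" where
  "NNN_Cayley G S \<longleftrightarrow>
     normal_Cayley G S \<and>
     (\<exists>P. regular_subgroup P (Cay G S) \<and>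
          Aut (Cay G S)\<lparr>carrier := P\<rparr> \<cong> G \<and>
          \<not> P \<lhd> Aut (Cay G S))"

definition NNND_group :: "('a, 'm) monoid_scheme \<Rightarrow> bool" where
  "NNND_group G \<longleftrightarrow>
     group G \<and> finite (carrier G) \<and>
     (\<exists>S. S \<subseteq> carrier G \<and> \<one>\<^bsub>G\<^esub> \<notin> S \<and> NNN_Cayley G S)"

definition NNN_group :: "('a, 'm) monoid_scheme \<Rightarrow> bool" where
  "NNN_group G \<longleftrightarrow>
     group G \<and> finite (carrier G) \<and>
     (\<exists>S. S \<subseteq> carrier G \<and> \<one>\<^bsub>G\<^esub> \<notin> S \<and> S = m_inv G ` S \<and> NNN_Cayley G S)"

lemma Cay_pair_digraph:
  assumes "group G" "finite (carrier G)" "S \<subseteq> carrier G" "\<one>\<^bsub>G\<^esub> \<notin> S"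
  shows "pair_digraph (Cay G S)"
proof -
  interpret group G by fact
  have sub: "parcs (Cay G S) \<subseteq> carrier G \<times> carrier G"
    using assms by (auto simp: Cay_def)
  show ?thesis
  proof
    show "finite (parcs (Cay G S))"
      using sub assms(2) by (meson finite_SigmaI finite_subset)
  next
    fix e assume "e \<in> parcs (Cay G S)"
    then show "fst e \<noteq> snd e"
      using assms by (auto simp: Cay_def subset_iff)
  qed (use assms in \<open>auto simp: Cay_def\<close>)
qed

lemma group_Aut: "group (Aut \<Gamma>)"
proof -
  let ?V = "pverts \<Gamma>"
  interpret B: group "BijGroup ?V" by (rule group_BijGroup)
  have "subgroup (carrier (Aut \<Gamma>)) (BijGroup ?V)"
  proof (rule B.subgroupI, goal_cases)
    case 2
    have "(\<lambda>x \<in> ?V. x) \<in> carrier (Aut \<Gamma>)" by (simp add: Aut_def id_Bij)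
    then show ?case by blast
  next
    case (3 f)
    then have f: "f \<in> Bij ?V"
      and iff: "\<And>u v. u \<in> ?V \<Longrightarrow> v \<in> ?V \<Longrightarrow> (f u, f v) \<in> parcs \<Gamma> \<longleftrightarrow> (u, v) \<in> parcs \<Gamma>"
      by (auto simp: Aut_def)
    have inv: "inv_into ?V f u \<in> ?V" "f (inv_into ?V f u) = u" if "u \<in> ?V" for u
      using f that by (auto simp: Bij_def bij_betw_def inv_into_into f_inv_into_f)
    show ?case
      unfolding inv_BijGroup[OF f]
      using f by (auto simp: Aut_def restrict_inv_into_Bij inv simp flip: iff)
  next
    case (4 f g)
    then have "f \<in> Bij (pverts \<Gamma>)" "g \<in> Bij (pverts \<Gamma>)" "\<And>u. u \<in> pverts \<Gamma> \<Longrightarrow> g u \<in> pverts \<Gamma>"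
      by (auto simp: Aut_def dest: Bij_imp_funcset)
    with 4 show ?case
      by (simp add: Aut_def BijGroup_def compose_Bij compose_eq)
  qed (auto simp: Aut_def BijGroup_def)
  then show ?thesis
    using B.subgroup_imp_group by (simp add: Aut_def)
qed

end

theory Submission
  imports Defs "HOL-Number_Theory.Cong"
begin

text \<open>
  If \<open>R(G)\<close> is normal, every automorphism lies in the holomorph of the dihedral group \<open>G\<close>, whose
  elements for \<open>n \<ge> 3\<close> are affine with a common multiplier \<open>r\<close> on rotations and reflections; \<open>R(G)\<close>
  itself consists of the maps with \<open>r = 1\<close> and opposite shifts. A regular subgroup isomorphic to \<open>G\<close>
  is generated by an image \<open>g\<close> of \<open>a\<close> and an image \<open>t\<close> of \<open>b\<close>. If \<open>g\<close> is a translation, the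
  subgroup is normalised by the whole holomorph; this always happens for odd \<open>n\<close>. For \<open>n = 4\<close> and
  \<open>n = 8\<close> the remaining pairs \<open>(g, t)\<close> can be listed up to powers of \<open>g\<close>, and whenever an automorphism
  fails to normalise \<open>\<langle>g, t\<rangle>\<close>, the automorphism group contains so many affine maps that the digraph
  also has a non-affine automorphism.

  Conversely, for \<open>d\<close> dividing \<open>n\<close> with \<open>3 \<le> d < n\<close>, take as connection set \<open>a\<^sup>\<plusminus>\<^sup>1\<close>, the
  nontrivial powers of \<open>a\<^sup>d\<close>, and all products of powers of \<open>a\<^sup>d\<close> with \<open>b\<close>. The ends of an edge have
  a common neighbour if and only if the edge does not come from \<open>a\<^sup>\<plusminus>\<^sup>1\<close>, so the automorphisms can
  be read off: they are the affine maps with multiplier \<open>\<plusminus>1\<close> whose two shifts have sum divisible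
  by \<open>d\<close>. Shifting only the reflections by \<open>d\<close> then fails to normalise a certain regular dihedral
  subgroup, unless \<open>d\<close> is even and \<open>n\<close> divides \<open>2 d\<close>. For \<open>n = 2 m\<close> take \<open>d = m\<close> if \<open>m\<close> is odd
  and \<open>d = 4\<close> otherwise.
\<close>

section \<open>The holomorph of a dihedral group\<close>

text \<open>\<open>c\<close> shifts the rotations, \<open>d\<close> the reflections, and
  \<open>e\<close> exchanges the two kinds. The parameters are integers rather than residues, so
  compositions are computed without reduction; the restriction makes the maps extensional, as
  \<open>Bij\<close> demands.\<close>

definition aff :: "nat \<Rightarrow> int \<Rightarrow> int \<Rightarrow> int \<Rightarrow> bool \<Rightarrow> int \<times> bool \<Rightarrow> int \<times> bool" where
  "aff n r c d e = (\<lambda>(i, s) \<in> carrier (dihedral n). ((r * i + (if s then d else c)) mod int n, s \<noteq> e))"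

lemma carrier_dihedral: "carrier (dihedral n) = {0..<int n} \<times> UNIV"
  by (simp add: dihedral_def)

lemma mult_dihedral:
  "(i, s) \<otimes>\<^bsub>dihedral n\<^esub> (j, t) = ((if s then i - j else i + j) mod int n, s \<noteq> t)"
  by (simp add: dihedral_def)

lemma aff_apply:
  "0 \<le> i \<Longrightarrow> i < int n \<Longrightarrow>
    aff n r c d e (i, s) = ((r * i + (if s then d else c)) mod int n, s \<noteq> e)"
  by (simp add: aff_def carrier_dihedral)

lemma mult_mod_add: "(r * (i mod m) + c) mod m = (r * i + c) mod m" for r i c m :: int
  by (metis mod_add_left_eq mod_mult_right_eq)

lemma aff_apply_mod:
  "n > 0 \<Longrightarrow> aff n r c d e (i mod int n, s) = ((r * i + (if s then d else c)) mod int n, s \<noteq> e)"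
  by (simp add: aff_apply mult_mod_add)

lemma aff_in: "n > 0 \<Longrightarrow> p \<in> carrier (dihedral n) \<Longrightarrow> aff n r c d e p \<in> carrier (dihedral n)"
  by (cases p) (auto simp: aff_apply carrier_dihedral)

text \<open>If the inner map exchanges the kinds, the outer one meets them exchanged, so its two
  shifts change places.\<close>

lemma aff_comp:
  assumes "n > 0"
  shows "compose (carrier (dihedral n)) (aff n r c d e) (aff n r' c' d' e') =
    aff n (r * r') (r * c' + (if e' then d else c)) (r * d' + (if e' then c else d)) (e \<noteq> e')"
proof (rule extensionalityI)
  show "compose (carrier (dihedral n)) (aff n r c d e) (aff n r' c' d' e') p =
    aff n (r * r') (r * c' + (if e' then d else c)) (r * d' + (if e' then c else d)) (e \<noteq> e') p"
    if p: "p \<in> carrier (dihedral n)" for p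
  proof -
    obtain i s where i: "p = (i, s)" "0 \<le> i" "i < int n"
      using p by (cases p) (auto simp: carrier_dihedral)
    with p assms show ?thesis
      by (simp add: compose_eq aff_apply[OF i(2,3)] aff_apply_mod) (auto simp: algebra_simps)
  qed
qed (auto simp: aff_def compose_def)

text \<open>The values at the vertices \<open>1\<close> and \<open>b\<close> give \<open>c\<close>,
  \<open>e\<close> and \<open>d\<close>; the value at \<open>a\<close> then gives
  \<open>r\<close>.\<close>

lemma aff_eq_iff:
  assumes "n \<ge> 2"
  shows "aff n r c d e = aff n r' c' d' e' \<longleftrightarrow>
    [r = r'] (mod int n) \<and> [c = c'] (mod int n) \<and> [d = d'] (mod int n) \<and> e = e'"
proof
  assume eq: "aff n r c d e = aff n r' c' d' e'"
  have c: "[c = c'] (mod int n)" and e: "e = e'"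
    using fun_cong[OF eq, of "(0, False)"] assms by (auto simp: aff_apply cong_def)
  have d: "[d = d'] (mod int n)"
    using fun_cong[OF eq, of "(0, True)"] assms by (auto simp: aff_apply cong_def)
  have "[r + c = r' + c'] (mod int n)"
    using fun_cong[OF eq, of "(1, False)"] assms by (auto simp: aff_apply cong_def)
  then have "[r = r'] (mod int n)"
    using c by (metis cong_add_rcancel cong_sym cong_trans cong_add_lcancel)
  with c d e show "[r = r'] (mod int n) \<and> [c = c'] (mod int n) \<and> [d = d'] (mod int n) \<and> e = e'"
    by simp
next
  assume "[r = r'] (mod int n) \<and> [c = c'] (mod int n) \<and> [d = d'] (mod int n) \<and> e = e'"
  then have "[r * i + (if s then d else c) = r' * i + (if s then d' else c')] (mod int n)" and "e = e'" for i s
    by (cases s; simp add: cong_add cong_mult)+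
  then show "aff n r c d e = aff n r' c' d' e'"
    unfolding aff_def cong_def by (intro restrict_ext) auto
qed

lemma aff_one: "aff n 1 0 0 False = (\<lambda>p \<in> carrier (dihedral n). p)"
  unfolding aff_def by (intro restrict_ext) (auto simp: carrier_dihedral)

lemma aff_Bij:
  assumes "n > 0" "coprime r (int n)"
  shows "aff n r c d e \<in> Bij (carrier (dihedral n))"
proof -
  have "inj_on (aff n r c d e) (carrier (dihedral n))"
  proof (rule inj_onI)
    fix p q assume pq: "p \<in> carrier (dihedral n)" "q \<in> carrier (dihedral n)"
      and eq: "aff n r c d e p = aff n r c d e q"
    obtain i s j t where "p = (i, s)" "q = (j, t)" "0 \<le> i" "i < int n" "0 \<le> j" "j < int n"
      using pq by (cases p; cases q) (auto simp: carrier_dihedral)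
    moreover from this eq have st: "s = t" by (auto simp: aff_apply)
    with calculation eq have "[r * i + (if s then d else c) = r * j + (if s then d else c)] (mod int n)"
      by (auto simp: aff_apply cong_def)
    then have "[i = j] (mod int n)"
      using assms(2) by (simp only: cong_add_rcancel cong_mult_lcancel)
    ultimately show "p = q" using st by (simp add: cong_def)
  qed
  moreover have "aff n r c d e ` carrier (dihedral n) \<subseteq> carrier (dihedral n)"
    using aff_in[OF assms(1)] by blast
  ultimately have "bij_betw (aff n r c d e) (carrier (dihedral n)) (carrier (dihedral n))"
    by (simp add: bij_betw_def endo_inj_surj carrier_dihedral)
  then show ?thesis by (simp add: Bij_def aff_def)
qed

lemma right_mult_dihedral: "right_mult (dihedral n) (k, e) = aff n 1 k (- k) e"
  unfolding right_mult_def aff_def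
  by (intro restrict_ext) (auto simp: mult_dihedral)

lemma right_regular_dihedral:
  assumes "n > 0"
  shows "right_regular (dihedral n) = {aff n 1 k (- k) e |k e. True}"
proof -
  have "aff n 1 k (- k) e = right_mult (dihedral n) (k mod int n, e)" for k e
    unfolding right_mult_dihedral aff_def
    by (intro restrict_ext) (auto simp: mod_simps)
  moreover have "(k mod int n, e) \<in> carrier (dihedral n)" for k e
    using assms by (simp add: carrier_dihedral)
  ultimately show ?thesis
    unfolding right_regular_def by (fastforce simp: image_iff right_mult_dihedral)
qed

lemma pverts_Cay: "pverts (Cay G S) = carrier G"
  by (simp add: Cay_def)

lemma Aut_mult:
  "f \<in> carrier (Aut \<Gamma>) \<Longrightarrow> h \<in> carrier (Aut \<Gamma>) \<Longrightarrow> f \<otimes>\<^bsub>Aut \<Gamma>\<^esub> h = compose (pverts \<Gamma>) f h"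
  by (simp add: Aut_def BijGroup_def)

lemma Aut_one: "\<one>\<^bsub>Aut \<Gamma>\<^esub> = (\<lambda>x \<in> pverts \<Gamma>. x)"
  by (simp add: Aut_def BijGroup_def)

lemma Aut_iff:
  "f \<in> carrier (Aut \<Gamma>) \<longleftrightarrow> f \<in> Bij (pverts \<Gamma>) \<and>
    (\<forall>u \<in> pverts \<Gamma>. \<forall>v \<in> pverts \<Gamma>. (f u, f v) \<in> parcs \<Gamma> \<longleftrightarrow> (u, v) \<in> parcs \<Gamma>)"
  by (simp add: Aut_def)


lemma Bij_maps: "f \<in> Bij V \<Longrightarrow> p \<in> V \<Longrightarrow> f p \<in> V"
  using Bij_imp_funcset by blast

text \<open>Along the steps the kind of the image is constant on the rotations and on the
  reflections, and surjectivity forbids that both constants agree.\<close>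

lemma block_map:
  assumes n: "n > 0" and f: "f \<in> Bij (carrier (dihedral n))"
    and step: "\<And>i s. snd (f ((i + 1) mod int n, s)) = snd (f (i mod int n, s))"
  obtains e where "\<And>i s. snd (f (i mod int n, s)) = (s \<noteq> e)"
proof -
  have nat: "snd (f (int i mod int n, s)) = snd (f (0, s))" for i s
  proof (induction i)
    case (Suc i)
    have "int (Suc i) mod int n = (int i + 1) mod int n" by (simp add: add.commute)
    then show ?case by (simp only: step Suc)
  qed simp
  have const: "snd (f (i mod int n, s)) = snd (f (0, s))" for i s
    using nat[of "nat (i mod int n)" s] n by simp
  have "snd (f (0, True)) \<noteq> snd (f (0, False))"
  proof
    assume eq: "snd (f (0, True)) = snd (f (0, False))"
    have "(0, \<not> snd (f (0, False))) \<in> f ` carrier (dihedral n)"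
      using f n by (auto simp: Bij_def bij_betw_def carrier_dihedral)
    then obtain p where p: "p \<in> carrier (dihedral n)" "f p = (0, \<not> snd (f (0, False)))"
      by (metis imageE)
    obtain i s where "p = (i mod int n, s)"
      using p(1) by (cases p) (auto simp: carrier_dihedral intro: mod_pos_pos_trivial[symmetric])
    then have "snd (f (0, s)) = (\<not> snd (f (0, False)))" using const[of i s] p(2) by simp
    with eq show False by (cases s) auto
  qed
  then have zero: "snd (f (0, s)) = (s \<noteq> snd (f (0, False)))" for s by (cases s) auto
  show ?thesis by (rule that[OF trans[OF const zero]])
qed

lemma aff_steps:
  assumes n: "n > 0" and f: "f \<in> Bij (carrier (dihedral n))"
    and step: "\<And>i s. fst (f ((i + 1) mod int n, s)) = (fst (f (i mod int n, s)) + r) mod int n"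
    and block: "\<And>i s. snd (f (i mod int n, s)) = (s \<noteq> e)"
  shows "f = aff n r (fst (f (0, False))) (fst (f (0, True))) e"
proof (rule extensionalityI)
  show "f \<in> extensional (carrier (dihedral n))" using f by (simp add: Bij_def)
  have nat: "fst (f (int i mod int n, s)) = (r * int i + fst (f (0, s))) mod int n" for i s
  proof (induction i)
    case 0
    have "f (0, s) \<in> carrier (dihedral n)" by (rule Bij_maps[OF f]) (use n in \<open>simp add: carrier_dihedral\<close>)
    then have "fst (f (0, s)) \<in> {0..<int n}" by (simp add: carrier_dihedral mem_Times_iff)
    then show ?case by simp
  next
    case (Suc i)
    have "int (Suc i) mod int n = (int i + 1) mod int n" by (simp add: add.commute)
    then show ?case by (simp only: step Suc) (simp add: mod_simps algebra_simps)
  qed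
  show "f p = aff n r (fst (f (0, False))) (fst (f (0, True))) e p"
    if p: "p \<in> carrier (dihedral n)" for p
  proof -
    obtain i s where i: "p = (i, s)" "0 \<le> i" "i < int n"
      using p by (cases p) (auto simp: carrier_dihedral)
    have "fst (f (i, s)) = (r * i + fst (f (0, s))) mod int n" and "snd (f (i, s)) = (s \<noteq> e)"
      using nat[of "nat i" s] block[of i s] i by simp_all
    then show ?thesis
      unfolding i(1) aff_apply[OF i(2,3)] by (cases s) (simp_all add: prod_eq_iff)
  qed
qed (simp add: aff_def)

section \<open>Automorphisms of normal Cayley digraphs\<close>

text \<open>For \<open>n = 2\<close> a group automorphism may send \<open>a\<close> to a reflection
  and is then not affine, so that case is treated separately.\<close>

locale normal_dihedral_Cayley =
  fixes n :: nat and S :: "(int \<times> bool) set"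
  assumes n: "n \<ge> 3" and normal: "normal_Cayley (dihedral n) S"
begin

abbreviation A where "A \<equiv> Aut (Cay (dihedral n) S)"
abbreviation V where "V \<equiv> carrier (dihedral n)"

definition M where "M r c d e \<longleftrightarrow> aff n r c d e \<in> carrier A"

sublocale A: group A
  by (rule group_Aut)

lemma A_mult: "f \<in> carrier A \<Longrightarrow> h \<in> carrier A \<Longrightarrow> f \<otimes>\<^bsub>A\<^esub> h = compose V f h"
  by (simp add: Aut_mult pverts_Cay)

lemma A_Bij: "f \<in> carrier A \<Longrightarrow> f \<in> Bij V"
  by (simp add: Aut_iff pverts_Cay)

lemma M_right: "M 1 k (- k) e"
proof -
  have "right_regular (dihedral n) \<subseteq> carrier A"
    using normal by (simp add: normal_Cayley_def normal_def subgroup_def)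
  then show ?thesis
    using n unfolding M_def by (auto simp: right_regular_dihedral)
qed

lemma M_mult:
  assumes "M r c d e" "M r' c' d' e'"
  shows "M (r * r') (r * c' + (if e' then d else c)) (r * d' + (if e' then c else d)) (e \<noteq> e')"
  using A.m_closed[OF assms[unfolded M_def]] n
  by (simp add: A_mult[OF assms[unfolded M_def]] aff_comp M_def)

lemma M_cong:
  assumes "M r c d e" "[r = r'] (mod int n)" "[c = c'] (mod int n)" "[d = d'] (mod int n)"
  shows "M r' c' d' e"
proof -
  have "aff n r c d e = aff n r' c' d' e" using n assms(2-) by (simp add: aff_eq_iff)
  then show ?thesis using assms(1) by (simp add: M_def)
qed

text \<open>Conjugating \<open>R(a)\<close> by \<open>f\<close> gives an element of
  \<open>R(G)\<close>. It must be some \<open>R(a^k)\<close>, since the exchanging elements of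
  \<open>R(G)\<close> are involutions while the square of \<open>R(a)\<close> is not the identity.
  Commuting \<open>f\<close> past \<open>R(a)\<close> then moves images by steps of \<open>k\<close>
  or \<open>- k\<close>.\<close>

lemma automorphism_aff:
  assumes f: "f \<in> carrier A"
  obtains r c d e where "f = aff n r c d e"
proof -
  define a where "a = aff n 1 1 (- 1) False"
  have aA: "a \<in> carrier A" using M_right[of 1 False] by (simp add: M_def a_def)
  have aR: "a \<in> right_regular (dihedral n)"
    using n unfolding a_def by (auto simp: right_regular_dihedral)
  interpret R: normal "right_regular (dihedral n)" A
    using normal by (simp add: normal_Cayley_def)
  have "f \<otimes>\<^bsub>A\<^esub> a \<otimes>\<^bsub>A\<^esub> inv\<^bsub>A\<^esub> f \<in> right_regular (dihedral n)"
    by (rule R.inv_op_closed2[OF f aR])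
  then obtain k e where b: "f \<otimes>\<^bsub>A\<^esub> a \<otimes>\<^bsub>A\<^esub> inv\<^bsub>A\<^esub> f = aff n 1 k (- k) e"
    using n by (auto simp: right_regular_dihedral)
  define b where "b = aff n 1 k (- k) e"
  have bA: "b \<in> carrier A" using M_right[of k e] by (simp add: M_def b_def)
  have fa: "f \<otimes>\<^bsub>A\<^esub> a = b \<otimes>\<^bsub>A\<^esub> f"
    using b f aA by (metis A.inv_solve_right' A.m_closed b_def bA A.inv_closed)
  have "\<not> e"
  proof
    assume e
    then have "b \<otimes>\<^bsub>A\<^esub> b = \<one>\<^bsub>A\<^esub>"
      using n bA by (simp add: A_mult Aut_one pverts_Cay b_def aff_comp flip: aff_one)
    then have "f \<otimes>\<^bsub>A\<^esub> (a \<otimes>\<^bsub>A\<^esub> a) = f"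
      using fa f aA bA by (metis A.m_assoc A.l_one)
    then have "a \<otimes>\<^bsub>A\<^esub> a = \<one>\<^bsub>A\<^esub>"
      using f aA by (simp add: A.r_cancel_one)
    then have "aff n 1 2 (- 2) False = aff n 1 0 0 False"
      using n aA by (simp add: A_mult Aut_one pverts_Cay a_def aff_comp flip: aff_one)
    then have "int n dvd 2"
      using n by (simp add: aff_eq_iff cong_iff_dvd_diff)
    then show False using n by (auto dest: zdvd_imp_le)
  qed
  have fV: "f p \<in> V" if "p \<in> V" for p
    using A_Bij[OF f] that by (rule Bij_maps)
  have comm: "f (a p) = b (f p)" if "p \<in> V" for p
    using fun_cong[OF fa, of p] that f aA bA by (simp add: A_mult compose_eq)
  have step: "f ((i + 1) mod int n, s) =
      ((fst (f (i mod int n, s)) + (if snd (f (i mod int n, s)) = s then k else - k)) mod int n, snd (f (i mod int n, s)))"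
    for i s
  proof (cases s)
    case False
    have "f (i mod int n, s) \<in> V" using fV n by (simp add: carrier_dihedral)
    moreover have "a (i mod int n, s) = ((i + 1) mod int n, s)"
      using n False by (simp add: a_def aff_apply_mod)
    ultimately show ?thesis
      using comm[of "(i mod int n, s)"] n False \<open>\<not> e\<close>
      by (cases "f (i mod int n, s)") (auto simp: b_def aff_apply carrier_dihedral algebra_simps)
  next
    case True
    \<comment> \<open>\<open>R(a)\<close> moves reflections backwards, so the relation is applied at
      \<open>i + 1\<close> instead of \<open>i\<close>.\<close>
    have "f ((i + 1) mod int n, s) \<in> V" using fV n by (simp add: carrier_dihedral)
    moreover have "a ((i + 1) mod int n, s) = (i mod int n, s)"
      using n True by (simp add: a_def aff_apply_mod)
    ultimately show ?thesis
      using comm[of "((i + 1) mod int n, s)"] n True \<open>\<not> e\<close>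
      by (cases "f ((i + 1) mod int n, s)")
        (auto simp: b_def aff_apply carrier_dihedral mod_simps algebra_simps)
  qed
  have n0: "n > 0" using n by simp
  obtain e where e: "\<And>i s. snd (f (i mod int n, s)) = (s \<noteq> e)"
    using block_map[OF n0 A_Bij[OF f]] step by auto
  have "f = aff n (if e then - k else k) (fst (f (0, False))) (fst (f (0, True))) e"
    by (rule aff_steps[OF n0 A_Bij[OF f] _ e]) (use step e in auto)
  then show ?thesis by (rule that)
qed

lemma A_M:
  assumes "f \<in> carrier A"
  obtains r c d e where "f = aff n r c d e" "M r c d e"
proof -
  obtain r c d e where "f = aff n r c d e" by (rule automorphism_aff[OF assms])
  with assms that show ?thesis by (simp add: M_def)
qed

text \<open>Exponents are reduced inside, so that arcs can be carried along affine maps with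
  arbitrary integer arguments.\<close>

definition arc where
  "arc i s j t \<longleftrightarrow> ((i mod int n, s), (j mod int n, t)) \<in> parcs (Cay (dihedral n) S)"

lemma arc_cong:
  "[i = i'] (mod int n) \<Longrightarrow> [j = j'] (mod int n) \<Longrightarrow> arc i s j t \<longleftrightarrow> arc i' s j' t"
  by (simp add: arc_def cong_def)

lemma M_arc:
  assumes "M r c d e"
  shows "arc (r * i + (if s then d else c)) (s \<noteq> e) (r * j + (if t then d else c)) (t \<noteq> e) \<longleftrightarrow> arc i s j t"
proof -
  have "(i mod int n, s) \<in> V" "(j mod int n, t) \<in> V" using n by (auto simp: carrier_dihedral)
  then have "(aff n r c d e (i mod int n, s), aff n r c d e (j mod int n, t)) \<in> parcs (Cay (dihedral n) S)
    \<longleftrightarrow> ((i mod int n, s), (j mod int n, t)) \<in> parcs (Cay (dihedral n) S)"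
    using assms unfolding M_def Aut_iff pverts_Cay by blast
  then show ?thesis
    using n by (simp add: arc_def aff_apply_mod)
qed

lemma automorphismI:
  assumes f: "f \<in> Bij V"
    and "\<And>i s j t. 0 \<le> i \<Longrightarrow> i < int n \<Longrightarrow> 0 \<le> j \<Longrightarrow> j < int n \<Longrightarrow>
      arc (fst (f (i, s))) (snd (f (i, s))) (fst (f (j, t))) (snd (f (j, t))) \<longleftrightarrow> arc i s j t"
  shows "f \<in> carrier A"
  unfolding Aut_iff pverts_Cay
proof (intro conjI ballI)
  fix u v assume uv: "u \<in> V" "v \<in> V"
  obtain i s j t where ij: "u = (i, s)" "v = (j, t)" "0 \<le> i" "i < int n" "0 \<le> j" "j < int n"
    using uv by (cases u; cases v) (auto simp: carrier_dihedral)
  have arc: "(p, q) \<in> parcs (Cay (dihedral n) S) \<longleftrightarrow> arc (fst p) (snd p) (fst q) (snd q)"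
    if "p \<in> V" "q \<in> V" for p q
    using that by (auto simp: arc_def carrier_dihedral)
  show "(f u, f v) \<in> parcs (Cay (dihedral n) S) \<longleftrightarrow> (u, v) \<in> parcs (Cay (dihedral n) S)"
    using assms(2)[OF ij(3-6)] ij(1,2) uv by (simp add: arc Bij_maps[OF f])
qed (rule f)

text \<open>An automorphism is injective, so its multiplier is a unit modulo \<open>n\<close>; this
  is the cancellation form of that fact.\<close>

lemma M_inj:
  assumes "M r c d e" "[r * i = r * j] (mod int n)"
  shows "[i = j] (mod int n)"
proof -
  have "aff n r c d e (i mod int n, False) = aff n r c d e (j mod int n, False)"
    using n assms(2) cong_add_rcancel[of "r * i" c "r * j" "int n"]
    by (simp add: aff_apply_mod cong_def)
  moreover have "inj_on (aff n r c d e) V"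
    using A_Bij assms(1) by (simp add: M_def Bij_def bij_betw_def)
  moreover have "(i mod int n, False) \<in> V" "(j mod int n, False) \<in> V"
    using n by (simp_all add: carrier_dihedral)
  ultimately show ?thesis
    unfolding cong_def by (metis inj_onD prod.inject)
qed

text \<open>An even multiplier would send half of \<open>n\<close> to \<open>0\<close>.\<close>

lemma M_odd:
  assumes "M r c d e" "even n"
  shows "odd r"
proof
  assume "even r"
  then obtain r' where r': "r = 2 * r'" by (rule evenE)
  obtain m where m: "n = 2 * m" using assms(2) by (rule evenE)
  have "[r * int m = r * 0] (mod int n)"
    by (simp add: r' m cong_iff_dvd_diff)
  then have "[int m = 0] (mod int n)"
    by (rule M_inj[OF assms(1)])
  then have "n dvd m"
    by (simp add: cong_iff_dvd_diff)
  then show False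
    using n m by (auto dest: dvd_imp_le)
qed

end

section \<open>Non-affine automorphisms that exclude certain shifts of the reflections\<close>

context normal_dihedral_Cayley
begin

lemma arc_mod: "arc (i mod int n) s j t \<longleftrightarrow> arc i s j t" "arc i s (j mod int n) t \<longleftrightarrow> arc i s j t"
  by (simp_all add: arc_def)

lemma M_pow:
  assumes "M 1 c d False"
  shows "M 1 (k * c) (k * d) False"
proof -
  have nat: "M 1 (int k * c) (int k * d) False" for k
  proof (induction k)
    case 0
    show ?case using M_right[of 0 False] by simp
  next
    case (Suc k)
    from M_mult[OF Suc assms] show ?case by (simp add: algebra_simps)
  qed
  have "[int (nat (k mod int n)) = k] (mod int n)"
    using n by (simp add: cong_def)
  then show ?thesis
    using M_cong[OF nat[of "nat (k mod int n)"], of 1 "k * c" "k * d"]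
    by (simp add: cong_mult)
qed

text \<open>Composing with elements of \<open>R(G)\<close> makes the vertex \<open>1\<close> fixed
  and keeps the sum of the two shifts, because the shifts of an element of \<open>R(G)\<close> are
  opposite.\<close>

lemma M_fix:
  assumes "M r c d e"
  shows "M r 0 (c + d) False"
proof -
  have "M r c d False \<or> M r d c False"
    using M_mult[OF assms M_right[of 0 True]] assms by (cases e) auto
  then show ?thesis
    using M_mult[OF M_right[of "- c" False], of r c d False]
      M_mult[OF M_right[of "- d" False], of r d c False]
    by (auto simp: algebra_simps)
qed

text \<open>
  If a shift of the reflections by 2 is an automorphism, multiplying only the rotations by \<open>r\<close>
  preserves all arcs: \<open>r i - i\<close> is even, so arcs between the two kinds cannot tell the difference.
\<close>

lemma no_shift_by_2:
  assumes "even n" "M 1 0 2 False" "M r c d e"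
  shows "[r = 1] (mod int n)"
proof -
  have r: "M r 0 (c + d) False" by (rule M_fix[OF assms(3)])
  have shift: "M 1 (2 * k) 0 False" for k
    using M_mult[OF M_right[of "2 * k" False] M_pow[OF assms(2), of k]]
    by (simp add: algebra_simps)
  define f where "f = (\<lambda>(i, s) \<in> V. ((if s then i else r * i) mod int n, s))"
  have f: "f (i, s) = ((if s then i else r * i) mod int n, s)" if "0 \<le> i" "i < int n" for i s
    using that by (simp add: f_def carrier_dihedral)
  have "inj_on f V"
  proof (rule inj_onI)
    fix p q assume pq: "p \<in> V" "q \<in> V" "f p = f q"
    obtain i s j t where ij: "p = (i, s)" "q = (j, t)" "0 \<le> i" "i < int n" "0 \<le> j" "j < int n"
      using pq by (cases p; cases q) (auto simp: carrier_dihedral)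
    have "s = t" "[(if s then i else r * i) = (if s then j else r * j)] (mod int n)"
      using pq(3) ij by (auto simp: f cong_def)
    then have "[i = j] (mod int n)"
      using M_inj[OF assms(3)] by (cases s) auto
    then show "p = q" using ij \<open>s = t\<close> by (simp add: cong_def)
  qed
  moreover have "f ` V \<subseteq> V"
    using n by (auto simp: f_def carrier_dihedral)
  ultimately have "bij_betw f V V"
    by (simp add: bij_betw_def endo_inj_surj carrier_dihedral)
  then have "f \<in> Bij V" by (simp add: Bij_def f_def)
  then have "f \<in> carrier A"
  proof (rule automorphismI)
    fix i s j t assume ij: "0 \<le> i" "i < int n" "0 \<le> j" "j < int n"
    obtain k where k: "r = 2 * k + 1"
      using M_odd[OF assms(3,1)] by (rule oddE)
    have rk: "r * x = x + 2 * (k * x)" for x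
      by (simp add: k algebra_simps)
    show "arc (fst (f (i, s))) (snd (f (i, s))) (fst (f (j, t))) (snd (f (j, t))) \<longleftrightarrow> arc i s j t"
      using M_arc[OF r, of i False j False] M_arc[OF shift[of "k * i"], of i False j True]
        M_arc[OF shift[of "k * j"], of i True j False]
      by (cases s; cases t) (simp_all add: f[OF ij(1,2)] f[OF ij(3,4)] arc_mod rk add.commute)
  qed
  then obtain r' c' d' e' where f': "f = aff n r' c' d' e'"
    by (rule automorphism_aff)
  \<comment> \<open>On the reflections \<open>f\<close> has multiplier \<open>1\<close> and on the
    rotations \<open>r\<close>; an affine map has only one.\<close>
  have "f (0, True) = (0, True)" "f (1, True) = (1, True)" "f (0, False) = (0, False)"
    using n by (simp_all add: f)
  then have e': "\<not> e'" and c': "c' mod int n = 0" and d': "d' mod int n = 0" and "(r' + d') mod int n = 1"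
    using n unfolding f' by (auto simp: aff_apply)
  then have r': "r' mod int n = 1"
    by (metis add.right_neutral mod_add_right_eq)
  have "r mod int n = (r' + c') mod int n"
    using f[of 1 False] n unfolding f' by (simp add: aff_apply)
  also have "\<dots> = 1"
    using c' r' by (metis add.right_neutral mod_add_right_eq)
  finally show ?thesis using n by (simp add: cong_def)
qed

text \<open>Here the vertices \<open>1\<close> and \<open>a\<^sup>4\<close> are twins, so their transposition is an automorphism.\<close>

lemma no_shift_by_4:
  assumes n8: "n = 8" and "M 1 0 4 False" "M 5 c d e" "M r c' d' e'" "[r = 3] (mod 4)"
  shows False
proof -
  have r5: "M 5 0 (c + d) False" and r: "M r 0 (c' + d') False"
    using M_fix assms(3,4) by blast+
  have s40: "M 1 4 0 False"
    using M_mult[OF M_right[of 4 False] assms(2)] by simp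
  have s4: "arc (i + 4) False (j + 4) False \<longleftrightarrow> arc i False j False" for i j
    using M_arc[OF M_right[of 4 False], of i False j False] by (simp add: add.commute)
  \<comment> \<open>Multiplier \<open>5\<close> adds \<open>4\<close> to odd \<open>j\<close>, and
    \<open>r\<close> adds \<open>4\<close> to \<open>j\<close> equal to \<open>2\<close> modulo
    \<open>4\<close>. Fixing \<open>0\<close> while moving \<open>j\<close> to \<open>j + 4\<close>,
    and then shifting by \<open>4\<close>, turns an arc between \<open>0\<close> and
    \<open>j\<close> into one between \<open>4\<close> and \<open>j\<close>.\<close>
  have mult: "\<exists>v \<gamma>. M v 0 \<gamma> False \<and> [v * j = j + 4] (mod 8)" if j: "\<not> 4 dvd j" for j
  proof (cases "odd j")
    case True
    then have "8 dvd 5 * j - (j + 4)" by presburger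
    then show ?thesis using r5 by (auto simp: cong_iff_dvd_diff)
  next
    case False
    then obtain m where m: "j = 2 * m" using evenE by blast
    with j have "odd m" by auto
    then obtain a where "m = 2 * a + 1" by (rule oddE)
    moreover obtain b where "r = 3 + 4 * b"
      using assms(5) by (metis cong_iff_lin cong_sym mult.commute)
    ultimately have "r * j - (j + 4) = 8 * (a + b + 2 * a * b)"
      by (simp add: m algebra_simps)
    then have "8 dvd r * j - (j + 4)" by simp
    then show ?thesis using r by (auto simp: cong_iff_dvd_diff)
  qed
  have twin: "arc 0 False j t \<longleftrightarrow> arc 4 False j t" "arc j t 0 False \<longleftrightarrow> arc j t 4 False"
    if j: "t \<or> \<not> 4 dvd j" for j t
  proof (atomize (full), cases t)
    case True
    then show "(arc 0 False j t \<longleftrightarrow> arc 4 False j t) \<and> (arc j t 0 False \<longleftrightarrow> arc j t 4 False)"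
      using M_arc[OF s40, of 0 False j True] M_arc[OF s40, of j True 0 False] by simp
  next
    case False
    then obtain v \<gamma> where v: "M v 0 \<gamma> False" "[v * j = j + 4] (mod 8)"
      using mult j by blast
    have "arc 0 False j False \<longleftrightarrow> arc 0 False (j + 4) False"
      using M_arc[OF v(1), of 0 False j False] arc_cong[of 0 0 "v * j" "j + 4"] v(2) n8 by simp
    also have "\<dots> \<longleftrightarrow> arc 4 False (j + 8) False"
      using s4[of 0 "j + 4"] by (simp add: add.assoc)
    also have "\<dots> \<longleftrightarrow> arc 4 False j False"
      using n8 by (intro arc_cong) (simp_all add: cong_iff_dvd_diff)
    finally have 1: "arc 0 False j False \<longleftrightarrow> arc 4 False j False" .
    have "arc j False 0 False \<longleftrightarrow> arc (j + 4) False 0 False"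
      using M_arc[OF v(1), of j False 0 False] arc_cong[of "v * j" "j + 4" 0 0] v(2) n8 by simp
    also have "\<dots> \<longleftrightarrow> arc (j + 8) False 4 False"
      using s4[of "j + 4" 0] by (simp add: add.assoc)
    also have "\<dots> \<longleftrightarrow> arc j False 4 False"
      using n8 by (intro arc_cong) (simp_all add: cong_iff_dvd_diff)
    finally show "(arc 0 False j t \<longleftrightarrow> arc 4 False j t) \<and> (arc j t 0 False \<longleftrightarrow> arc j t 4 False)"
      using 1 False by simp
  qed
  define h where "h i = (if i = 0 then 4 else if i = 4 then 0 else i)" for i :: int
  define f where "f = (\<lambda>(i, s) \<in> V. (if s then i else h i, s))"
  have f: "f (i, s) = (if s then i else h i, s)" if "0 \<le> i" "i < 8" for i s
    using that n8 by (simp add: f_def carrier_dihedral)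
  have "bij_betw f V V"
    by (rule bij_betw_byWitness[where f' = f]) (auto simp: f_def h_def carrier_dihedral n8)
  then have "f \<in> Bij V" by (simp add: Bij_def f_def)
  then have "f \<in> carrier A"
  proof (rule automorphismI)
    fix i s j t assume ij: "0 \<le> i" "i < int n" "0 \<le> j" "j < int n"
    have "\<not> 4 dvd x" if "x \<noteq> 0" "x \<noteq> 4" "x \<in> {i, j}" for x
      using that ij n8 by auto
    note tw = twin[of _ i] twin[of _ j] twin[of True] this
    have "arc 4 False 4 False \<longleftrightarrow> arc 0 False 0 False" using s4[of 0 0] by simp
    moreover have "arc 4 False 0 False \<longleftrightarrow> arc 0 False 4 False"
      using s4[of 0 4] arc_cong[of 4 4 8 0] n8 by (simp add: cong_def)
    ultimately show "arc (fst (f (i, s))) (snd (f (i, s))) (fst (f (j, t))) (snd (f (j, t))) \<longleftrightarrow> arc i s j t"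
      using ij n8 tw by (cases s; cases t) (auto simp: f h_def)
  qed
  then obtain r' c' d' e' where f': "f = aff n r' c' d' e'"
    by (rule automorphism_aff)
  \<comment> \<open>The reflections force multiplier \<open>1\<close>, and the exchange of
    \<open>0\<close> and \<open>4\<close> forces the rotation shift \<open>4\<close>; but then
    \<open>1\<close> could not be fixed.\<close>
  have "f (0, True) = (0, True)" "f (1, True) = (1, True)" "f (0, False) = (4, False)" "f (1, False) = (1, False)"
    using n by (simp_all add: f h_def)
  then have "\<not> e'" "c' mod 8 = 4" "d' mod 8 = 0" "(r' + d') mod 8 = 1" "(r' + c') mod 8 = 1"
    unfolding f' using n8 by (auto simp: aff_apply)
  then show False by presburger
qed

end

section \<open>Regular dihedral subgroups\<close>

locale regular_dihedral_subgroup = normal_dihedral_Cayley +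
  fixes P :: "(int \<times> bool \<Rightarrow> int \<times> bool) set" and \<phi>
  assumes regular: "regular_subgroup P (Cay (dihedral n) S)"
    and iso: "\<phi> \<in> iso (dihedral n) (A\<lparr>carrier := P\<rparr>)"
begin

definition Q where "Q r c d e \<longleftrightarrow> aff n r c d e \<in> P"

text \<open>The image of \<open>a^k b^e\<close>, with \<open>k\<close> an arbitrary integer so that
  the dihedral relations can be used without reduction.\<close>

definition gp where "gp k e = \<phi> (k mod int n, e)"

lemma P_subgroup: "subgroup P A"
  using regular by (simp add: regular_subgroup_def)

lemma P_sub: "p \<in> P \<Longrightarrow> p \<in> carrier A"
  using P_subgroup by (rule subgroup.mem_carrier)

lemma Q_M: "Q r c d e \<Longrightarrow> M r c d e"
  by (simp add: Q_def M_def P_sub)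

lemma Q_mult:
  assumes "Q r c d e" "Q r' c' d' e'"
  shows "Q (r * r') (r * c' + (if e' then d else c)) (r * d' + (if e' then c else d)) (e \<noteq> e')"
  using subgroup.m_closed[OF P_subgroup assms[unfolded Q_def]] n
  by (simp add: A_mult[OF P_sub P_sub] assms[unfolded Q_def] aff_comp Q_def)

lemma Q_cong:
  assumes "Q r c d e" "[r = r'] (mod int n)" "[c = c'] (mod int n)" "[d = d'] (mod int n)"
  shows "Q r' c' d' e"
proof -
  have "aff n r c d e = aff n r' c' d' e" using n assms(2-) by (simp add: aff_eq_iff)
  then show ?thesis using assms(1) by (simp add: Q_def)
qed

lemma gp_in: "gp k e \<in> P"
  using iso n by (auto simp: gp_def iso_def bij_betw_def carrier_dihedral)

lemma gp_mult: "gp k e \<otimes>\<^bsub>A\<^esub> gp j f = gp (if e then k - j else k + j) (e \<noteq> f)"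
proof -
  have "(k mod int n, e) \<in> V" "(j mod int n, f) \<in> V"
    using n by (simp_all add: carrier_dihedral)
  then have "\<phi> ((k mod int n, e) \<otimes>\<^bsub>dihedral n\<^esub> (j mod int n, f)) = gp k e \<otimes>\<^bsub>A\<^esub> gp j f"
    using iso by (simp add: gp_def iso_def hom_def)
  then show ?thesis
    by (cases e) (simp_all add: gp_def mult_dihedral mod_diff_eq mod_add_eq)
qed

lemma gp_eq_iff: "gp k e = gp j f \<longleftrightarrow> [k = j] (mod int n) \<and> e = f"
proof -
  have "inj_on \<phi> V" using iso by (simp add: iso_def bij_betw_def)
  then show ?thesis
    using n by (simp add: gp_def inj_on_eq_iff carrier_dihedral cong_def)
qed

lemma gp_surj:
  assumes "p \<in> P"
  obtains k e where "p = gp (int k) e"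
proof -
  obtain v where v: "v \<in> V" "p = \<phi> v"
    using iso assms by (auto simp: iso_def bij_betw_def)
  then have "p = gp (int (nat (fst v))) (snd v)"
    by (auto simp: gp_def carrier_dihedral)
  then show ?thesis by (rule that)
qed

lemma gp_0: "gp 0 False = \<one>\<^bsub>A\<^esub>"
proof -
  have "gp 0 False \<otimes>\<^bsub>A\<^esub> gp 0 False = gp 0 False" by (simp add: gp_mult)
  then show ?thesis using P_sub[OF gp_in] A.r_cancel_one by blast
qed

lemma gp_aff:
  obtains r c d e' where "gp k e = aff n r c d e'" "Q r c d e'"
proof -
  obtain r c d e' where "gp k e = aff n r c d e'"
    by (rule automorphism_aff[OF P_sub[OF gp_in]])
  then show ?thesis using that gp_in[of k e] by (simp add: Q_def)
qed

lemma Q_fixpoint: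
  assumes "Q r c d False" "[r * i + (if s then d else c) = i] (mod int n)"
  shows "aff n r c d False = gp 0 False"
proof -
  have "aff n r c d False (i mod int n, s) = (i mod int n, s)"
    using n assms(2) by (simp add: aff_apply_mod cong_def)
  moreover have "(i mod int n, s) \<in> V"
    using n by (simp add: carrier_dihedral)
  ultimately show ?thesis
    using regular assms(1) unfolding regular_subgroup_def pverts_Cay gp_0 Q_def by blast
qed

lemma transitive:
  obtains p where "p \<in> P" "p (0, False) = (x mod int n, s)"
proof -
  have "(0, False) \<in> V" "(x mod int n, s) \<in> V"
    using n by (simp_all add: carrier_dihedral)
  then show ?thesis
    using regular that unfolding regular_subgroup_def pverts_Cay by blast
qed

text \<open>Stated without inverses, so that it is checked by composing affine maps.\<close>

definition normalises where
  "normalises f \<longleftrightarrow> f \<in> carrier A \<and> (\<forall>p \<in> P. \<exists>q \<in> P. f \<otimes>\<^bsub>A\<^esub> p = q \<otimes>\<^bsub>A\<^esub> f)"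

lemma normalises_mult:
  assumes "normalises f" "normalises h"
  shows "normalises (f \<otimes>\<^bsub>A\<^esub> h)"
  unfolding normalises_def
proof (intro conjI ballI)
  have fh: "f \<in> carrier A" "h \<in> carrier A" using assms by (auto simp: normalises_def)
  then show "f \<otimes>\<^bsub>A\<^esub> h \<in> carrier A" by simp
  fix p assume p: "p \<in> P"
  then obtain q where q: "q \<in> P" "h \<otimes>\<^bsub>A\<^esub> p = q \<otimes>\<^bsub>A\<^esub> h"
    using assms(2) by (auto simp: normalises_def)
  then obtain q' where q': "q' \<in> P" "f \<otimes>\<^bsub>A\<^esub> q = q' \<otimes>\<^bsub>A\<^esub> f"
    using assms(1) by (auto simp: normalises_def)
  have "f \<otimes>\<^bsub>A\<^esub> h \<otimes>\<^bsub>A\<^esub> p = q' \<otimes>\<^bsub>A\<^esub> (f \<otimes>\<^bsub>A\<^esub> h)"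
    using fh p q q' by (metis A.m_assoc P_sub)
  with q' show "\<exists>q \<in> P. f \<otimes>\<^bsub>A\<^esub> h \<otimes>\<^bsub>A\<^esub> p = q \<otimes>\<^bsub>A\<^esub> (f \<otimes>\<^bsub>A\<^esub> h)" by blast
qed

text \<open>The elements that \<open>f\<close> carries past itself within \<open>P\<close> are
  closed under products, and the images of \<open>a\<close> and of any one reflection generate
  \<open>P\<close>. Leaving \<open>j\<close> free allows a convenient reflection to be
  chosen.\<close>

lemma normalises_generators:
  assumes f: "f \<in> carrier A"
    and a: "\<exists>q \<in> P. f \<otimes>\<^bsub>A\<^esub> gp 1 False = q \<otimes>\<^bsub>A\<^esub> f"
    and b: "\<exists>q \<in> P. f \<otimes>\<^bsub>A\<^esub> gp j True = q \<otimes>\<^bsub>A\<^esub> f"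
  shows "normalises f"
  unfolding normalises_def
proof (intro conjI ballI)
  let ?X = "\<lambda>p. \<exists>q \<in> P. f \<otimes>\<^bsub>A\<^esub> p = q \<otimes>\<^bsub>A\<^esub> f"
  have mult: "?X (p \<otimes>\<^bsub>A\<^esub> p')" if X: "?X p" "?X p'" and "p \<in> P" "p' \<in> P" for p p'
  proof -
    obtain q q' where q: "q \<in> P" "q' \<in> P" "f \<otimes>\<^bsub>A\<^esub> p = q \<otimes>\<^bsub>A\<^esub> f" "f \<otimes>\<^bsub>A\<^esub> p' = q' \<otimes>\<^bsub>A\<^esub> f"
      using X by blast
    have "f \<otimes>\<^bsub>A\<^esub> (p \<otimes>\<^bsub>A\<^esub> p') = (q \<otimes>\<^bsub>A\<^esub> q') \<otimes>\<^bsub>A\<^esub> f"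
      using f q that by (metis A.m_assoc P_sub)
    moreover have "q \<otimes>\<^bsub>A\<^esub> q' \<in> P"
      using q P_subgroup by (simp add: subgroup.m_closed)
    ultimately show ?thesis by blast
  qed
  have pow: "?X (gp (int k) False)" for k
  proof (induction k)
    case 0
    have "f \<otimes>\<^bsub>A\<^esub> gp 0 False = gp 0 False \<otimes>\<^bsub>A\<^esub> f" using f by (simp add: gp_0)
    then show ?case using gp_in by auto
  next
    case (Suc k)
    have "?X (gp 1 False)" by (rule a)
    from mult[OF Suc this gp_in gp_in] show ?case by (simp add: gp_mult add.commute)
  qed
  have pow_int: "?X (gp k False)" for k
  proof -
    have "gp k False = gp (int (nat (k mod int n))) False"
      using n by (simp add: gp_eq_iff cong_def)
    then show ?thesis using pow[of "nat (k mod int n)"] by (simp only:)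
  qed
  fix p assume "p \<in> P"
  then obtain k e where p: "p = gp (int k) e" by (rule gp_surj)
  have "?X p"
  proof (cases e)
    case True
    have "?X (gp j True)" by (rule b)
    from mult[OF pow_int this gp_in gp_in, of "int k - j"] show ?thesis
      using True p by (simp add: gp_mult)
  next
    case False
    then show ?thesis using pow p by simp
  qed
  then show "\<exists>q \<in> P. f \<otimes>\<^bsub>A\<^esub> p = q \<otimes>\<^bsub>A\<^esub> f" by simp
qed (rule f)

text \<open>
  The three conjuncts say that \<open>aff n r c d e\<close> is conjugated into \<open>P\<close> by the shifts
  \<open>aff n 1 k (- k) False\<close>, by the exchange \<open>aff n 1 0 0 True\<close>, and by the automorphisms fixing the
  vertex \<open>1\<close>; these generate the automorphism group.
\<close>

definition stable where
  "stable r c d e \<longleftrightarrow>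
    (\<forall>k. Q r (c + (if e then - k else k) - r * k) (d - (if e then - k else k) + r * k) e) \<and>
    Q r d c e \<and>
    (\<forall>v \<gamma>. M v 0 \<gamma> False \<longrightarrow> Q r (v * c + (if e then \<gamma> else 0)) (v * d + (if e then 0 else \<gamma>) - r * \<gamma>) e)"

lemma stable_shift:
  assumes "stable r c d e" "Q r c d e"
  shows "\<exists>q \<in> P. aff n 1 k (- k) False \<otimes>\<^bsub>A\<^esub> aff n r c d e = q \<otimes>\<^bsub>A\<^esub> aff n 1 k (- k) False"
proof (rule bexI)
  define c' d' where "c' = c + (if e then - k else k) - r * k" and "d' = d - (if e then - k else k) + r * k"
  have Q': "Q r c' d' e" using assms(1) by (auto simp: stable_def c'_def d'_def)
  then show "aff n r c' d' e \<in> P" by (simp add: Q_def)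
  show "aff n 1 k (- k) False \<otimes>\<^bsub>A\<^esub> aff n r c d e = aff n r c' d' e \<otimes>\<^bsub>A\<^esub> aff n 1 k (- k) False"
    using n M_right[of k False] Q_M[OF assms(2)] Q_M[OF Q']
    by (simp add: M_def A_mult aff_comp c'_def d'_def)
qed

lemma stable_swap:
  assumes "stable r c d e" "Q r c d e"
  shows "\<exists>q \<in> P. aff n 1 0 0 True \<otimes>\<^bsub>A\<^esub> aff n r c d e = q \<otimes>\<^bsub>A\<^esub> aff n 1 0 0 True"
proof (rule bexI)
  have Q': "Q r d c e" using assms(1) by (auto simp: stable_def)
  then show "aff n r d c e \<in> P" by (simp add: Q_def)
  show "aff n 1 0 0 True \<otimes>\<^bsub>A\<^esub> aff n r c d e = aff n r d c e \<otimes>\<^bsub>A\<^esub> aff n 1 0 0 True"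
    using n M_right[of 0 True] Q_M[OF assms(2)] Q_M[OF Q']
    by (simp add: M_def A_mult aff_comp)
qed

lemma stable_fix:
  assumes "stable r c d e" "Q r c d e" "M v 0 \<gamma> False"
  shows "\<exists>q \<in> P. aff n v 0 \<gamma> False \<otimes>\<^bsub>A\<^esub> aff n r c d e = q \<otimes>\<^bsub>A\<^esub> aff n v 0 \<gamma> False"
proof (rule bexI)
  define c' d' where "c' = v * c + (if e then \<gamma> else 0)" and "d' = v * d + (if e then 0 else \<gamma>) - r * \<gamma>"
  have Q': "Q r c' d' e" using assms(1,3) by (auto simp: stable_def c'_def d'_def)
  then show "aff n r c' d' e \<in> P" by (simp add: Q_def)
  show "aff n v 0 \<gamma> False \<otimes>\<^bsub>A\<^esub> aff n r c d e = aff n r c' d' e \<otimes>\<^bsub>A\<^esub> aff n v 0 \<gamma> False"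
    using n assms(3) Q_M[OF assms(2)] Q_M[OF Q']
    by (simp add: M_def A_mult aff_comp c'_def d'_def mult.commute)
qed

text \<open>Every automorphism is a shift from \<open>R(G)\<close>, times one fixing the vertex
  \<open>1\<close>, times possibly the exchange; \<open>stable\<close> deals with each
  factor.\<close>

lemma normal_if_stable:
  assumes "gp 1 False = aff n r c d e" "gp j True = aff n u c' d' e'"
    and "stable r c d e" "stable u c' d' e'"
  shows "P \<lhd> A"
proof -
  have Q: "Q r c d e" "Q u c' d' e'"
    using gp_in[of 1 False] gp_in[of j True] assms(1,2) by (simp_all add: Q_def)
  have shift: "normalises (aff n 1 k (- k) False)" for k
    using M_right[of k False] stable_shift assms Q
    by (intro normalises_generators[where j = j]) (auto simp: M_def)
  have swap: "normalises (aff n 1 0 0 True)"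
    using M_right[of 0 True] stable_swap assms Q
    by (intro normalises_generators[where j = j]) (auto simp: M_def)
  have fix1: "normalises (aff n v 0 \<gamma> False)" if "M v 0 \<gamma> False" for v \<gamma>
    using that stable_fix assms Q
    by (intro normalises_generators[where j = j]) (auto simp: M_def)
  have "normalises f" if f: "f \<in> carrier A" for f
  proof -
    obtain v a b \<epsilon> where v: "f = aff n v a b \<epsilon>" "M v a b \<epsilon>" by (rule A_M[OF f])
    have M': "M v 0 (a + b) False" using v(2) by (rule M_fix)
    \<comment> \<open>Once the exchange is split off on the right, the two shifts change
      places.\<close>
    let ?k = "if \<epsilon> then b else a"
    have "normalises (aff n 1 ?k (- ?k) False \<otimes>\<^bsub>A\<^esub> aff n v 0 (a + b) False)"
      by (intro normalises_mult shift fix1 M')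
    also have "aff n 1 ?k (- ?k) False \<otimes>\<^bsub>A\<^esub> aff n v 0 (a + b) False = aff n v ?k (a + b - ?k) False"
      using M' M_right[of ?k False] n unfolding M_def
      by (simp only: A_mult) (simp add: aff_comp)
    finally have 1: "normalises (aff n v ?k (a + b - ?k) False)" .
    show ?thesis
    proof (cases \<epsilon>)
      case False
      then show ?thesis using 1 v by simp
    next
      case True
      have "normalises (aff n v ?k (a + b - ?k) False \<otimes>\<^bsub>A\<^esub> aff n 1 0 0 True)"
        by (intro normalises_mult 1 swap)
      moreover have "aff n v ?k (a + b - ?k) False \<otimes>\<^bsub>A\<^esub> aff n 1 0 0 True = f"
        using 1 swap n v True by (simp add: normalises_def A_mult aff_comp)
      ultimately show ?thesis by simp
    qed
  qed
  moreover have "f \<otimes>\<^bsub>A\<^esub> p \<otimes>\<^bsub>A\<^esub> inv\<^bsub>A\<^esub> f \<in> P" if nf: "normalises f" and p: "p \<in> P" for f p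
  proof -
    obtain q where q: "q \<in> P" "f \<otimes>\<^bsub>A\<^esub> p = q \<otimes>\<^bsub>A\<^esub> f"
      using nf p by (auto simp: normalises_def)
    moreover have "f \<in> carrier A" using nf by (simp add: normalises_def)
    ultimately show ?thesis using P_sub by (simp add: A.m_assoc)
  qed
  ultimately show ?thesis
    using P_subgroup by (simp add: A.normal_inv_iff)
qed

end

section \<open>Consequences of the dihedral relations, and odd \<open>n\<close>\<close>

context regular_dihedral_subgroup
begin

text \<open>Writing \<open>g\<close> and \<open>t\<close> for the images of \<open>a\<close> and of
  a reflection, the parameters are compared in \<open>t^2 = 1\<close> and \<open>g t g = t\<close>.
  The second relation gives \<open>r u r = u\<close>, hence \<open>r^2 = 1\<close> because
  \<open>u^2 = 1\<close>.\<close>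

lemma relations:
  assumes g: "gp 1 False = aff n r c d e" and t: "gp j True = aff n u c' d' e'"
  shows "[u * u = 1] (mod int n)"
    and "[u * c' + (if e' then d' else c') = 0] (mod int n)"
    and "[u * d' + (if e' then c' else d') = 0] (mod int n)"
    and "[r * r = 1] (mod int n)"
    and "[r * u * c + (if e then r * d' + (if e' then c else d) else r * c' + (if e' then d else c)) = c'] (mod int n)"
    and "[r * u * d + (if e then r * c' + (if e' then d else c) else r * d' + (if e' then c else d)) = d'] (mod int n)"
proof -
  have gA: "aff n r c d e \<in> carrier A" and tA: "aff n u c' d' e' \<in> carrier A"
    using gp_in P_sub g t by metis+
  have "gp j True \<otimes>\<^bsub>A\<^esub> gp j True = gp 0 False"
    by (simp add: gp_mult)
  then have "aff n (u * u) (u * c' + (if e' then d' else c')) (u * d' + (if e' then c' else d')) False = aff n 1 0 0 False"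
    using n tA by (simp add: gp_0 t A_mult aff_comp Aut_one pverts_Cay flip: aff_one)
  then show u: "[u * u = 1] (mod int n)"
    and "[u * c' + (if e' then d' else c') = 0] (mod int n)"
    and "[u * d' + (if e' then c' else d') = 0] (mod int n)"
    using n by (simp_all only: aff_eq_iff)
  have "gp 1 False \<otimes>\<^bsub>A\<^esub> gp j True \<otimes>\<^bsub>A\<^esub> gp 1 False = gp j True"
    by (simp add: gp_mult)
  moreover have "aff n r c d e \<otimes>\<^bsub>A\<^esub> aff n u c' d' e' =
      aff n (r * u) (r * c' + (if e' then d else c)) (r * d' + (if e' then c else d)) (e \<noteq> e')"
    using n gA tA by (simp add: A_mult aff_comp)
  moreover have "aff n (r * u) (r * c' + (if e' then d else c)) (r * d' + (if e' then c else d)) (e \<noteq> e') \<in> carrier A"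
    using calculation(2) gA tA by (metis A.m_closed)
  ultimately have eq: "aff n (r * u * r)
      (r * u * c + (if e then r * d' + (if e' then c else d) else r * c' + (if e' then d else c)))
      (r * u * d + (if e then r * c' + (if e' then d else c) else r * d' + (if e' then c else d)))
      ((e \<noteq> e') \<noteq> e) = aff n u c' d' e'"
    using n gA by (simp only: g t A_mult aff_comp)
  show "[r * u * c + (if e then r * d' + (if e' then c else d) else r * c' + (if e' then d else c)) = c'] (mod int n)"
    and "[r * u * d + (if e then r * c' + (if e' then d else c) else r * d' + (if e' then c else d)) = d'] (mod int n)"
    using eq n by (simp_all only: aff_eq_iff)
  have "[r * u * r = u] (mod int n)" using eq n by (simp only: aff_eq_iff)
  then have "[r * u * r * u = u * u] (mod int n)" by (intro cong_mult cong_refl)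
  then have "[r * r * (u * u) = u * u] (mod int n)" by (simp add: mult_ac)
  moreover have "[r * r * (u * u) = r * r * 1] (mod int n)" using u by (intro cong_mult cong_refl)
  ultimately show "[r * r = 1] (mod int n)"
    using u by (metis cong_sym cong_trans mult_1_right)
qed

lemma gp_power:
  assumes "gp m False = aff n 1 c d False"
  shows "gp (k * m) False = aff n 1 (k * c) (k * d) False"
proof -
  have nat: "gp (int k * m) False = aff n 1 (int k * c) (int k * d) False" for k
  proof (induction k)
    case 0
    show ?case by (simp add: gp_0 Aut_one pverts_Cay aff_one)
  next
    case (Suc k)
    have "gp (int (Suc k) * m) False = gp (int k * m) False \<otimes>\<^bsub>A\<^esub> gp m False"
      by (simp add: gp_mult algebra_simps)
    also have "\<dots> = aff n 1 (int (Suc k) * c) (int (Suc k) * d) False"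
      using n P_sub[OF gp_in[of m False]] P_sub[OF gp_in[of "int k * m" False]]
      by (simp add: Suc assms A_mult aff_comp) (simp add: algebra_simps)
    finally show ?case .
  qed
  have "[int (nat (k mod int n)) = k] (mod int n)"
    using n by (simp add: cong_def)
  then have "gp (k * m) False = gp (int (nat (k mod int n)) * m) False"
      and "aff n 1 (int (nat (k mod int n)) * c) (int (nat (k mod int n)) * d) False = aff n 1 (k * c) (k * d) False"
    using n by (simp_all only: gp_eq_iff aff_eq_iff) (auto simp: cong_sym cong_mult)
  then show ?thesis using nat by metis
qed

text \<open>
  Here \<open>P\<close> consists of the maps \<open>aff n 1 x (- u * x) False\<close> and \<open>aff n u x (- u * x) True\<close>: for
  \<open>u = 1\<close> this is \<open>R(G)\<close>, for \<open>u = - 1\<close> the left regular representation.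
\<close>

lemma normal_if_translations:
  assumes g: "gp 1 False = aff n 1 c d False" and t: "gp j True = aff n u c' d' True"
  shows "P \<lhd> A"
proof -
  note rel = relations[OF g t, simplified]
  have uu: "[x * (u * u) = x] (mod int n)" for x
    using rel(1) by (metis cong_scalar_left mult_1_right)
  have "[u * c + d = 0] (mod int n)"
    using relations(5)[OF g t] by (simp add: cong_iff_dvd_diff algebra_simps)
  then have g': "gp 1 False = aff n 1 c (- u * c) False"
    using g n by (simp add: aff_eq_iff cong_iff_dvd_diff algebra_simps)
  have t': "gp j True = aff n u c' (- u * c') True"
    using t n rel(2) by (simp add: aff_eq_iff cong_iff_dvd_diff algebra_simps)
  have Q1: "Q 1 x (- u * x) False" for x
  proof -
    \<comment> \<open>Transitivity provides an element carrying \<open>1\<close> to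
      \<open>a^x\<close>. The images of reflections all exchange the kinds, so it is a power of
      \<open>g\<close>, and its rotation shift is \<open>x\<close>.\<close>
    obtain p where p: "p \<in> P" "p (0, False) = (x mod int n, False)" by (rule transitive)
    obtain k e where k: "p = gp (int k) e" using p(1) by (rule gp_surj)
    have "gp (int k) True = gp (int k - j) False \<otimes>\<^bsub>A\<^esub> gp j True"
      by (simp add: gp_mult)
    also have "\<dots> = aff n u (c' - u * ((int k - j) * c)) (- u * c' + (int k - j) * c) True"
      using n P_sub[OF gp_in[of j True]] P_sub[OF gp_in[of "int k - j" False]]
      by (simp add: t' gp_power[OF g', simplified] A_mult aff_comp algebra_simps)
    finally have "\<not> e" using p(2) k n by (cases e) (auto simp: aff_apply)
    then have p': "p = aff n 1 (int k * c) (int k * (- u * c)) False" using k gp_power[OF g', simplified] by simp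
    then have "[int k * c = x] (mod int n)"
      using p(2) n by (simp add: aff_apply cong_def)
    moreover from this have "[- u * (int k * c) = - u * x] (mod int n)"
      by (rule cong_scalar_left)
    moreover have "Q 1 (int k * c) (int k * (- u * c)) False"
      using p(1) p' by (simp add: Q_def)
    ultimately show ?thesis
      using Q_cong[of 1 "int k * c" "int k * (- u * c)" False 1 x "- u * x"]
      by (simp add: mult.left_commute)
  qed
  have Q2: "Q u x (- u * x) True" for x
  proof -
    have "Q u c' (- u * c') True" using gp_in[of j True] t' by (simp add: Q_def)
    \<comment> \<open>The translation \<open>y\<close> is chosen so that \<open>c' - u * y\<close>
      is \<open>x\<close> modulo \<open>n\<close>, by \<open>u * u = 1\<close>.\<close>
    from Q_mult[OF Q1 this, of "u * c' - u * x"]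
    have "Q u (c' - (u * u) * (c' - x)) (- u * x) True" by (simp add: algebra_simps)
    then show ?thesis
      by (rule Q_cong) (use cong_sym[OF uu[of "c' - x"]] in \<open>simp_all add: cong_iff_dvd_diff algebra_simps\<close>)
  qed
  show ?thesis
  proof (rule normal_if_stable[OF g' t'])
    show "stable 1 c (- u * c) False"
      unfolding stable_def
    proof (intro conjI allI impI)
      show "Q 1 (- u * c) c False"
        by (rule Q_cong[OF Q1[of "- u * c"]]) (use uu[of c] in \<open>simp_all add: mult_ac\<close>)
      show "Q 1 (v * c + (if False then \<gamma> else 0)) (v * (- u * c) + (if False then 0 else \<gamma>) - 1 * \<gamma>) False"
        for v \<gamma>
        using Q1[of "v * c"] by (simp add: mult_ac)
    qed (use Q1[of c] in simp)
    show "stable u c' (- u * c') True"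
      unfolding stable_def
    proof (intro conjI allI impI)
      fix k
      show "Q u (c' + (if True then - k else k) - u * k) (- u * c' - (if True then - k else k) + u * k) True"
        by (rule Q_cong[OF Q2[of "c' - k - u * k"]])
          (use uu[of k] in \<open>simp_all add: cong_iff_dvd_diff algebra_simps\<close>)
      show "Q u (- u * c') c' True"
        by (rule Q_cong[OF Q2[of "- u * c'"]]) (use uu[of c'] in \<open>simp_all add: mult_ac\<close>)
      fix v \<gamma>
      show "Q u (v * c' + (if True then \<gamma> else 0)) (v * (- u * c') + (if True then 0 else \<gamma>) - u * \<gamma>) True"
        by (rule Q_cong[OF Q2[of "v * c' + \<gamma>"]]) (simp_all add: cong_iff_dvd_diff algebra_simps)
    qed
  qed
qed

lemma gp_power_parity:
  assumes "gp 1 False = aff n r c d e"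
  shows "\<exists>a b. gp (int k) False = aff n (r ^ k) a b (e \<and> odd k)"
proof (induction k)
  case 0
  show ?case by (auto simp: gp_0 Aut_one pverts_Cay simp flip: aff_one)
next
  case (Suc k)
  then obtain a b where ab: "gp (int k) False = aff n (r ^ k) a b (e \<and> odd k)" by blast
  have "gp (int (Suc k)) False = gp (int k) False \<otimes>\<^bsub>A\<^esub> gp 1 False"
    by (simp add: gp_mult add.commute)
  also have "\<dots> = compose V (aff n (r ^ k) a b (e \<and> odd k)) (aff n r c d e)"
    using P_sub[OF gp_in[of 1 False]] P_sub[OF gp_in[of "int k" False]]
    by (simp add: A_mult ab assms)
  also have "((e \<and> odd k) \<noteq> e) = (e \<and> odd (Suc k))" by auto
  ultimately show ?case
    using n by (simp only: aff_comp) (metis power_Suc2)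
qed

text \<open>If neither generator exchanged the kinds, no element of \<open>P\<close> would, against
  transitivity.\<close>

lemma swap_if_not_swap:
  assumes "gp 1 False = aff n r c d False" "gp j True = aff n u c' d' e"
  shows e
proof (rule ccontr)
  assume "\<not> e"
  obtain p where p: "p \<in> P" "p (0, False) = (0 mod int n, True)" by (rule transitive)
  obtain k f where k: "p = gp (int k) f" using p(1) by (rule gp_surj)
  have pow: "\<exists>r c d. gp i False = aff n r c d False" for i
  proof -
    have "gp i False = gp (int (nat (i mod int n))) False"
      using n by (simp add: gp_eq_iff cong_def)
    then show ?thesis using gp_power_parity[OF assms(1), of "nat (i mod int n)"] by (simp only: simp_thms) blast
  qed
  have "\<exists>r c d. p = aff n r c d False"
  proof (cases f)
    case True
    obtain r1 c1 d1 where 1: "gp (int k - j) False = aff n r1 c1 d1 False" using pow by blast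
    have "p = gp (int k - j) False \<otimes>\<^bsub>A\<^esub> gp j True"
      using True k by (simp add: gp_mult)
    then show ?thesis
      using n \<open>\<not> e\<close> P_sub[OF gp_in[of j True]] P_sub[OF gp_in[of "int k - j" False]]
      by (auto simp: 1 assms(2) A_mult aff_comp)
  qed (use k pow in auto)
  then show False using p(2) n by (auto simp: aff_apply)
qed

text \<open>As \<open>g^n = 1\<close> with \<open>n\<close> odd, \<open>g\<close> cannot exchange
  the kinds, and \<open>r^2 = 1\<close> turns \<open>r^n = 1\<close> into \<open>r = 1\<close>; so
  \<open>g\<close> is a translation.\<close>

lemma normal_if_odd:
  assumes "odd n"
  shows "P \<lhd> A"
proof -
  obtain r c d e where g: "gp 1 False = aff n r c d e" by (rule gp_aff)
  obtain u c' d' e' where t: "gp 0 True = aff n u c' d' e'" by (rule gp_aff)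
  obtain a b where "gp (int n) False = aff n (r ^ n) a b (e \<and> odd n)"
    using gp_power_parity[OF g] by blast
  moreover have "gp (int n) False = aff n 1 0 0 False"
    using gp_eq_iff[of "int n" False 0 False] by (simp add: gp_0 Aut_one pverts_Cay aff_one cong_def)
  ultimately have rn: "[r ^ n = 1] (mod int n)" and e: "\<not> e"
    using n assms by (auto simp: aff_eq_iff cong_sym_eq)
  obtain m where "n = 2 * m + 1" using assms by (rule oddE)
  then have "r ^ n = r * (r * r) ^ m" by (simp add: power_add power_mult power2_eq_square)
  moreover have "[(r * r) ^ m = 1 ^ m] (mod int n)"
    using relations(4)[OF g t] by (rule cong_pow)
  ultimately have "[r ^ n = r] (mod int n)"
    by (metis cong_scalar_left mult_1_right power_one)
  then have "[r = 1] (mod int n)" using rn by (metis cong_sym cong_trans)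
  then have "gp 1 False = aff n 1 c d False"
    using g e n by (simp add: aff_eq_iff)
  then show ?thesis
    using normal_if_translations t swap_if_not_swap by (metis (full_types))
qed

end

section \<open>\<open>n = 4\<close> or \<open>n = 8\<close>: images of \<open>a\<close> that
  exchange rotations and reflections\<close>

context normal_dihedral_Cayley
begin

text \<open>Otherwise some multiple of the shift is \<open>2\<close> modulo \<open>n\<close>, and
  \<open>no_shift_by_2\<close> then allows only the multiplier \<open>1\<close>.\<close>

lemma M_shift_dvd_4:
  assumes n48: "n = 4 \<or> n = 8" and \<gamma>: "M 1 0 \<gamma> False" and r: "M r c d e" "\<not> [r = 1] (mod int n)"
  shows "4 dvd \<gamma>"
proof (rule ccontr)
  assume not4: "\<not> 4 dvd \<gamma>"
  \<comment> \<open>For odd \<open>\<gamma>\<close> take \<open>k = 2 * \<gamma>\<close>, as odd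
    squares are \<open>1\<close> modulo \<open>8\<close>; for \<open>\<gamma> = 2 * m\<close> with
    \<open>m\<close> odd take \<open>k = m\<close>.\<close>
  have "\<exists>k. 8 dvd k * \<gamma> - 2"
  proof (cases "odd \<gamma>")
    case True
    then obtain m where "\<gamma> = 2 * m + 1" by (rule oddE)
    then have "2 * \<gamma> * \<gamma> - 2 = 8 * (m * m + m)" by (simp add: algebra_simps)
    then show ?thesis by (metis dvd_triv_left)
  next
    case False
    then obtain m where m: "\<gamma> = 2 * m" using evenE by blast
    with not4 have "odd m" by auto
    then obtain l where "m = 2 * l + 1" by (rule oddE)
    then have "m * \<gamma> - 2 = 8 * (l * l + l)" by (simp add: m algebra_simps)
    then show ?thesis by (metis dvd_triv_left)
  qed
  then obtain k where k: "8 dvd k * \<gamma> - 2" by blast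
  have "int n dvd 8" using n48 by auto
  with k have "int n dvd k * \<gamma> - 2" by (rule dvd_trans[rotated])
  then have "M 1 0 2 False"
    using M_cong[OF M_pow[OF \<gamma>, of k], of 1 0 2] by (simp add: cong_iff_dvd_diff)
  then show False
    using no_shift_by_2[OF _ _ r(1)] r(2) n48 by auto
qed

end

context regular_dihedral_subgroup
begin

context
  fixes r c d u c' d' :: int and j :: int
  assumes n48: "n = 4 \<or> n = 8"
    and g: "gp 1 False = aff n r c d True" and t: "gp j True = aff n u c' d' False"
begin

lemma r_square: "int n dvd r * r - 1"
  using relations(4)[OF g t] by (simp add: cong_iff_dvd_diff)

text \<open>By \<open>r^2 = 1\<close> both shifts of \<open>g^2\<close> are determined by the single
  number \<open>c + r * d\<close>.\<close>

lemma gp_2: "gp 2 False = aff n 1 (r * (c + r * d)) (c + r * d) False"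
proof -
  have gA: "aff n r c d True \<in> carrier A" using P_sub[OF gp_in[of 1 False]] g by simp
  have "gp 2 False = gp 1 False \<otimes>\<^bsub>A\<^esub> gp 1 False" by (simp add: gp_mult)
  also have "\<dots> = aff n (r * r) (r * c + d) (r * d + c) False"
    using gA n by (simp add: g A_mult aff_comp)
  also have "\<dots> = aff n 1 (r * (c + r * d)) (c + r * d) False"
  proof -
    have "int n dvd r * c + d - r * (c + r * d)"
      using r_square by Groebner_Basis.algebra
    then show ?thesis using n r_square by (simp add: aff_eq_iff cong_iff_dvd_diff)
  qed
  finally show ?thesis .
qed

text \<open>The sum is even because \<open>g^n = 1\<close>. If \<open>4\<close> divided it, the
  power of \<open>g\<close> with exponent \<open>n / 2\<close> would fix a vertex and so be the
  identity.\<close>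

lemma sum_mod_4: "[c + r * d = 2] (mod 4)"
proof -
  let ?s = "c + r * d"
  obtain h where h: "n = 4 * h" "h > 0" using n48 by auto
  have pow: "gp (int k * 2) False = aff n 1 (int k * (r * ?s)) (int k * ?s) False" for k
    by (rule gp_power[OF gp_2])
  have "gp (int (2 * h) * 2) False = gp 0 False"
    unfolding gp_eq_iff by (simp add: cong_iff_dvd_diff h)
  also have "gp 0 False = aff n 1 0 0 False" by (simp add: gp_0 Aut_one pverts_Cay aff_one)
  finally have "int n dvd int (2 * h) * ?s"
    using n unfolding pow by (simp add: aff_eq_iff cong_iff_dvd_diff)
  then have "2 * int h * 2 dvd 2 * int h * ?s" by (simp add: h(1) mult_ac)
  then have even: "even ?s" using h(2) by (subst (asm) dvd_mult_cancel_left) auto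
  have "\<not> 4 dvd ?s"
  proof
    assume "4 dvd ?s"
    then have "int n dvd int h * ?s" by (auto simp: h(1) elim!: dvdE)
    moreover have "Q 1 (int h * (r * ?s)) (int h * ?s) False"
      using gp_in[of "int h * 2" False] by (simp add: Q_def pow)
    ultimately have "gp (int h * 2) False = gp 0 False"
      unfolding pow by (intro Q_fixpoint[where i = 0 and s = True]) (simp_all add: cong_iff_dvd_diff)
    then show False
      using h unfolding gp_eq_iff by (auto simp: cong_iff_dvd_diff dest: zdvd_imp_le)
  qed
  obtain m where m: "?s = 2 * m" using even by (rule evenE)
  with \<open>\<not> 4 dvd ?s\<close> have "odd m" by auto
  then obtain l where "m = 2 * l + 1" by (rule oddE)
  with m have "?s = 2 + 4 * l" by simp
  then show ?thesis by (simp add: cong_iff_dvd_diff)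
qed

lemma even_translation: "\<exists>i. gp i False = aff n 1 (2 * k) (2 * r * k) False"
proof -
  let ?s = "c + r * d"
  obtain b where b: "?s = 2 + 4 * b"
    using sum_mod_4 by (metis cong_iff_lin cong_sym mult.commute)
  have n8: "int n dvd 8" using n48 by auto
  \<comment> \<open>Here \<open>c + r * d = 2 * (1 + 2 * b)\<close>, and multiplying by
    \<open>1 + 2 * b\<close> gives \<open>2\<close> modulo \<open>8\<close>; the factor
    \<open>r\<close> places \<open>2 * k\<close> on the rotations.\<close>
  define i where "i = (1 + 2 * b) * r * k"
  have "i * ?s - 2 * r * k = 8 * (r * k * (b + b * b))"
    unfolding b i_def by (simp add: algebra_simps)
  then have 1: "int n dvd i * ?s - 2 * r * k" using n8 by (simp add: dvd_mult2)
  have 2: "int n dvd i * (r * ?s) - 2 * k"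
    using 1 r_square by Groebner_Basis.algebra
  have "gp (i * 2) False = aff n 1 (2 * k) (2 * r * k) False"
    using 1 2 n unfolding gp_power[OF gp_2] by (simp add: aff_eq_iff cong_iff_dvd_diff)
  then show ?thesis by blast
qed

lemma Q_even: "Q 1 (2 * k) (2 * r * k) False"
  using even_translation[of k] gp_in unfolding Q_def by metis

text \<open>The map in question is again the image of a reflection, hence not the identity, and
  regularity leaves it no fixed vertex.\<close>

lemma shifted_no_fixpoint:
  "\<not> [u * x + (if s then d' + 2 * r * k else c' + 2 * k) = x] (mod int n)"
proof
  assume fp: "[u * x + (if s then d' + 2 * r * k else c' + 2 * k) = x] (mod int n)"
  obtain i where i: "gp i False = aff n 1 (2 * k) (2 * r * k) False" using even_translation by blast
  have "gp (i + j) True = gp i False \<otimes>\<^bsub>A\<^esub> gp j True" by (simp add: gp_mult)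
  also have "\<dots> = aff n u (c' + 2 * k) (d' + 2 * r * k) False"
    using n P_sub[OF gp_in[of j True]] P_sub[OF gp_in[of i False]] by (simp add: t i A_mult aff_comp)
  finally have ij: "gp (i + j) True = aff n u (c' + 2 * k) (d' + 2 * r * k) False" .
  then have "Q u (c' + 2 * k) (d' + 2 * r * k) False"
    using gp_in[of "i + j" True] by (simp add: Q_def)
  from Q_fixpoint[OF this fp] ij show False by (simp add: gp_eq_iff)
qed

text \<open>With an even shift, a suitable even translation would make the image of a reflection fix
  \<open>1\<close> or \<open>b\<close>.\<close>

lemma odd_shifts: "odd c'" "odd d'"
proof -
  show "odd c'"
  proof
    assume "even c'"
    then obtain m where "c' = 2 * m" by (rule evenE)
    then show False using shifted_no_fixpoint[of 0 False "- m"] by simp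
  qed
  show "odd d'"
  proof
    assume "even d'"
    then obtain m where m: "d' = 2 * m" by (rule evenE)
    have "int n dvd d' + 2 * r * (- (r * m))"
      using r_square unfolding m by Groebner_Basis.algebra
    then show False using shifted_no_fixpoint[of 0 True "- (r * m)"] by (simp add: cong_iff_dvd_diff)
  qed
qed

text \<open>The relation \<open>t^2 = 1\<close> makes \<open>(u + 1) * c'\<close> vanish modulo
  \<open>n\<close>, and \<open>c'\<close> is odd while \<open>n\<close> is a power of
  \<open>2\<close>.\<close>

lemma u_minus_1: "[u = - 1] (mod int n)"
proof -
  have "coprime c' (2 ^ k)" for k :: nat using odd_shifts(1) by simp
  from this[of 2] this[of 3] have "coprime c' (int n)" using n48 by auto
  moreover have "int n dvd (u + 1) * c'"
    using relations(2)[OF g t] by (simp add: cong_iff_dvd_diff algebra_simps)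
  ultimately have "int n dvd u + 1"
    by (metis coprime_commute coprime_dvd_mult_left_iff)
  then show ?thesis by (simp add: cong_iff_dvd_diff)
qed

text \<open>Composing \<open>g\<close> with powers of \<open>g^2\<close> does not change this number
  modulo \<open>n\<close>.\<close>

abbreviation \<delta> where "\<delta> \<equiv> d - r * c"

lemma even_delta: "even \<delta>" and odd_r: "odd r"
proof -
  show r: "odd r"
    using M_odd[OF Q_M, of r c d True] gp_in[of 1 False] n48 by (auto simp: Q_def g)
  have "4 dvd c + r * d - 2" using sum_mod_4 by (simp add: cong_iff_dvd_diff)
  then have "2 dvd c + r * d - 2" by (rule dvd_trans[rotated]) simp
  then have "even (c + r * d)" by simp
  then show "even \<delta>" using r by auto
qed

text \<open>By \<open>g t g = t\<close> and \<open>u = - 1\<close>, the analogue of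
  \<open>\<delta>\<close> for \<open>t\<close> is \<open>- r * \<delta>\<close> modulo
  \<open>n\<close>.\<close>

lemma t_delta: "int n dvd d' - r * c' + r * \<delta>"
proof -
  have "int n dvd u + 1" using u_minus_1 by (simp add: cong_iff_dvd_diff)
  moreover have "int n dvd r * u * c + (r * d' + d) - c'"
    using relations(5)[OF g t] by (simp add: cong_iff_dvd_diff)
  ultimately show ?thesis using r_square by Groebner_Basis.algebra
qed

text \<open>A membership test for the coset of \<open>g\<close> modulo the even translations: one of
  these reaches \<open>x\<close>, and \<open>\<delta>\<close> then determines \<open>y\<close>.
  \<open>Q_fixing\<close> is the same for \<open>t\<close>.\<close>

lemma Q_swapping:
  assumes "even (x - c)" "int n dvd y - r * x - \<delta>"
  shows "Q r x y True"
proof -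
  obtain m where m: "x - c = 2 * m" using assms(1) by (rule evenE)
  have "Q r c d True" using gp_in[of 1 False] g by (simp add: Q_def)
  \<comment> \<open>Because \<open>g\<close> exchanges the kinds first, \<open>c\<close> receives
    the second shift of the translation, which for this choice is \<open>2 * m\<close> modulo
    \<open>n\<close>.\<close>
  from Q_mult[OF Q_even this, of "r * m"]
  have "Q r (c + 2 * r * (r * m)) (d + 2 * (r * m)) True" by (simp add: add.commute)
  then show ?thesis
  proof (rule Q_cong)
    show "[c + 2 * r * (r * m) = x] (mod int n)" "[d + 2 * (r * m) = y] (mod int n)"
      unfolding cong_iff_dvd_diff using r_square m assms(2) by Groebner_Basis.algebra+
  qed simp
qed

lemma Q_fixing:
  assumes "odd x" "int n dvd y - r * x + r * \<delta>"
  shows "Q (- 1) x y False"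
proof -
  have "even (x - c')" using assms(1) odd_shifts(1) by simp
  then obtain m where m: "x - c' = 2 * m" by (rule evenE)
  have "Q u c' d' False" using gp_in[of j True] t by (simp add: Q_def)
  from Q_mult[OF Q_even this, of m]
  have "Q u (c' + 2 * m) (d' + 2 * r * m) False" by (simp add: add.commute)
  then show ?thesis
  proof (rule Q_cong)
    have "c' + 2 * m = x" using m by linarith
    then show "[c' + 2 * m = x] (mod int n)" by simp
    show "[d' + 2 * r * m = y] (mod int n)"
      unfolding cong_iff_dvd_diff using t_delta m assms(2) by Groebner_Basis.algebra
  qed (rule u_minus_1)
qed

text \<open>
  Up to powers of \<open>g\<close>, conjugates of \<open>g\<close> are told apart by \<open>\<delta>\<close> alone, so an automorphism normalises
  \<open>P\<close> as soon as it preserves \<open>\<delta>\<close>.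
\<close>

lemma normal_if_swap:
  assumes r: "int n dvd 2 * r + 2"
    and fix1: "\<And>v \<gamma>. M v 0 \<gamma> False \<Longrightarrow> int n dvd 2 * \<gamma> - r * (v - 1) * \<delta>"
  shows "P \<lhd> A"
proof (rule normal_if_stable[OF g])
  have t': "aff n u c' d' False = aff n (- 1) c' d' False"
    using u_minus_1 n by (simp add: aff_eq_iff)
  then show "gp j True = aff n (- 1) c' d' False" using t by simp
  have r\<delta>: "int n dvd (1 + r) * \<delta>"
  proof -
    obtain m where m: "\<delta> = 2 * m" using even_delta by (rule evenE)
    have "(1 + r) * \<delta> = (2 * r + 2) * m" unfolding m by (simp add: algebra_simps)
    then show ?thesis using r by simp
  qed
  \<comment> \<open>Both \<open>v - 1\<close> and \<open>\<delta>\<close> are even, so the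
    hypothesis gives \<open>4 dvd 2 * \<gamma>\<close>.\<close>
  have \<gamma>: "even \<gamma>" if M: "M v 0 \<gamma> False" for v \<gamma>
  proof -
    have "4 dvd int n" using n48 by auto
    then have "4 dvd 2 * \<gamma> - r * (v - 1) * \<delta>" using fix1[OF M] by (rule dvd_trans)
    moreover have "4 dvd r * (v - 1) * \<delta>"
    proof -
      have "odd v" using M_odd[OF M] n48 by auto
      then obtain a where "v = 2 * a + 1" by (rule oddE)
      moreover obtain b where "\<delta> = 2 * b" using even_delta by (rule evenE)
      ultimately have "r * (v - 1) * \<delta> = 4 * (r * a * b)" by simp
      then show ?thesis by (metis dvd_triv_left)
    qed
    ultimately have "4 dvd 2 * \<gamma>" by (metis diff_add_cancel dvd_add)
    then show ?thesis by presburger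
  qed
  show "stable r c d True"
    unfolding stable_def if_True
  proof (intro conjI allI impI)
    show "Q r (c + - k - r * k) (d - - k + r * k) True" for k
    proof (rule Q_swapping)
      show "int n dvd d - - k + r * k - r * (c + - k - r * k) - \<delta>"
      proof -
        have "d - - k + r * k - r * (c + - k - r * k) - \<delta> = k * (2 * r + 2) + k * (r * r - 1)"
          by (simp add: algebra_simps)
        then show ?thesis using r r_square by simp
      qed
    qed (use odd_r in auto)
    show "Q r d c True"
    proof (rule Q_swapping)
      show "int n dvd c - r * d - \<delta>"
        using r\<delta> r_square by Groebner_Basis.algebra
      show "even (d - c)" using even_delta odd_r by auto
    qed
    fix v \<gamma> assume M: "M v 0 \<gamma> False"
    show "Q r (v * c + \<gamma>) (v * d + 0 - r * \<gamma>) True"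
    proof (rule Q_swapping)
      show "even (v * c + \<gamma> - c)" using \<gamma>[OF M] M_odd[OF M] n48 by auto
      show "int n dvd v * d + 0 - r * \<gamma> - r * (v * c + \<gamma>) - \<delta>"
        using fix1[OF M] r_square by Groebner_Basis.algebra
    qed
  qed
  show "stable (- 1) c' d' False"
    unfolding stable_def if_False
  proof (intro conjI allI impI)
    show "Q (- 1) (c' + k - - 1 * k) (d' - k + - 1 * k) False" for k
    proof (rule Q_fixing)
      show "int n dvd d' - k + - 1 * k - r * (c' + k - - 1 * k) + r * \<delta>"
      proof -
        have "d' - k + - 1 * k - r * (c' + k - - 1 * k) + r * \<delta> = (d' - r * c' + r * \<delta>) - k * (2 * r + 2)"
          by (simp add: algebra_simps)
        then show ?thesis using r t_delta by (metis dvd_diff dvd_mult)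
      qed
    qed (use odd_shifts in auto)
    show "Q (- 1) d' c' False"
    proof (rule Q_fixing)
      show "int n dvd c' - r * d' + r * \<delta>"
        using r\<delta> r_square t_delta by Groebner_Basis.algebra
    qed (rule odd_shifts)
    fix v \<gamma> assume M: "M v 0 \<gamma> False"
    show "Q (- 1) (v * c' + 0) (v * d' + \<gamma> - - 1 * \<gamma>) False"
    proof (rule Q_fixing)
      show "odd (v * c' + 0)" using odd_shifts(1) M_odd[OF M] n48 by auto
      show "int n dvd v * d' + \<gamma> - - 1 * \<gamma> - r * (v * c' + 0) + r * \<delta>"
        using fix1[OF M] t_delta by Groebner_Basis.algebra
    qed
  qed
qed

end

end

context regular_dihedral_subgroup
begin

text \<open>An automorphism that fixes \<open>1\<close> and has multiplier \<open>1\<close> modulo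
  \<open>4\<close> must shift the reflections by a multiple of \<open>4\<close>. Used for
  \<open>g\<close>, corrected to fix \<open>1\<close>, this forces \<open>r\<close> to be
  \<open>3\<close> modulo \<open>4\<close>. Used for any other automorphism fixing \<open>1\<close>,
  composed with one of multiplier \<open>- 1\<close> if need be, it gives the condition of
  \<open>normal_if_swap\<close>.\<close>

lemma normal_if_swapping_generator:
  assumes n48: "n = 4 \<or> n = 8" and g: "gp 1 False = aff n r c d True"
  shows "P \<lhd> A"
proof -
  \<comment> \<open>As \<open>g\<close> exchanges the kinds, one of the images of \<open>b\<close>
    and \<open>a b\<close> does not.\<close>
  obtain j u c' d' where t: "gp j True = aff n u c' d' False"
  proof -
    obtain u c' d' e where t: "gp 0 True = aff n u c' d' e" by (rule gp_aff)
    show ?thesis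
    proof (cases e)
      case True
      have "gp 1 True = gp 1 False \<otimes>\<^bsub>A\<^esub> gp 0 True" by (simp add: gp_mult)
      then show ?thesis
        using n True P_sub[OF gp_in[of 1 False]] P_sub[OF gp_in[of 0 True]] that
        by (simp add: g t A_mult aff_comp)
    qed (use t that in auto)
  qed
  note str = n48 g t
  define a b where "a = c + d" and "b = c' + d'"
  have n4: "4 dvd int n" and n8: "int n dvd 8" using n48 by auto
  have "M u c' d' False" using gp_in[of j True] by (intro Q_M) (simp add: Q_def t)
  from M_fix[OF this] have Mb: "M (- 1) 0 b False"
    unfolding b_def by (rule M_cong) (simp_all add: u_minus_1[OF str])
  have "M r c d True" using gp_in[of 1 False] by (intro Q_M) (simp add: Q_def g)
  from M_fix[OF this] have Ma: "M r 0 a False"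
    unfolding a_def .
  have "\<not> [- 1 = 1] (mod int n)"
    using n by (auto simp: cong_iff_dvd_diff dest: zdvd_imp_le)
  then have four: "4 dvd \<gamma>" if "M 1 0 \<gamma> False" for \<gamma>
    using M_shift_dvd_4[OF n48 that Mb] by simp
  have square: "M 1 0 ((v + 1) * \<gamma>) False" if "M v 0 \<gamma> False" "[v * v = 1] (mod int n)" for v \<gamma>
    using M_mult[OF that(1) that(1)] that(2) by (auto simp: algebra_simps elim!: M_cong)
  \<comment> \<open>The square of such a map shifts the reflections alone by
    \<open>6 * \<gamma>\<close>, which is \<open>4\<close> modulo \<open>8\<close>;
    \<open>no_shift_by_4\<close> excludes this, with the multiplier \<open>- 1\<close> from
    \<open>Mb\<close>.\<close>
  have no5: False if n: "n = 8" and M5: "M v 0 \<gamma> False" "[v = 5] (mod 8)" and \<gamma>: "4 dvd \<gamma> - 2" for v \<gamma>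
  proof -
    have M5': "M 5 0 \<gamma> False" by (rule M_cong[OF M5(1)]) (use n M5(2) in simp_all)
    have "[(5 + 1) * \<gamma> = 4] (mod 8)" using \<gamma> unfolding cong_iff_dvd_diff by presburger
    moreover have "M 1 0 ((5 + 1) * \<gamma>) False" by (rule square[OF M5']) (simp add: n cong_def)
    ultimately have "M 1 0 4 False" using M_cong[of 1 0 "(5 + 1) * \<gamma>" False 1 0 4] n by simp
    then show False using no_shift_by_4[OF n _ M5' Mb] by (simp add: cong_iff_dvd_diff)
  qed
  \<comment> \<open>Modulo \<open>n\<close> the multiplier is \<open>1\<close> or, for
    \<open>n = 8\<close>, also \<open>5\<close>. In the latter case the square shows that
    \<open>\<gamma>\<close> is even, and \<open>no5\<close> excludes \<open>2\<close> modulo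
    \<open>4\<close>.\<close>
  have one: "4 dvd \<gamma>" if M: "M v 0 \<gamma> False" and v: "[v = 1] (mod 4)" for v \<gamma>
  proof (cases "[v = 1] (mod int n)")
    case True
    then have "M 1 0 \<gamma> False" by (intro M_cong[OF M]) simp_all
    then show ?thesis by (rule four)
  next
    case False
    then have n: "n = 8" using n48 v by auto
    have "\<not> 8 dvd v - 1" "4 dvd v - 1" using False v n by (simp_all add: cong_iff_dvd_diff)
    then have "8 dvd v - 5" by presburger
    then have v5: "[v = 5] (mod 8)" by (simp add: cong_iff_dvd_diff)
    then have "M 5 0 \<gamma> False" by (intro M_cong[OF M]) (simp_all add: n)
    from square[OF this] have "4 dvd (5 + 1) * \<gamma>" by (intro four) (simp add: n cong_def)
    moreover have "\<not> 4 dvd \<gamma> - 2" using no5[OF n M v5] by blast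
    ultimately show ?thesis by presburger
  qed
  have "odd r" by (rule odd_r[OF str])
  have s: "4 dvd c + r * d - 2" using sum_mod_4[OF str] by (simp add: cong_iff_dvd_diff)
  \<comment> \<open>For \<open>r\<close> equal to \<open>1\<close> modulo \<open>4\<close>, the
    shift \<open>a\<close> would agree modulo \<open>4\<close> with \<open>c + r * d\<close>, which
    is \<open>2\<close>, against \<open>one\<close>.\<close>
  have r3: "4 dvd r + 1"
  proof (rule ccontr)
    assume "\<not> 4 dvd r + 1"
    with \<open>odd r\<close> have r1: "4 dvd r - 1" by presburger
    then have "4 dvd (c + r * d - 2) - (r - 1) * d" using s by (metis dvd_diff dvd_mult2)
    then have "4 dvd a - 2" by (simp add: a_def algebra_simps)
    moreover have "4 dvd a" using one[OF Ma] r1 by (simp add: cong_iff_dvd_diff)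
    ultimately show False by presburger
  qed
  define \<delta>' where "\<delta>' = d - r * c"
  have "even \<delta>'" unfolding \<delta>'_def by (rule even_delta[OF str])
  have td: "int n dvd d' - r * c' + r * \<delta>'" unfolding \<delta>'_def by (rule t_delta[OF str])
  have r2: "int n dvd 2 * r + 2"
  proof -
    have "8 dvd 2 * r + 2" using r3 by presburger
    then show ?thesis by (rule dvd_trans[OF n8])
  qed
  have b2: "int n dvd 2 * b + 2 * r * \<delta>'"
  proof -
    have "2 * b + 2 * r * \<delta>' = 2 * (d' - r * c' + r * \<delta>') + c' * (2 * r + 2)"
      by (simp add: b_def algebra_simps)
    then show ?thesis using r2 td by (metis dvd_add dvd_mult)
  qed
  show ?thesis
  proof (rule normal_if_swap[OF str r2])
    fix v \<gamma> assume M: "M v 0 \<gamma> False"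
    have "odd v" using M_odd[OF M] n48 by auto
    have "int n dvd 2 * \<gamma> - r * (v - 1) * \<delta>'"
    proof (cases "4 dvd v - 1")
      case True
      then have "4 dvd \<gamma>" using one[OF M] by (simp add: cong_iff_dvd_diff)
      then have "8 dvd 2 * \<gamma>" by presburger
      moreover have "4 * 2 dvd (v - 1) * \<delta>'" using True \<open>even \<delta>'\<close> by (rule mult_dvd_mono)
      then have "8 dvd r * (v - 1) * \<delta>'" by (simp add: mult.assoc)
      ultimately show ?thesis using n8 by (metis dvd_diff dvd_trans)
    next
      case False
      with \<open>odd v\<close> have v3: "4 dvd v + 1" by presburger
      \<comment> \<open>Composing with \<open>Mb\<close> brings the multiplier back to
        \<open>1\<close> modulo \<open>4\<close>; the contribution of \<open>b\<close> is then
        removed with \<open>b2\<close>.\<close>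
      have "M (- v) 0 (v * b + \<gamma>) False" using M_mult[OF M Mb] by simp
      moreover have "4 dvd - v - 1" using v3 by presburger
      ultimately have "4 dvd v * b + \<gamma>" using one[of "- v"] by (simp add: cong_iff_dvd_diff)
      then have "8 dvd 2 * (v * b + \<gamma>)" by presburger
      then have 1: "int n dvd 2 * (v * b + \<gamma>)" by (rule dvd_trans[OF n8])
      have "4 * 2 dvd (v + 1) * \<delta>'" using v3 \<open>even \<delta>'\<close> by (rule mult_dvd_mono)
      then have 2: "int n dvd (v + 1) * \<delta>'" using n8 dvd_trans by fastforce
      have "int n dvd 2 * (v * b + \<gamma>) - v * (2 * b + 2 * r * \<delta>') + r * ((v + 1) * \<delta>')"
        by (rule dvd_add[OF dvd_diff[OF 1 dvd_mult[OF b2]] dvd_mult[OF 2]])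
      also have "2 * (v * b + \<gamma>) - v * (2 * b + 2 * r * \<delta>') + r * ((v + 1) * \<delta>') = 2 * \<gamma> - r * (v - 1) * \<delta>'"
        by (simp add: algebra_simps)
      finally show ?thesis .
    qed
    then show "int n dvd 2 * \<gamma> - r * (v - 1) * (d - r * c)" by (simp add: \<delta>'_def)
  qed
qed

lemma gp_2_not_swapping:
  assumes g: "gp 1 False = aff n r c d False"
  shows "gp 2 False = aff n (r * r) ((r + 1) * c) ((r + 1) * d) False"
proof -
  have "gp 2 False = gp 1 False \<otimes>\<^bsub>A\<^esub> gp 1 False" by (simp add: gp_mult)
  then show ?thesis
    using n P_sub[OF gp_in[of 1 False]] by (simp add: g A_mult aff_comp algebra_simps)
qed

text \<open>If \<open>g\<close> keeps the kinds and has multiplier \<open>- 1\<close>, then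
  \<open>g^2 = 1\<close>, against its order; with multiplier \<open>1\<close> it is a
  translation.\<close>

lemma normal_if_4:
  assumes n4: "n = 4"
  shows "P \<lhd> A"
proof -
  obtain r c d e where g: "gp 1 False = aff n r c d e" by (rule gp_aff)
  obtain u c' d' e' where t: "gp 0 True = aff n u c' d' e'" by (rule gp_aff)
  show ?thesis
  proof (cases e)
    case True
    then show ?thesis using normal_if_swapping_generator g n4 by auto
  next
    case False
    then have g': "gp 1 False = aff n r c d False" using g by simp
    have "Q r c d False" using gp_in[of 1 False] by (simp add: Q_def g')
    then have "odd r" by (rule M_odd[OF Q_M]) (simp add: n4)
    have "\<not> 4 dvd r + 1"
    proof
      assume "4 dvd r + 1"
      then have "4 dvd (r + 1) * x" for x by simp
      moreover have "[r * r = 1] (mod 4)" using relations(4)[OF g t] n4 by simp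
      ultimately have "gp 2 False = aff n 1 0 0 False"
        unfolding gp_2_not_swapping[OF g'] by (simp add: aff_eq_iff n4 cong_iff_dvd_diff)
      also have "\<dots> = gp 0 False" by (simp add: gp_0 Aut_one pverts_Cay aff_one)
      finally show False unfolding gp_eq_iff by (simp add: n4 cong_iff_dvd_diff)
    qed
    with \<open>odd r\<close> have "4 dvd r - 1" by presburger
    then have "gp 1 False = aff n 1 c d False"
      unfolding g' by (simp add: aff_eq_iff n4 cong_iff_dvd_diff)
    moreover have e' using swap_if_not_swap g' t by blast
    ultimately show ?thesis using normal_if_translations t by auto
  qed
qed

end

section \<open>\<open>n = 8\<close>: images of \<open>a\<close> with multiplier
  \<open>5\<close>\<close>

lemma odd_square_mod_8: "odd c \<Longrightarrow> 8 dvd c * c - (1 :: int)"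
proof -
  assume "odd c"
  then obtain m where m: "c = 2 * m + 1" by (rule oddE)
  have "even (m * (m + 1))" by simp
  then have "4 * 2 dvd 4 * (m * (m + 1))" by (intro mult_dvd_mono) simp_all
  also have "4 * (m * (m + 1)) = c * c - 1" by (simp add: m algebra_simps)
  finally show ?thesis by simp
qed

context regular_dihedral_subgroup
begin

text \<open>Odd \<open>c\<close> and \<open>d\<close> express that \<open>g^4\<close> fixes no
  vertex; an even \<open>c'\<close> is obtained by passing from \<open>t\<close> to
  \<open>g t\<close> if necessary.\<close>

context
  fixes c d u c' d' j :: int
  assumes n8: "n = 8"
    and g: "gp 1 False = aff n 5 c d False" and t: "gp j True = aff n u c' d' True"
    and odd_c: "odd c" and odd_d: "odd d" and even_c': "even c'"
begin

lemma u_square: "8 dvd u * u - 1"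
  using relations(1)[OF g t] n8 by (simp add: cong_iff_dvd_diff)

lemma Q_u: "Q u c' d' True" and Q_5: "Q 5 c d False"
  using gp_in[of j True] gp_in[of 1 False] by (simp_all add: Q_def g t)

lemma odd_u: "odd u"
  by (rule M_odd[OF Q_M[OF Q_u]]) (simp add: n8)

lemma d'_eq: "8 dvd d' + u * c'"
  using relations(2)[OF g t] n8 by (simp add: cong_iff_dvd_diff add.commute)

lemma d_eq: "8 dvd d - 3 * u * c"
proof -
  have "8 dvd 5 * u * c + (5 * c' + d) - c'"
    using relations(5)[OF g t] n8 by (simp add: cong_iff_dvd_diff)
  moreover have "4 * 2 dvd 4 * c'" using even_c' by (intro mult_dvd_mono) simp_all
  then have "8 dvd 4 * c' + 8 * (u * c)" by simp
  ultimately have "8 dvd 5 * u * c + (5 * c' + d) - c' - (4 * c' + 8 * (u * c))" by (rule dvd_diff)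
  then show ?thesis by (simp add: algebra_simps)
qed

lemma Q_cong8:
  assumes "Q r x y e" "8 dvd r - r'" "8 dvd x - x'" "8 dvd y - y'"
  shows "Q r' x' y' e"
  using assms(1) by (rule Q_cong) (use assms n8 in \<open>simp_all add: cong_iff_dvd_diff\<close>)

lemma Q_even_translation: "Q 1 (2 * k) (- 2 * u * k) False"
proof -
  have "gp 2 False = aff n (5 * 5) ((5 + 1) * c) ((5 + 1) * d) False"
    by (rule gp_2_not_swapping[OF g])
  also have "\<dots> = aff n 1 (6 * c) (6 * d) False"
    using n by (simp add: aff_eq_iff) (simp add: n8 cong_iff_dvd_diff)
  \<comment> \<open>The exponent \<open>i = 3 * c * k\<close> solves
    \<open>6 * c * i = 2 * k\<close> modulo \<open>8\<close>, since \<open>18 * c * c\<close> is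
    \<open>2\<close> modulo \<open>8\<close>.\<close>
  finally have "gp (3 * c * k * 2) False = aff n 1 (3 * c * k * (6 * c)) (3 * c * k * (6 * d)) False"
    by (rule gp_power)
  then have "Q 1 (3 * c * k * (6 * c)) (3 * c * k * (6 * d)) False"
    using gp_in[of "3 * c * k * 2" False] by (simp add: Q_def)
  then show ?thesis
  proof (rule Q_cong8)
    have "3 * c * k * (6 * c) - 2 * k = 18 * k * (c * c - 1) + 8 * (2 * k)"
      by (simp add: algebra_simps)
    then show "8 dvd 3 * c * k * (6 * c) - 2 * k"
      using odd_square_mod_8[OF odd_c] by simp
    have "3 * c * k * (6 * d) - - 2 * u * k =
        18 * c * k * (d - 3 * u * c) + 54 * u * k * (c * c - 1) + 8 * (7 * u * k)"
      by (simp add: algebra_simps)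
    then show "8 dvd 3 * c * k * (6 * d) - - 2 * u * k"
      using odd_square_mod_8[OF odd_c] d_eq by simp
  qed simp
qed

text \<open>Together with \<open>Q_u_even\<close>, a membership test for the cosets of
  \<open>g\<close> and \<open>t\<close> modulo the even translations.\<close>

lemma Q_5_odd:
  assumes "odd x" "8 dvd y - 3 * u * x"
  shows "Q 5 x y False"
proof -
  have "even (x - c)" using assms(1) odd_c by simp
  then obtain m where m: "x - c = 2 * m" by (rule evenE)
  from Q_mult[OF Q_even_translation Q_5, of m]
  have "Q 5 (c + 2 * m) (d - 2 * u * m) False" by simp
  then show ?thesis
  proof (rule Q_cong8)
    have "c + 2 * m - x = 0" using m by linarith
    then show "8 dvd c + 2 * m - x" by simp
    have "d - 2 * u * m - y = (d - 3 * u * c) - (y - 3 * u * x) - 8 * (u * m) + 3 * u * (2 * m - (x - c))"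
      by (simp add: algebra_simps)
    also have "8 dvd \<dots>" using d_eq assms(2) m by simp
    finally show "8 dvd d - 2 * u * m - y" .
  qed simp
qed

lemma Q_u_even:
  assumes "even x" "8 dvd y + u * x"
  shows "Q u x y True"
proof -
  have "even (c' - x)" using assms(1) even_c' by simp
  then obtain m where m: "c' - x = 2 * m" by (rule evenE)
  from Q_mult[OF Q_even_translation Q_u, of "u * m"]
  have "Q u (c' - 2 * u * (u * m)) (d' + 2 * (u * m)) True" by (simp add: algebra_simps)
  then show ?thesis
  proof (rule Q_cong8)
    have "c' - 2 * u * (u * m) - x = (c' - x - 2 * m) - 2 * m * (u * u - 1)"
      by (simp add: algebra_simps)
    also have "8 dvd \<dots>" using u_square m by simp
    finally show "8 dvd c' - 2 * u * (u * m) - x" .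
    have "d' + 2 * (u * m) - y = (d' + u * c') - (y + u * x) - u * (c' - x - 2 * m)"
      by (simp add: algebra_simps)
    also have "8 dvd \<dots>" using d'_eq assms(2) m by simp
    finally show "8 dvd d' + 2 * (u * m) - y" .
  qed simp
qed

text \<open>Composing, if necessary, with \<open>g\<close> corrected to fix \<open>1\<close>, which
  has multiplier \<open>5\<close> and an even shift, brings the multiplier to \<open>1\<close> or
  \<open>3\<close> modulo \<open>8\<close> and keeps the shift odd. The first contradicts
  \<open>M_shift_dvd_4\<close>; in the second the square shifts the reflections by \<open>4\<close>,
  against \<open>no_shift_by_4\<close>.\<close>

lemma M_fix_even:
  assumes M: "M v 0 \<gamma> False"
  shows "even \<gamma>"
proof (rule ccontr)
  assume "odd \<gamma>"
  have M5: "M 5 0 (c + d) False" using M_fix[OF Q_M[OF Q_5]] .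
  have "\<not> [5 = 1] (mod int n)" by (simp add: n8 cong_def)
  then have four: "4 dvd \<beta>" if "M 1 0 \<beta> False" for \<beta>
    using M_shift_dvd_4[OF _ that M5] n8 by simp
  have M_cong8: "M r' 0 y' False" if "M r 0 y False" "8 dvd r - r'" "8 dvd y - y'" for r r' y y'
    using that(1) by (rule M_cong) (use that n8 in \<open>simp_all add: cong_iff_dvd_diff\<close>)
  have no3: False if M3: "M w 0 \<beta> False" and w: "8 dvd w - 3" and "odd \<beta>" for w \<beta>
  proof -
    have M3': "M 3 0 \<beta> False" using M_cong8[OF M3, of 3 \<beta>] w by simp
    from M_mult[OF this this] have "M 9 0 (4 * \<beta>) False" by simp
    moreover have "8 dvd 4 * \<beta> - 4" using \<open>odd \<beta>\<close> by presburger
    ultimately have "M 1 0 4 False" using M_cong8[of 9 "4 * \<beta>" 1 4] by simp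
    then show False using no_shift_by_4[OF n8 _ M5 M3'] by simp
  qed
  have "odd v" by (rule M_odd[OF M]) (simp add: n8)
  have M5v: "M (5 * v) 0 (5 * \<gamma> + (c + d)) False" using M_mult[OF M5 M] by simp
  have odd5: "odd (5 * \<gamma> + (c + d))" using \<open>odd \<gamma>\<close> odd_c odd_d by simp
  have "8 dvd v - 1 \<or> 8 dvd v - 3 \<or> 8 dvd 5 * v - 1 \<or> 8 dvd 5 * v - 3"
    using \<open>odd v\<close> by presburger
  then consider "8 dvd v - 1" | "8 dvd v - 3" | "8 dvd 5 * v - 1" | "8 dvd 5 * v - 3"
    by blast
  then show False
  proof cases
    case 1
    then have "4 dvd \<gamma>" using four M_cong8[OF M, of 1 \<gamma>] by simp
    then show False using \<open>odd \<gamma>\<close> by presburger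
  next
    case 2
    then show False using no3[OF M] \<open>odd \<gamma>\<close> by blast
  next
    case 3
    then have "4 dvd 5 * \<gamma> + (c + d)" using four M_cong8[OF M5v, of 1 "5 * \<gamma> + (c + d)"] by simp
    then show False using odd5 by presburger
  next
    case 4
    then show False using no3[OF M5v] odd5 by blast
  qed
qed

text \<open>Shifts and the exchange are checked by congruences alone; for automorphisms fixing
  \<open>1\<close> the test comes down to \<open>\<gamma>\<close> being even.\<close>

lemma normal_if_5: "P \<lhd> A"
proof (rule normal_if_stable[OF g t])
  show "stable 5 c d False"
    unfolding stable_def if_False
  proof (intro conjI allI impI)
    show "Q 5 (c + k - 5 * k) (d - k + 5 * k) False" for k
    proof (rule Q_5_odd)
      have "even (1 + 3 * u)" using odd_u by simp
      then have "4 * 2 dvd 4 * (1 + 3 * u)" by (intro mult_dvd_mono) simp_all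
      then have "8 dvd (d - 3 * u * c) + k * (4 * (1 + 3 * u))" using d_eq by simp
      then show "8 dvd d - k + 5 * k - 3 * u * (c + k - 5 * k)" by (simp add: algebra_simps)
    qed (use odd_c in simp)
    show "Q 5 d c False"
    proof (rule Q_5_odd)
      have "c - 3 * u * d = - 3 * u * (d - 3 * u * c) - 9 * c * (u * u - 1) - 8 * c"
        by (simp add: algebra_simps)
      also have "8 dvd \<dots>" using d_eq u_square by simp
      finally show "8 dvd c - 3 * u * d" .
    qed (rule odd_d)
    fix v \<gamma> assume M: "M v 0 \<gamma> False"
    have "odd v" by (rule M_odd[OF M]) (simp add: n8)
    have "4 * 2 dvd 4 * \<gamma>" using M_fix_even[OF M] by (intro mult_dvd_mono) simp_all
    then have "8 dvd v * (d - 3 * u * c) - 4 * \<gamma>" using d_eq by simp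
    then show "Q 5 (v * c + 0) (v * d + \<gamma> - 5 * \<gamma>) False"
      using \<open>odd v\<close> odd_c by (intro Q_5_odd) (simp_all add: algebra_simps)
  qed
  show "stable u c' d' True"
    unfolding stable_def if_True
  proof (intro conjI allI impI)
    show "Q u (c' + - k - u * k) (d' - - k + u * k) True" for k
    proof (rule Q_u_even)
      have "d' - - k + u * k + u * (c' + - k - u * k) = (d' + u * c') - k * (u * u - 1)"
        by (simp add: algebra_simps)
      also have "8 dvd \<dots>" using d'_eq u_square by simp
      finally show "8 dvd d' - - k + u * k + u * (c' + - k - u * k)" .
    qed (use even_c' odd_u in simp)
    show "Q u d' c' True"
    proof (rule Q_u_even)
      have "8 dvd u * (d' + u * c') - c' * (u * u - 1)" using d'_eq u_square by simp
      then show "8 dvd c' + u * d'" by (simp add: algebra_simps)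
      have "2 dvd d' + u * c'" using d'_eq by (rule dvd_trans[rotated]) simp
      then show "even d'" using even_c' by simp
    qed
    fix v \<gamma> assume M: "M v 0 \<gamma> False"
    have "8 dvd v * (d' + u * c')" using d'_eq by simp
    then show "Q u (v * c' + \<gamma>) (v * d' + 0 - u * \<gamma>) True"
      using even_c' M_fix_even[OF M] by (intro Q_u_even) (simp_all add: algebra_simps)
  qed
qed

end

text \<open>If \<open>g\<close> keeps the kinds, \<open>g^4\<close> is a translation without fixed
  vertices, which excludes \<open>r\<close> equal to \<open>3\<close> modulo \<open>4\<close>. So
  \<open>r\<close> is \<open>1\<close> modulo \<open>8\<close>, when \<open>g\<close> is a
  translation, or \<open>5\<close>.\<close>

lemma normal_if_8:
  assumes n8: "n = 8"
  shows "P \<lhd> A"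
proof -
  obtain r c d e where g0: "gp 1 False = aff n r c d e" by (rule gp_aff)
  show ?thesis
  proof (cases e)
    case True
    then show ?thesis using normal_if_swapping_generator g0 n8 by auto
  next
    case False
    then have g: "gp 1 False = aff n r c d False" using g0 by simp
    obtain u c' d' e' where t0: "gp 0 True = aff n u c' d' e'" by (rule gp_aff)
    then have e' using swap_if_not_swap g by blast
    with t0 have t: "gp 0 True = aff n u c' d' True" by simp
    have "Q r c d False" using gp_in[of 1 False] by (simp add: Q_def g)
    then have "odd r" by (rule M_odd[OF Q_M]) (simp add: n8)
    have "gp 2 False = aff n 1 ((r + 1) * c) ((r + 1) * d) False"
      using relations(4)[OF g t] n gp_2_not_swapping[OF g] by (simp add: aff_eq_iff)
    then have gp4: "gp (2 * 2) False = aff n 1 (2 * ((r + 1) * c)) (2 * ((r + 1) * d)) False"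
      by (rule gp_power)
    have Q4: "Q 1 (2 * ((r + 1) * c)) (2 * ((r + 1) * d)) False"
      using gp_in[of "2 * 2" False] unfolding Q_def gp4 .
    have "\<not> [4 = 0] (mod int n)" by (simp add: n8 cong_def)
    then have gp40: "gp (2 * 2) False \<noteq> gp 0 False" by (simp add: gp_eq_iff)
    have c4: "\<not> 4 dvd (r + 1) * c"
    proof
      assume "4 dvd (r + 1) * c"
      then have "8 dvd 2 * ((r + 1) * c)" by presburger
      then have "[1 * 0 + (if False then 2 * ((r + 1) * d) else 2 * ((r + 1) * c)) = 0] (mod int n)"
        by (simp add: n8 cong_iff_dvd_diff)
      from Q_fixpoint[OF Q4 this] show False using gp40 gp4 by simp
    qed
    have d4: "\<not> 4 dvd (r + 1) * d"
    proof
      assume "4 dvd (r + 1) * d"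
      then have "8 dvd 2 * ((r + 1) * d)" by presburger
      then have "[1 * 0 + (if True then 2 * ((r + 1) * d) else 2 * ((r + 1) * c)) = 0] (mod int n)"
        by (simp add: n8 cong_iff_dvd_diff)
      from Q_fixpoint[OF Q4 this] show False using gp40 gp4 by simp
    qed
    have "\<not> 4 dvd r + 1" using c4 dvd_mult2 by blast
    with \<open>odd r\<close> have "8 dvd r - 1 \<or> 8 dvd r - 5" by presburger
    then show ?thesis
    proof
      assume "8 dvd r - 1"
      then have "[r = 1] (mod int n)" by (simp add: n8 cong_iff_dvd_diff)
      then have "gp 1 False = aff n 1 c d False" using g n by (simp add: aff_eq_iff)
      then show ?thesis using normal_if_translations t by blast
    next
      assume "8 dvd r - 5"
      then have "[r = 5] (mod int n)" by (simp add: n8 cong_iff_dvd_diff)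
      then have g5: "gp 1 False = aff n 5 c d False" using g n by (simp add: aff_eq_iff)
      have "even (r + 1)" using \<open>odd r\<close> by simp
      then have "odd c" "odd d" using c4 d4 mult_dvd_mono[of 2 "r + 1" 2] by fastforce+
      show ?thesis
      proof (cases "even c'")
        case True
        show ?thesis by (rule normal_if_5[OF n8 g5 t \<open>odd c\<close> \<open>odd d\<close> True])
      next
        case False
        \<comment> \<open>Replacing the image of \<open>b\<close> by that of \<open>a b\<close>
          makes the shift even, as \<open>d\<close> is odd.\<close>
        have "gp 1 True = gp 1 False \<otimes>\<^bsub>A\<^esub> gp 0 True" by (simp add: gp_mult)
        also have "\<dots> = aff n (5 * u) (5 * c' + d) (5 * d' + c) True"
          using n P_sub[OF gp_in[of 1 False]] P_sub[OF gp_in[of 0 True]]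
          by (simp add: g5 t A_mult aff_comp)
        finally show ?thesis
          using normal_if_5[OF n8 g5 _ \<open>odd c\<close> \<open>odd d\<close>] False \<open>odd d\<close> by simp
      qed
    qed
  qed
qed

end

section \<open>\<open>n = 2\<close>, and necessity of the condition on \<open>n\<close>\<close>

text \<open>The nontrivial elements of \<open>P\<close> are involutions without fixed points, and
  such an involution of four points is determined by the image of one point. So \<open>P\<close> is
  \<open>R(G)\<close>.\<close>

lemma normal_if_2:
  assumes normal: "normal_Cayley (dihedral 2) S"
    and regular: "regular_subgroup P (Cay (dihedral 2) S)"
    and iso: "Aut (Cay (dihedral 2) S)\<lparr>carrier := P\<rparr> \<cong> dihedral 2"
  shows "P \<lhd> Aut (Cay (dihedral 2) S)"
proof -
  let ?A = "Aut (Cay (dihedral 2) S)" and ?V = "carrier (dihedral 2)"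
  interpret A: group ?A by (rule group_Aut)
  have V: "?V = {(0, False), (1, False), (0, True), (1, True)}"
    by (auto simp: carrier_dihedral)
  have sub: "subgroup P ?A" using regular by (simp add: regular_subgroup_def)
  then have PA: "p \<in> carrier ?A" if "p \<in> P" for p using that by (rule subgroup.mem_carrier)
  obtain h where h: "h \<in> iso (?A\<lparr>carrier := P\<rparr>) (dihedral 2)"
    using iso by (auto simp: is_iso_def)
  have involution: "p (p x) = x" if p: "p \<in> P" and x: "x \<in> ?V" for p x
  proof -
    have square: "v \<otimes>\<^bsub>dihedral 2\<^esub> v = (0, False)" if "v \<in> ?V" for v
      using that by (auto simp: V mult_dihedral)
    have h_square: "h (q \<otimes>\<^bsub>?A\<^esub> q) = (0, False)" if "q \<in> P" for q
      using h that square by (simp add: iso_def hom_def Pi_iff)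
    have one: "\<one>\<^bsub>?A\<^esub> \<in> P" and pp: "p \<otimes>\<^bsub>?A\<^esub> p \<in> P"
      using p sub by (simp_all add: subgroup.one_closed subgroup.m_closed)
    have "h (p \<otimes>\<^bsub>?A\<^esub> p) = h \<one>\<^bsub>?A\<^esub>"
      using h_square[OF p] h_square[OF one] by simp
    moreover have "inj_on h P" using h by (simp add: iso_def bij_betw_def)
    ultimately have "p \<otimes>\<^bsub>?A\<^esub> p = \<one>\<^bsub>?A\<^esub>"
      using one pp by (simp only: inj_on_eq_iff)
    then have "compose ?V p p x = x"
      using PA[OF p] x by (simp add: Aut_mult Aut_one pverts_Cay)
    then show ?thesis using x by (simp add: compose_eq)
  qed
  have id_if_fix: "p = (\<lambda>x \<in> ?V. x)" if "p \<in> P" "x \<in> ?V" "p x = x" for p x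
    using regular that unfolding regular_subgroup_def pverts_Cay Aut_one by blast
  have P_right: "p = right_mult (dihedral 2) (p (0, False))" if p: "p \<in> P" for p
  proof (rule extensionalityI)
    have "p \<in> Bij ?V" using PA[OF p] by (simp add: Aut_iff pverts_Cay)
    then show "p \<in> extensional ?V" by (simp add: Bij_def)
    have pV: "p x \<in> ?V" if "x \<in> ?V" for x using \<open>p \<in> Bij ?V\<close> that by (rule Bij_maps)
    show "p x = right_mult (dihedral 2) (p (0, False)) x" if x: "x \<in> ?V" for x
    proof (cases "p (0, False) = (0, False)")
      case True
      then have "p = (\<lambda>x \<in> ?V. x)" using id_if_fix[OF p, of "(0, False)"] by (simp add: V)
      then show ?thesis using x True by (auto simp: right_mult_def V mult_dihedral)
    next
      case False
      have zero: "(0, False) \<in> ?V" by (simp add: V)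
      define v w where "v = p (0, False)" and "w = p x"
      have v: "v \<in> ?V" "v \<noteq> (0, False)" "p v = (0, False)" and w: "w \<in> ?V" "p w = x"
        using False pV[OF zero] pV[OF x] involution[OF p zero] involution[OF p x]
        by (simp_all add: v_def w_def)
      have "w \<noteq> x"
        using id_if_fix[OF p x] False zero by (auto simp: w_def)
      have third: "w = (0, False) \<longleftrightarrow> x = v" "w = v \<longleftrightarrow> x = (0, False)"
        using v(3) w(2) involution[OF p x] by (auto simp: v_def w_def)
      \<comment> \<open>If \<open>x\<close> is neither \<open>1\<close> nor \<open>v\<close>, then
        \<open>w\<close> is the fourth vertex.\<close>
      have "w = x \<otimes>\<^bsub>dihedral 2\<^esub> v"
        using v(1,2) w(1) x \<open>w \<noteq> x\<close> third unfolding V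
        by (elim insertE emptyE) (simp_all add: mult_dihedral)
      then show ?thesis using x by (simp add: right_mult_def v_def w_def)
    qed
  qed (simp add: right_mult_def)
  have "P = right_regular (dihedral 2)"
  proof
    show "P \<subseteq> right_regular (dihedral 2)"
    proof
      fix p assume p: "p \<in> P"
      have "p \<in> Bij ?V" using PA[OF p] by (simp add: Aut_iff pverts_Cay)
      then have "p (0, False) \<in> ?V" by (rule Bij_maps) (simp add: V)
      then show "p \<in> right_regular (dihedral 2)"
        unfolding right_regular_def using P_right[OF p] by blast
    qed
    show "right_regular (dihedral 2) \<subseteq> P"
    proof
      fix f assume "f \<in> right_regular (dihedral 2)"
      then obtain v where v: "v \<in> ?V" "f = right_mult (dihedral 2) v" by (auto simp: right_regular_def)
      moreover have "(0, False) \<in> ?V" by (simp add: V)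
      ultimately obtain p where "p \<in> P" "p (0, False) = v"
        using regular unfolding regular_subgroup_def pverts_Cay by blast
      then show "f \<in> P" using P_right[of p] v by simp
    qed
  qed
  then show ?thesis using normal by (simp add: normal_Cayley_def)
qed

lemma NNND_dihedral_only_if:
  assumes "n \<ge> 2" "NNND_group (dihedral n)"
  shows "n \<ge> 6 \<and> even n \<and> n \<noteq> 8"
proof -
  obtain S P where normal: "normal_Cayley (dihedral n) S"
    and P: "regular_subgroup P (Cay (dihedral n) S)"
      "Aut (Cay (dihedral n) S)\<lparr>carrier := P\<rparr> \<cong> dihedral n"
      "\<not> P \<lhd> Aut (Cay (dihedral n) S)"
    using assms(2) by (auto simp: NNND_group_def NNN_Cayley_def)
  have n2: "n \<noteq> 2" using normal_if_2 normal P by blast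
  then have n3: "n \<ge> 3" using assms(1) by simp
  have "group (Aut (Cay (dihedral n) S)\<lparr>carrier := P\<rparr>)"
    using P(1) by (auto simp: regular_subgroup_def intro: subgroup.subgroup_is_group[OF _ group_Aut])
  then have "dihedral n \<cong> Aut (Cay (dihedral n) S)\<lparr>carrier := P\<rparr>"
    using P(2) by (rule group.iso_sym)
  then obtain \<phi> where "\<phi> \<in> iso (dihedral n) (Aut (Cay (dihedral n) S)\<lparr>carrier := P\<rparr>)"
    by (auto simp: is_iso_def)
  then interpret regular_dihedral_subgroup n S P \<phi>
    using n3 normal P(1) by unfold_locales
  have "even n" "n \<noteq> 4" "n \<noteq> 8"
    using normal_if_odd normal_if_4 normal_if_8 P(3) by blast+
  then show ?thesis using n3 by presburger
qed

section \<open>A Cayley graph made of two cycles and some cliques\<close>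

text \<open>With \<open>d < n\<close> every clique has at least four vertices, so its edges lie in
  triangles; with \<open>3 \<le> d\<close> the edges of the cycles do not.\<close>

locale cycle_clique_graph =
  fixes n d :: nat
  assumes d3: "d \<ge> 3" and dvd: "d dvd n" and dn: "d < n"
begin

abbreviation V where "V \<equiv> carrier (dihedral n)"

text \<open>
  The edges of the Cayley graph of this set form two \<open>n\<close>-cycles, one on the rotations and one on the
  reflections, together with \<open>d\<close> disjoint cliques of size \<open>2 n / d\<close>.
\<close>

definition S :: "(int \<times> bool) set" where
  "S = {(i, s). 0 \<le> i \<and> i < int n \<and>
    (int d dvd i \<and> (s \<or> i \<noteq> 0) \<or> \<not> s \<and> (i = 1 \<or> i = int n - 1))}"

abbreviation \<Gamma> where "\<Gamma> \<equiv> Cay (dihedral n) S"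

text \<open>Membership in the same right coset of the subgroup generated by \<open>a^d\<close> and
  \<open>b\<close>; reflexive, unlike adjacency.\<close>

definition clique :: "int \<times> bool \<Rightarrow> int \<times> bool \<Rightarrow> bool" where
  "clique p q \<longleftrightarrow> int d dvd (if snd p = snd q then fst q - fst p else fst q + fst p)"

definition cycle :: "int \<times> bool \<Rightarrow> int \<times> bool \<Rightarrow> bool" where
  "cycle p q \<longleftrightarrow> snd p = snd q \<and> (int n dvd fst q - fst p - 1 \<or> int n dvd fst q - fst p + 1)"

lemma n6: "n \<ge> 6"
proof -
  obtain k where k: "n = d * k" using dvd by (rule dvdE)
  then have "k \<ge> 2" using dn by (cases "k = 0 \<or> k = 1") auto
  then have "3 * 2 \<le> d * k" using d3 by (intro mult_le_mono)
  then show ?thesis using k by simp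
qed

lemma int_dvd: "int d dvd int n"
  using dvd by simp

lemma dvd_small: "int d dvd x \<Longrightarrow> \<bar>x\<bar> < 3 \<Longrightarrow> x = 0"
  using d3 zdvd_imp_le[of "int d" "\<bar>x\<bar>"] by fastforce

lemma n_dvd_small: "int n dvd x \<Longrightarrow> \<bar>x\<bar> < 6 \<Longrightarrow> x = 0"
  using n6 zdvd_imp_le[of "int n" "\<bar>x\<bar>"] by fastforce

lemma clique_refl: "clique p p"
  by (simp add: clique_def)

text \<open>Negating the exponents of reflections turns the relation into congruence modulo
  \<open>d\<close>, visibly an equivalence.\<close>

lemma clique_iff:
  "clique (i, s) (j, t) \<longleftrightarrow> int d dvd (if t then - j else j) - (if s then - i else i)"
proof -
  have "int d dvd - j - i \<longleftrightarrow> int d dvd j + i"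
    using dvd_minus_iff[of "int d" "j + i"] by simp
  then show ?thesis
    by (cases s; cases t) (simp_all add: clique_def dvd_diff_commute)
qed

lemma clique_trans: "clique p q \<Longrightarrow> clique q w \<Longrightarrow> clique p w"
proof (cases p; cases q; cases w)
  fix i s j t k u
  assume "clique p q" "clique q w" and [simp]: "p = (i, s)" "q = (j, t)" "w = (k, u)"
  then have "int d dvd ((if t then - j else j) - (if s then - i else i)) + ((if u then - k else k) - (if t then - j else j))"
    by (intro dvd_add) (simp_all only: clique_iff)
  then show "clique p w" by (simp add: clique_iff)
qed

lemma clique_sym: "clique p q \<Longrightarrow> clique q p"
proof (cases p; cases q)
  fix i s j t
  assume "clique p q" and [simp]: "p = (i, s)" "q = (j, t)"
  then have "int d dvd - ((if t then - j else j) - (if s then - i else i))"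
    by (simp only: clique_iff dvd_minus_iff)
  then show "clique q p" by (simp add: clique_iff)
qed

lemma clique_mod: "clique (i mod int n, s) (j mod int n, t) \<longleftrightarrow> clique (i, s) (j, t)"
proof -
  have "i mod int n = i - int n * (i div int n)" "j mod int n = j - int n * (j div int n)"
    by (simp_all add: minus_mult_div_eq_mod)
  moreover obtain k where "int n = int d * k" using int_dvd by (rule dvdE)
  ultimately obtain a b where "i mod int n = i + int d * a" "j mod int n = j + int d * b"
    by (metis diff_conv_add_uminus mult.assoc mult_minus_right)
  then have "(if t then - (j mod int n) else j mod int n) - (if s then - (i mod int n) else i mod int n) =
    (if t then - j else j) - (if s then - i else i) + int d * ((if t then - b else b) - (if s then - a else a))"
    by (simp add: algebra_simps)
  then show ?thesis unfolding clique_iff by (simp add: dvd_add_left_iff)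
qed

lemma cycle_mod: "cycle (i mod int n, s) (j mod int n, t) \<longleftrightarrow> cycle (i, s) (j, t)"
proof -
  have "[j mod int n - i mod int n + e = j - i + e] (mod int n)" for e
    by (intro cong_add cong_diff cong_refl) simp_all
  then have "int n dvd j mod int n - i mod int n + e \<longleftrightarrow> int n dvd j - i + e" for e
    by (meson cong_dvd_iff cong_dvd_modulus dvd_refl)
  from this[of 1] this[of "- 1"] show ?thesis by (simp add: cycle_def)
qed

lemma cycle_not_clique: "cycle p q \<Longrightarrow> \<not> clique p q"
proof
  assume "cycle p q" "clique p q"
  then have "int d dvd fst q - fst p" and "int d dvd fst q - fst p - 1 \<or> int d dvd fst q - fst p + 1"
    using int_dvd by (auto simp: cycle_def clique_def intro: dvd_trans)
  then have "int d dvd 1 \<or> int d dvd - 1"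
    by (metis add_diff_cancel_left' diff_diff_eq2 dvd_diff dvd_diff_commute minus_diff_eq)
  then show False using d3 by (auto dest: zdvd_imp_le)
qed

lemma cycle_irrefl: "\<not> cycle p p"
  using cycle_not_clique clique_refl by blast

lemma arc_iff:
  assumes p: "p \<in> V" and q: "q \<in> V"
  shows "(p, q) \<in> parcs \<Gamma> \<longleftrightarrow> p \<noteq> q \<and> clique p q \<or> cycle p q"
proof -
  obtain i s j t where ij: "p = (i, s)" "q = (j, t)" "0 \<le> i" "i < int n" "0 \<le> j" "j < int n"
    using p q by (cases p; cases q) (auto simp: carrier_dihedral)
  \<comment> \<open>The exponent of \<open>a\<close>, before reduction, in \<open>q\<close> times
    the inverse of \<open>p\<close>, the only element taking \<open>p\<close> to \<open>q\<close>
    from the left.\<close>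
  define k where "k = (if s = t then j - i else j + i)"
  have unique: "x mod int n = k mod int n \<and> e = (s \<noteq> t)"
    if "(j, t) = (x, e) \<otimes>\<^bsub>dihedral n\<^esub> (i, s)" for x e
    using that by (auto simp: mult_dihedral k_def mod_simps)
  have "(j, t) = (k mod int n, s \<noteq> t) \<otimes>\<^bsub>dihedral n\<^esub> (i, s)"
    using ij by (auto simp: mult_dihedral k_def mod_simps)
  then have "(p, q) \<in> parcs \<Gamma>" if "(k mod int n, s \<noteq> t) \<in> S"
    using that p unfolding Cay_def ij(1,2) by (simp only: pair_pre_digraph.select_convs) blast
  moreover have "(k mod int n, s \<noteq> t) \<in> S" if pq: "(p, q) \<in> parcs \<Gamma>"
  proof -
    obtain v where v: "v \<in> S" "(j, t) = v \<otimes>\<^bsub>dihedral n\<^esub> (i, s)"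
      using pq unfolding Cay_def ij(1,2) by (simp only: pair_pre_digraph.select_convs) blast
    obtain x e where x: "v = (x, e)" by (cases v)
    then have "x mod int n = x" using v(1) by (simp add: S_def)
    then show ?thesis using unique[of x e] v x by simp
  qed
  ultimately have "(p, q) \<in> parcs \<Gamma> \<longleftrightarrow> (k mod int n, s \<noteq> t) \<in> S" by blast
  also have "\<dots> \<longleftrightarrow> p \<noteq> q \<and> clique p q \<or> cycle p q"
  proof -
    have "int d dvd k mod int n \<longleftrightarrow> clique p q"
      using int_dvd by (simp add: dvd_mod_iff k_def clique_def ij)
    moreover have "k mod int n = 0 \<longleftrightarrow> p = q" if "s = t"
    proof
      assume "k mod int n = 0"
      then have "j mod int n = i mod int n" using that by (simp add: k_def mod_eq_dvd_iff dvd_eq_mod_eq_0)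
      then show "p = q" using ij that by simp
    qed (simp add: ij k_def)
    moreover have "k mod int n = 1 \<longleftrightarrow> int n dvd k - 1"
      using mod_eq_dvd_iff[of k "int n" 1] n6 by simp
    moreover have "- 1 mod int n = int n - 1" using n6 by (simp add: zmod_minus1)
    then have "k mod int n = int n - 1 \<longleftrightarrow> int n dvd k + 1"
      using mod_eq_dvd_iff[of k "int n" "- 1"] by simp
    moreover have "0 \<le> k mod int n" "k mod int n < int n" using n6 by simp_all
    moreover have "cycle p q \<longleftrightarrow> s = t \<and> (int n dvd k - 1 \<or> int n dvd k + 1)"
      by (auto simp: cycle_def k_def ij)
    moreover have "s \<noteq> t \<Longrightarrow> p \<noteq> q" by (auto simp: ij)
    ultimately show ?thesis unfolding S_def by auto
  qed
  finally show ?thesis .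
qed

end

section \<open>Automorphisms of the graph\<close>

context cycle_clique_graph
begin

lemma cycle_offset:
  assumes "cycle (i, s) (j, t)"
  obtains a where "a \<in> {1, - 1}" "int n dvd j - i - a"
  using assms that[of 1] that[of "- 1"] by (auto simp: cycle_def)

lemma cycle_succ: "cycle (i mod int n, s) ((i + 1) mod int n, s)"
  unfolding cycle_mod by (simp add: cycle_def)

text \<open>A cycle edge lies in no triangle. With two further cycle edges, \<open>n\<close> would
  divide an odd number of size at most \<open>3\<close>. With a cycle edge and a clique edge,
  \<open>d\<close> divides a sum of two signs, which is then \<open>0\<close>, so two vertices
  coincide. Two clique edges would make the first edge a clique edge as well.\<close>

lemma clique_iff_triangle:
  assumes u: "u \<in> V" and v: "v \<in> V" and uv: "u \<noteq> v"
  shows "clique u v \<longleftrightarrow>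
    (u, v) \<in> parcs \<Gamma> \<and> (\<exists>w \<in> V. (u, w) \<in> parcs \<Gamma> \<and> (w, v) \<in> parcs \<Gamma>)"
proof
  assume c: "clique u v"
  obtain i s where i: "u = (i, s)" "0 \<le> i" "i < int n"
    using u by (cases u) (auto simp: carrier_dihedral)
  define u' where "u' = ((- i) mod int n, \<not> s)"
  define u'' where "u'' = ((i + int d) mod int n, s)"
  have V': "u' \<in> V" "u'' \<in> V" using n6 by (simp_all add: u'_def u''_def carrier_dihedral)
  have "clique (i mod int n, s) u'"
    unfolding u'_def clique_mod by (simp add: clique_iff)
  moreover have "clique (i mod int n, s) u''"
    unfolding u''_def clique_mod by (simp add: clique_iff)
  ultimately have c': "clique u u'" "clique u u''" using i by simp_all
  have ne: "u' \<noteq> u" "u'' \<noteq> u'" by (auto simp: u'_def u''_def i)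
  have "u'' \<noteq> u"
  proof
    assume "u'' = u"
    then have "(i + int d) mod int n = i mod int n" using i by (simp add: u''_def)
    then have "int n dvd int d" by (simp add: mod_eq_dvd_iff)
    then show False using d3 dn by (auto dest: zdvd_imp_le)
  qed
  define w where "w = (if v = u' then u'' else u')"
  have "w \<in> V" "w \<noteq> u" "w \<noteq> v" "clique u w"
    using V' c' ne \<open>u'' \<noteq> u\<close> by (auto simp: w_def)
  moreover from this have "clique w v" using c clique_sym clique_trans by blast
  ultimately show "(u, v) \<in> parcs \<Gamma> \<and> (\<exists>w \<in> V. (u, w) \<in> parcs \<Gamma> \<and> (w, v) \<in> parcs \<Gamma>)"
    using c u v uv by (auto simp: arc_iff)
next
  assume rhs: "(u, v) \<in> parcs \<Gamma> \<and> (\<exists>w \<in> V. (u, w) \<in> parcs \<Gamma> \<and> (w, v) \<in> parcs \<Gamma>)"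
  then obtain w where w: "w \<in> V" "(u, w) \<in> parcs \<Gamma>" "(w, v) \<in> parcs \<Gamma>" by blast
  show "clique u v"
  proof (rule ccontr)
    assume nc: "\<not> clique u v"
    then have uv: "cycle u v" using rhs u v by (simp add: arc_iff)
    obtain i s j t k x where ij: "u = (i, s)" "v = (j, t)" "w = (k, x)"
      by (cases u; cases v; cases w)
    have bounds: "0 \<le> i" "i < int n" "0 \<le> k" "k < int n" "0 \<le> j" "j < int n"
      using u v w(1) by (auto simp: ij carrier_dihedral)
    have st: "s = t" using uv by (simp add: cycle_def ij)
    have neq: "w \<noteq> u" "w \<noteq> v"
      using w u v cycle_irrefl[of u] cycle_irrefl[of v] by (auto simp: arc_iff)
    have "\<not> (clique u w \<and> clique w v)" using nc clique_trans by blast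
    then have x: "x = s" and cyc: "cycle u w \<or> cycle w v"
      using w u v st by (auto simp: arc_iff cycle_def ij)
    obtain a where a: "a \<in> {1, - 1}" "int n dvd j - i - a"
      by (rule cycle_offset[OF uv[unfolded ij]])
    consider "cycle u w" "cycle w v" | "clique u w" "cycle w v" | "cycle u w" "clique w v"
      using w u v cyc \<open>\<not> (clique u w \<and> clique w v)\<close> by (auto simp: arc_iff)
    then show False
    proof cases
      case 1
      obtain b where b: "b \<in> {1, - 1}" "int n dvd k - i - b"
        by (rule cycle_offset[OF 1(1)[unfolded ij]])
      obtain c where c: "c \<in> {1, - 1}" "int n dvd j - k - c"
        by (rule cycle_offset[OF 1(2)[unfolded ij]])
      have "int n dvd (j - i - a) - (k - i - b) - (j - k - c)"
        by (rule dvd_diff[OF dvd_diff[OF a(2) b(2)] c(2)])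
      then have "b + c - a = 0" using a(1) b(1) c(1) by (intro n_dvd_small) (auto simp: algebra_simps)
      then show False using a(1) b(1) c(1) by auto
    next
      case 2
      obtain c where c: "c \<in> {1, - 1}" "int n dvd j - k - c"
        by (rule cycle_offset[OF 2(2)[unfolded ij]])
      have n: "int n dvd (j - i - a) - (j - k - c)" using a(2) c(2) by (rule dvd_diff)
      then have "int d dvd (j - i - a) - (j - k - c)" using int_dvd dvd_trans by blast
      moreover have "int d dvd k - i" using 2(1) x by (simp add: clique_def ij)
      ultimately have "int d dvd (j - i - a) - (j - k - c) - (k - i)" by (rule dvd_diff)
      then have "c - a = 0" using a(1) c(1) by (intro dvd_small) (auto simp: algebra_simps)
      then have "int n dvd k - i" using n by simp
      then have "k mod int n = i mod int n" by (simp add: mod_eq_dvd_iff)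
      then show False using neq(1) x bounds by (simp add: ij)
    next
      case 3
      obtain c where c: "c \<in> {1, - 1}" "int n dvd k - i - c"
        by (rule cycle_offset[OF 3(1)[unfolded ij]])
      have n: "int n dvd (j - i - a) - (k - i - c)" using a(2) c(2) by (rule dvd_diff)
      then have "int d dvd (j - i - a) - (k - i - c)" using int_dvd dvd_trans by blast
      moreover have "int d dvd j - k" using 3(2) x st by (simp add: clique_def ij)
      ultimately have "int d dvd (j - i - a) - (k - i - c) - (j - k)" by (rule dvd_diff)
      then have "c - a = 0" using a(1) c(1) by (intro dvd_small) (auto simp: algebra_simps)
      then have "int n dvd j - k" using n by simp
      then have "j mod int n = k mod int n" by (simp add: mod_eq_dvd_iff)
      then show False using neq(2) x st bounds by (simp add: ij)
    qed
  qed
qed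

context
  fixes f assumes f: "f \<in> carrier (Aut \<Gamma>)"
begin

lemma f_Bij: "f \<in> Bij V"
  using f by (simp add: Aut_iff pverts_Cay)

lemma f_V: "p \<in> V \<Longrightarrow> f p \<in> V"
  by (rule Bij_maps[OF f_Bij])

lemma f_inj: "p \<in> V \<Longrightarrow> q \<in> V \<Longrightarrow> f p = f q \<longleftrightarrow> p = q"
  using f_Bij by (simp add: Bij_def bij_betw_def) (metis inj_onD)

lemma f_surj: "w \<in> V \<Longrightarrow> \<exists>p \<in> V. f p = w"
proof -
  assume w: "w \<in> V"
  have "f ` V = V" using f_Bij by (simp add: Bij_def bij_betw_def)
  with w have "w \<in> f ` V" by simp
  then show ?thesis by blast
qed

lemma f_arc: "p \<in> V \<Longrightarrow> q \<in> V \<Longrightarrow> (f p, f q) \<in> parcs \<Gamma> \<longleftrightarrow> (p, q) \<in> parcs \<Gamma>"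
  using f by (simp add: Aut_iff pverts_Cay)

lemma f_clique:
  assumes p: "p \<in> V" and q: "q \<in> V"
  shows "clique (f p) (f q) \<longleftrightarrow> clique p q"
proof (cases "p = q")
  case False
  have "(\<exists>w \<in> V. (f p, w) \<in> parcs \<Gamma> \<and> (w, f q) \<in> parcs \<Gamma>) \<longleftrightarrow>
      (\<exists>w \<in> V. (p, w) \<in> parcs \<Gamma> \<and> (w, q) \<in> parcs \<Gamma>)"
  proof
    assume "\<exists>w \<in> V. (f p, w) \<in> parcs \<Gamma> \<and> (w, f q) \<in> parcs \<Gamma>"
    then obtain w where "w \<in> V" "(f p, f w) \<in> parcs \<Gamma>" "(f w, f q) \<in> parcs \<Gamma>"
      using f_surj by blast
    then show "\<exists>w \<in> V. (p, w) \<in> parcs \<Gamma> \<and> (w, q) \<in> parcs \<Gamma>"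
      using f_arc p q by blast
  next
    assume "\<exists>w \<in> V. (p, w) \<in> parcs \<Gamma> \<and> (w, q) \<in> parcs \<Gamma>"
    then obtain w where "w \<in> V" "(f p, f w) \<in> parcs \<Gamma>" "(f w, f q) \<in> parcs \<Gamma>"
      using f_arc p q by blast
    then show "\<exists>w \<in> V. (f p, w) \<in> parcs \<Gamma> \<and> (w, f q) \<in> parcs \<Gamma>"
      using f_V by blast
  qed
  then show ?thesis
    using False p q by (simp add: clique_iff_triangle f_V f_inj f_arc)
qed (simp add: clique_refl)

lemma f_cycle:
  assumes p: "p \<in> V" and q: "q \<in> V" and c: "cycle p q"
  shows "cycle (f p) (f q)"
proof -
  have "\<not> clique (f p) (f q)" using cycle_not_clique[OF c] f_clique[OF p q] by simp
  moreover have "(f p, f q) \<in> parcs \<Gamma>" using c by (simp add: f_arc p q arc_iff)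
  ultimately show ?thesis by (simp add: arc_iff f_V p q)
qed

text \<open>Each step of the image of a cycle is \<open>1\<close> or \<open>- 1\<close>, and a
  change of sign would return to an earlier image, against injectivity.\<close>

lemma f_step:
  obtains r where "r \<in> {1, - 1}"
    "\<And>i. fst (f ((i + 1) mod int n, s)) = (fst (f (i mod int n, s)) + r) mod int n"
proof -
  define x where "x i = fst (f (i mod int n, s))" for i
  have inV: "(i mod int n, t) \<in> V" for i t using n6 by (simp add: carrier_dihedral)
  have x_range: "0 \<le> x i" "x i < int n" for i
    using f_V[OF inV[of i s]] by (auto simp: x_def carrier_dihedral mem_Times_iff)
  have cyc: "cycle (f (i mod int n, s)) (f ((i + 1) mod int n, s))" for i
    by (intro f_cycle inV cycle_succ)
  have step: "\<exists>a \<in> {1, - 1}. int n dvd x (i + 1) - x i - a" for i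
    using cyc[of i] by (auto simp: cycle_def x_def)
  have snd: "snd (f ((i + 1) mod int n, s)) = snd (f (i mod int n, s))" for i
    using cyc[of i] by (simp add: cycle_def)
  have no_return: "x (i + 1 + 1) \<noteq> x i" for i
  proof
    assume "x (i + 1 + 1) = x i"
    then have "f ((i + 1 + 1) mod int n, s) = f (i mod int n, s)"
      using snd[of i] snd[of "i + 1"] by (simp add: x_def prod_eq_iff)
    then have "(i + 1 + 1) mod int n = i mod int n"
      using f_inj[OF inV inV, of "i + 1 + 1" s i s] by simp
    then have "int n dvd 2" by (simp add: mod_eq_dvd_iff)
    then show False using n_dvd_small by fastforce
  qed
  obtain r where r: "r \<in> {1, - 1}" "int n dvd x (0 + 1) - x 0 - r" using step by blast
  have nat: "int n dvd x (int i + 1) - x (int i) - r" for i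
  proof (induction i)
    case 0
    then show ?case using r by simp
  next
    case (Suc i)
    obtain a where a: "a \<in> {1, - 1}" "int n dvd x (int i + 1 + 1) - x (int i + 1) - a"
      using step by blast
    have "a = r"
    proof (rule ccontr)
      assume "a \<noteq> r"
      then have "a = - r" using a(1) r(1) by auto
      then have "int n dvd x (int i + 1 + 1) - x (int i)"
        using dvd_add[OF a(2) Suc] by simp
      then have "x (int i + 1 + 1) mod int n = x (int i) mod int n" by (simp add: mod_eq_dvd_iff)
      then show False using no_return x_range by simp
    qed
    then show ?case using a by (simp add: add.commute)
  qed
  have "x (i + 1) = (x i + r) mod int n" for i
  proof -
    have "x (i mod int n + 1) = x (i + 1)" "x (i mod int n) = x i"
      by (simp_all add: x_def mod_simps)
    moreover have "int n dvd x (i mod int n + 1) - (x (i mod int n) + r)"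
      using nat[of "nat (i mod int n)"] n6 by (simp add: diff_diff_eq)
    ultimately have "x (i + 1) mod int n = (x i + r) mod int n" by (simp add: mod_eq_dvd_iff)
    then show ?thesis using x_range by simp
  qed
  then show ?thesis using that r(1) by (simp add: x_def)
qed

text \<open>The directions on the two cycles agree: \<open>a^i\<close> and \<open>a^(-i) b\<close>
  lie in one clique, and comparing \<open>i = 0\<close> with \<open>i = 1\<close> shows that
  \<open>d\<close> divides the difference of the two signs, which has size at most
  \<open>2\<close>.\<close>

lemma automorphism_form: "\<exists>r \<in> {1, - 1}. \<exists>c c' e. int d dvd c + c' \<and> f = aff n r c c' e"
proof -
  have n0: "n > 0" using n6 by simp
  have inV: "(i mod int n, t) \<in> V" for i t using n0 by (simp add: carrier_dihedral)
  have "cycle (f (i mod int n, s)) (f ((i + 1) mod int n, s))" for i s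
    by (intro f_cycle inV cycle_succ)
  then have "snd (f ((i + 1) mod int n, s)) = snd (f (i mod int n, s))" for i s
    by (simp add: cycle_def)
  then obtain e where e: "\<And>i s. snd (f (i mod int n, s)) = (s \<noteq> e)"
    using block_map[OF n0 f_Bij] by blast
  obtain r where r: "r \<in> {1, - 1}"
    "\<And>i. fst (f ((i + 1) mod int n, False)) = (fst (f (i mod int n, False)) + r) mod int n"
    using f_step[where s = False] by blast
  obtain r' where r': "r' \<in> {1, - 1}"
    "\<And>i. fst (f ((i + 1) mod int n, True)) = (fst (f (i mod int n, True)) + r') mod int n"
    using f_step[where s = True] by blast
  define x where "x i = fst (f (i mod int n, False))" for i
  define y where "y i = fst (f (i mod int n, True))" for i
  have fx: "f (i mod int n, False) = (x i, e)" and fy: "f (i mod int n, True) = (y i, \<not> e)" for i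
    using e[of i False] e[of i True] by (simp_all add: x_def y_def prod_eq_iff)
  have xy: "int d dvd x i + y (- i)" for i
  proof -
    have "clique (i mod int n, False) (- i mod int n, True)"
      unfolding clique_mod by (simp add: clique_def)
    then have "clique (x i, e) (y (- i), \<not> e)"
      using f_clique[OF inV inV] by (simp flip: fx fy)
    then show ?thesis by (simp add: clique_def add.commute)
  qed
  have "int n dvd x (0 + 1) - (x 0 + r)"
    using r(2)[of 0] by (simp add: x_def mod_eq_dvd_iff[symmetric])
  moreover have "int n dvd y (- 1 + 1) - (y (- 1) + r')"
    using r'(2)[of "- 1"] by (simp add: y_def mod_eq_dvd_iff[symmetric])
  ultimately have "int n dvd (x (0 + 1) - (x 0 + r)) - (y (- 1 + 1) - (y (- 1) + r'))"
    by (rule dvd_diff)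
  then have "int d dvd (x (0 + 1) - (x 0 + r)) - (y (- 1 + 1) - (y (- 1) + r'))"
    by (rule dvd_trans[OF int_dvd])
  from dvd_add[OF dvd_diff[OF this xy[of 1]] xy[of 0]] have "int d dvd r' - r" by simp
  then have "r' = r" using dvd_small[of "r' - r"] r(1) r'(1) by auto
  then have step: "fst (f ((i + 1) mod int n, s)) = (fst (f (i mod int n, s)) + r) mod int n" for i s
    using r(2)[of i] r'(2)[of i] by (cases s) (simp_all only:)
  have "f = aff n r (fst (f (0, False))) (fst (f (0, True))) e"
    by (rule aff_steps[OF n0 f_Bij]) (rule step, rule e)
  then have "f = aff n r (x 0) (y 0) e" unfolding x_def y_def mod_0 .
  moreover have "int d dvd x 0 + y 0" using xy[of 0] by simp
  ultimately show ?thesis using r(1) by blast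
qed

end

end

section \<open>Normality, and a regular dihedral subgroup that is not normal\<close>

context cycle_clique_graph
begin

lemma n2: "n \<ge> 2" and n0: "n > 0"
  using n6 by simp_all

lemma even_n_if: "int n dvd x \<Longrightarrow> even n \<Longrightarrow> even x"
  using dvd_trans[of 2 "int n" x] by simp

lemma dvd_sign: "r \<in> {1, - 1} \<Longrightarrow> a dvd r * z \<longleftrightarrow> a dvd z" for a r z :: int
  by auto

lemma aff_clique:
  assumes "r \<in> {1, - 1}" "int d dvd c + c'" "p \<in> V" "q \<in> V"
  shows "clique (aff n r c c' e p) (aff n r c c' e q) \<longleftrightarrow> clique p q"
proof -
  obtain i s j t where ij: "p = (i, s)" "q = (j, t)" "0 \<le> i" "i < int n" "0 \<le> j" "j < int n"
    using assms(3,4) by (cases p; cases q) (auto simp: carrier_dihedral)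
  have "clique (aff n r c c' e p) (aff n r c c' e q) \<longleftrightarrow>
      clique (r * i + (if s then c' else c), s \<noteq> e) (r * j + (if t then c' else c), t \<noteq> e)"
    by (simp add: ij aff_apply clique_mod)
  also have "\<dots> \<longleftrightarrow> clique (i, s) (j, t)"
  proof (cases "s = t")
    case True
    have "r * j + (if t then c' else c) - (r * i + (if t then c' else c)) = r * (j - i)"
      by (simp add: algebra_simps)
    then show ?thesis using True by (simp add: clique_def dvd_sign[OF assms(1)])
  next
    case False
    then have "r * j + (if t then c' else c) + (r * i + (if s then c' else c)) = r * (j + i) + (c + c')"
      by (cases s) (auto simp: algebra_simps)
    moreover have "int d dvd r * (j + i) + (c + c') \<longleftrightarrow> int d dvd j + i"
      using dvd_add_left_iff[OF assms(2)] by (simp only: dvd_sign[OF assms(1)])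
    ultimately show ?thesis using False by (simp add: clique_def)
  qed
  finally show ?thesis by (simp add: ij)
qed

lemma aff_cycle:
  assumes "r \<in> {1, - 1}" "p \<in> V" "q \<in> V"
  shows "cycle (aff n r c c' e p) (aff n r c c' e q) \<longleftrightarrow> cycle p q"
proof -
  obtain i s j t where ij: "p = (i, s)" "q = (j, t)" "0 \<le> i" "i < int n" "0 \<le> j" "j < int n"
    using assms(2,3) by (cases p; cases q) (auto simp: carrier_dihedral)
  have "cycle (aff n r c c' e p) (aff n r c c' e q) \<longleftrightarrow>
      cycle (r * i + (if s then c' else c), s \<noteq> e) (r * j + (if t then c' else c), t \<noteq> e)"
    by (simp add: ij aff_apply cycle_mod)
  also have "\<dots> \<longleftrightarrow> cycle (i, s) (j, t)"
  proof (cases "s = t")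
    case True
    have "r * j + (if t then c' else c) - (r * i + (if t then c' else c)) - 1 = r * (j - i - r)"
      "r * j + (if t then c' else c) - (r * i + (if t then c' else c)) + 1 = r * (j - i + r)"
      using assms(1) by (auto simp: algebra_simps)
    then show ?thesis
      using True assms(1) by (simp only: cycle_def fst_conv snd_conv dvd_sign[OF assms(1)]) auto
  qed (simp add: cycle_def)
  finally show ?thesis by (simp add: ij)
qed

lemma aff_Bij': "r \<in> {1, - 1} \<Longrightarrow> aff n r c c' e \<in> Bij V"
  using n0 by (intro aff_Bij) auto

lemma aff_automorphism:
  assumes "r \<in> {1, - 1}" "int d dvd c + c'"
  shows "aff n r c c' e \<in> carrier (Aut \<Gamma>)"
  unfolding Aut_iff pverts_Cay
proof (intro conjI ballI)
  show B: "aff n r c c' e \<in> Bij V" using assms(1) by (rule aff_Bij')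
  fix p q assume pq: "p \<in> V" "q \<in> V"
  have "inj_on (aff n r c c' e) V" using B by (simp add: Bij_def bij_betw_def)
  then have "aff n r c c' e p = aff n r c c' e q \<longleftrightarrow> p = q" using pq by (simp add: inj_on_eq_iff)
  then show "(aff n r c c' e p, aff n r c c' e q) \<in> parcs \<Gamma> \<longleftrightarrow> (p, q) \<in> parcs \<Gamma>"
    using pq n0 assms by (simp add: arc_iff aff_in aff_clique aff_cycle)
qed

sublocale A: group "Aut \<Gamma>"
  by (rule group_Aut)

lemma Aut_aff_mult:
  assumes "aff n r c d' e \<in> carrier (Aut \<Gamma>)" "aff n r' c' d'' e' \<in> carrier (Aut \<Gamma>)"
  shows "aff n r c d' e \<otimes>\<^bsub>Aut \<Gamma>\<^esub> aff n r' c' d'' e' =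
    aff n (r * r') (r * c' + (if e' then d' else c)) (r * d'' + (if e' then c else d')) (e \<noteq> e')"
  using assms n0 by (simp add: Aut_mult pverts_Cay aff_comp)

lemma right_regular_eq: "right_regular (dihedral n) = {aff n 1 k (- k) e |k e. True}"
  using n0 by (rule right_regular_dihedral)

lemma right_automorphism: "aff n 1 k (- k) e \<in> carrier (Aut \<Gamma>)"
  by (rule aff_automorphism) simp_all

lemma right_regular_subgroup: "subgroup (right_regular (dihedral n)) (Aut \<Gamma>)"
proof (rule A.subgroupI)
  show "right_regular (dihedral n) \<subseteq> carrier (Aut \<Gamma>)"
    using right_automorphism by (auto simp: right_regular_eq)
  show "right_regular (dihedral n) \<noteq> {}" by (auto simp: right_regular_eq)
  fix f assume "f \<in> right_regular (dihedral n)"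
  then obtain k e where f: "f = aff n 1 k (- k) e" by (auto simp: right_regular_eq)
  define m where "m = (if e then k else - k)"
  have "aff n 1 m (- m) e \<otimes>\<^bsub>Aut \<Gamma>\<^esub> f = \<one>\<^bsub>Aut \<Gamma>\<^esub>"
    by (simp add: f Aut_aff_mult right_automorphism m_def Aut_one pverts_Cay aff_one)
  then have "inv\<^bsub>Aut \<Gamma>\<^esub> f = aff n 1 m (- m) e"
    using right_automorphism f by (metis A.inv_equality)
  then show "inv\<^bsub>Aut \<Gamma>\<^esub> f \<in> right_regular (dihedral n)" by (auto simp: right_regular_eq)
  fix h assume "h \<in> right_regular (dihedral n)"
  then obtain l e' where h: "h = aff n 1 l (- l) e'" by (auto simp: right_regular_eq)
  define m where "m = l + (if e' then - k else k)"
  have "f \<otimes>\<^bsub>Aut \<Gamma>\<^esub> h = aff n 1 m (- m) (e \<noteq> e')"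
    by (simp add: f h Aut_aff_mult right_automorphism m_def minus_diff_commute)
  then show "f \<otimes>\<^bsub>Aut \<Gamma>\<^esub> h \<in> right_regular (dihedral n)" by (auto simp: right_regular_eq)
qed

lemma conj_in_if:
  assumes "f \<in> carrier (Aut \<Gamma>)" "p \<in> carrier (Aut \<Gamma>)" "q \<in> carrier (Aut \<Gamma>)"
    and "f \<otimes>\<^bsub>Aut \<Gamma>\<^esub> p = q \<otimes>\<^bsub>Aut \<Gamma>\<^esub> f"
  shows "f \<otimes>\<^bsub>Aut \<Gamma>\<^esub> p \<otimes>\<^bsub>Aut \<Gamma>\<^esub> inv\<^bsub>Aut \<Gamma>\<^esub> f = q"
  using assms by (simp add: A.m_assoc)

lemma normal: "normal_Cayley (dihedral n) S"
  unfolding normal_Cayley_def A.normal_inv_iff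
proof (intro conjI ballI)
  show "subgroup (right_regular (dihedral n)) (Aut \<Gamma>)" by (rule right_regular_subgroup)
  fix f p assume f: "f \<in> carrier (Aut \<Gamma>)" and "p \<in> right_regular (dihedral n)"
  then obtain k \<epsilon> where p: "p = aff n 1 k (- k) \<epsilon>" by (auto simp: right_regular_eq)
  obtain r c c' e where f': "f = aff n r c c' e" using automorphism_form[OF f] by blast
  \<comment> \<open>Found by comparing the shifts of the two products; an exchange by
    \<open>f\<close> reverses the sign.\<close>
  define m where "m = (if e then - 1 else 1) * (r * k + (if \<epsilon> then c' - c else 0))"
  have "f \<otimes>\<^bsub>Aut \<Gamma>\<^esub> p = aff n 1 m (- m) \<epsilon> \<otimes>\<^bsub>Aut \<Gamma>\<^esub> f"
    using f[unfolded f'] right_automorphism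
    by (simp add: f' p Aut_aff_mult) (auto simp: m_def algebra_simps)
  then have "f \<otimes>\<^bsub>Aut \<Gamma>\<^esub> p \<otimes>\<^bsub>Aut \<Gamma>\<^esub> inv\<^bsub>Aut \<Gamma>\<^esub> f = aff n 1 m (- m) \<epsilon>"
    using f p right_automorphism by (intro conj_in_if) simp_all
  then show "f \<otimes>\<^bsub>Aut \<Gamma>\<^esub> p \<otimes>\<^bsub>Aut \<Gamma>\<^esub> inv\<^bsub>Aut \<Gamma>\<^esub> f \<in> right_regular (dihedral n)"
    by (auto simp: right_regular_eq)
qed

text \<open>The power \<open>(-1)^m\<close>, for negative \<open>m\<close> as well.\<close>

definition sgn_pow :: "int \<Rightarrow> int" where
  "sgn_pow m = (if even m then 1 else - 1)"

text \<open>\<open>R(G)\<close> twisted by a sign that depends on the parity of the shift; for even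
  \<open>n\<close> this parity makes sense modulo \<open>n\<close>.\<close>

definition P where "P = {aff n (sgn_pow m) m (- m) e |m e. True}"

text \<open>
  \<open>P\<close> is generated by \<open>rot 1 False\<close>, of order \<open>n\<close> although it exchanges rotations and reflections,
  and the involution \<open>rot 0 True\<close>, which exchanges neither.
\<close>

definition rot :: "int \<Rightarrow> bool \<Rightarrow> int \<times> bool \<Rightarrow> int \<times> bool" where
  "rot k e = (let m = (if even k then 1 else - 1) * (k + of_bool e) in aff n (sgn_pow m) m (- m) (odd k))"

lemma P_automorphism: "aff n (sgn_pow m) m (- m) e \<in> carrier (Aut \<Gamma>)"
  by (rule aff_automorphism) (simp_all add: sgn_pow_def)

lemma rot_automorphism: "rot k e \<in> carrier (Aut \<Gamma>)"
  unfolding rot_def Let_def by (rule P_automorphism)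

lemma rot_mult: "rot k e \<otimes>\<^bsub>Aut \<Gamma>\<^esub> rot j f = rot (if e then k - j else k + j) (e \<noteq> f)"
proof -
  define m where "m = (if even k then 1 else - 1) * (k + of_bool e)"
  define l where "l = (if even j then 1 else - 1) * (j + of_bool f)"
  define k' where "k' = (if e then k - j else k + j)"
  define x where "x = sgn_pow m * l + (if odd j then - m else m)"
  have "rot k e = aff n (sgn_pow m) m (- m) (odd k)" "rot j f = aff n (sgn_pow l) l (- l) (odd j)"
    by (simp_all only: rot_def Let_def m_def l_def)
  moreover have "sgn_pow m * - l + (if odd j then m else - m) = - x"
    by (simp add: x_def)
  ultimately have "rot k e \<otimes>\<^bsub>Aut \<Gamma>\<^esub> rot j f = aff n (sgn_pow m * sgn_pow l) x (- x) (odd k \<noteq> odd j)"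
    by (simp only: Aut_aff_mult P_automorphism x_def)
  also have "sgn_pow m * sgn_pow l = sgn_pow x"
    by (auto simp: x_def sgn_pow_def)
  also have "(odd k \<noteq> odd j) = odd k'"
    by (simp add: k'_def)
  also have "x = (if even k' then 1 else - 1) * (k' + of_bool (e \<noteq> f))"
    by (cases e; cases f; cases "even k"; cases "even j")
      (simp_all add: x_def k'_def m_def l_def sgn_pow_def)
  finally show ?thesis by (simp only: rot_def Let_def k'_def)
qed

context
  assumes even_n: "even n"
begin

text \<open>Even \<open>n\<close> enters here: reducing \<open>k\<close> keeps its parity.\<close>

lemma rot_mod: "rot (k mod int n) e = rot k e"
proof -
  have ev: "even (k mod int n) \<longleftrightarrow> even k"
    using even_n by (simp add: dvd_mod_iff)
  then have "[(if even k then 1 else - 1) * (k mod int n + of_bool e) = (if even k then 1 else - 1) * (k + of_bool e)] (mod int n)"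
    by (intro cong_mult cong_add cong_refl) simp
  moreover from this have "[- ((if even k then 1 else - 1) * (k mod int n + of_bool e)) = - ((if even k then 1 else - 1) * (k + of_bool e))] (mod int n)"
    by (simp only: cong_minus_minus_iff)
  ultimately show ?thesis
    using n2 ev by (simp only: rot_def Let_def aff_eq_iff) (simp add: sgn_pow_def)
qed

text \<open>The exchange gives the parity of \<open>k\<close> and the multiplier that of
  \<open>k + of_bool e\<close>; together they give \<open>e\<close>.\<close>

lemma rot_inj:
  assumes "rot k e = rot j f"
  shows "[k = j] (mod int n) \<and> e = f"
proof -
  let ?m = "(if even k then 1 else - 1) * (k + of_bool e)"
  let ?l = "(if even j then 1 else - 1) * (j + of_bool f)"
  have eq: "[sgn_pow ?m = sgn_pow ?l] (mod int n)" "[?m = ?l] (mod int n)" "odd k = odd j"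
    using assms n2 by (simp_all only: rot_def Let_def aff_eq_iff)
  have "even ?m \<longleftrightarrow> even ?l"
    using eq(1) n_dvd_small[of 2] n_dvd_small[of "- 2"]
    by (auto simp: sgn_pow_def cong_iff_dvd_diff split: if_splits)
  then have ef: "e = f" using eq(3) by (cases e; cases f) auto
  have "[k + of_bool e = j + of_bool e] (mod int n)"
  proof (cases "even k")
    case True
    then show ?thesis using eq ef by simp
  next
    case False
    then have "[- (k + of_bool e) = - (j + of_bool e)] (mod int n)" using eq ef by simp
    then show ?thesis by (simp only: cong_minus_minus_iff)
  qed
  then show ?thesis using ef by (simp only: cong_add_rcancel)
qed

lemma rot_image: "(\<lambda>(k, e). rot k e) ` V = P"
proof
  show "(\<lambda>(k, e). rot k e) ` V \<subseteq> P" by (auto simp: rot_def Let_def P_def)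
  show "P \<subseteq> (\<lambda>(k, e). rot k e) ` V"
  proof
    fix p assume "p \<in> P"
    then obtain m \<epsilon> where p: "p = aff n (sgn_pow m) m (- m) \<epsilon>" by (auto simp: P_def)
    \<comment> \<open>The exchange must be the parity of \<open>k\<close>, and \<open>m\<close> is
      up to sign \<open>k\<close> or \<open>k + 1\<close>; comparing the parities of
      \<open>m\<close> and \<open>k\<close> tells which.\<close>
    have "\<exists>k e. p = rot k e"
    proof (cases "odd m = \<epsilon>")
      case True
      then have "p = rot (if \<epsilon> then - m else m) False"
        by (auto simp: p rot_def Let_def)
      then show ?thesis by blast
    next
      case False
      then have "p = rot (if \<epsilon> then - m - 1 else m - 1) True"
        by (auto simp: p rot_def Let_def)
      then show ?thesis by blast
    qed
    then obtain k e where "p = rot k e" by blast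
    then have "p = (\<lambda>(k, e). rot k e) (k mod int n, e)" by (simp add: rot_mod)
    moreover have "(k mod int n, e) \<in> V" using n0 by (simp add: carrier_dihedral)
    ultimately show "p \<in> (\<lambda>(k, e). rot k e) ` V" by (rule image_eqI)
  qed
qed

lemma rot_iso: "(\<lambda>(k, e). rot k e) \<in> iso (dihedral n) (Aut \<Gamma>\<lparr>carrier := P\<rparr>)"
  unfolding iso_def
proof (intro CollectI conjI)
  have "inj_on (\<lambda>(k, e). rot k e) V"
    using rot_inj by (fastforce simp: inj_on_def carrier_dihedral cong_def)
  then show "bij_betw (\<lambda>(k, e). rot k e) V (carrier (Aut \<Gamma>\<lparr>carrier := P\<rparr>))"
    using rot_image by (simp add: bij_betw_def)
  show "(\<lambda>(k, e). rot k e) \<in> hom (dihedral n) (Aut \<Gamma>\<lparr>carrier := P\<rparr>)"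
  proof (rule homI)
    fix x y
    show "(\<lambda>(k, e). rot k e) (x \<otimes>\<^bsub>dihedral n\<^esub> y) =
        (\<lambda>(k, e). rot k e) x \<otimes>\<^bsub>Aut \<Gamma>\<lparr>carrier := P\<rparr>\<^esub> (\<lambda>(k, e). rot k e) y"
      by (cases x; cases y) (simp add: mult_dihedral rot_mod rot_mult)
    assume "x \<in> V"
    then show "(\<lambda>(k, e). rot k e) x \<in> carrier (Aut \<Gamma>\<lparr>carrier := P\<rparr>)"
      using rot_image by auto
  qed
qed

lemma P_subgroup: "subgroup P (Aut \<Gamma>)"
proof -
  have "(\<lambda>(k, e). rot k e) \<in> hom (dihedral n) (Aut \<Gamma>)"
    using rot_automorphism by (auto simp: hom_def mult_dihedral rot_mod rot_mult)
  then have "group_hom (dihedral n) (Aut \<Gamma>) (\<lambda>(k, e). rot k e)"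
    using n0 dihedral_group[of n] by (simp add: group_hom_def group_hom_axioms_def A.group_axioms)
  from group_hom.img_is_subgroup[OF this] show ?thesis by (simp add: rot_image)
qed

lemma P_regular: "regular_subgroup P \<Gamma>"
  unfolding regular_subgroup_def pverts_Cay
proof (intro conjI ballI impI)
  show "subgroup P (Aut \<Gamma>)" by (rule P_subgroup)
  show "\<exists>f \<in> P. f u = v" if uv: "u \<in> V" "v \<in> V" for u v
  proof -
    obtain i s j t where ij: "u = (i, s)" "v = (j, t)" "0 \<le> i" "i < int n" "0 \<le> j" "j < int n"
      using uv by (cases u; cases v) (auto simp: carrier_dihedral)
    \<comment> \<open>An even difference is bridged by a translation, an odd one with multiplier
      \<open>- 1\<close>; \<open>j + i\<close> and \<open>j - i\<close> have the same parity. The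
      outer sign is there because reflections are shifted by \<open>- m\<close>.\<close>
    define m where "m = (if s then - 1 else 1) * (if even (j - i) then j - i else j + i)"
    have "sgn_pow m * i + (if s then - m else m) = j"
      by (auto simp: m_def sgn_pow_def)
    then have "aff n (sgn_pow m) m (- m) (s \<noteq> t) u = v"
      using ij by (auto simp: aff_apply)
    then show ?thesis by (auto simp: P_def)
  qed
  fix p assume "p \<in> P" and "\<exists>v \<in> V. p v = v"
  then obtain m e v where p: "p = aff n (sgn_pow m) m (- m) e" and v: "v \<in> V" "p v = v"
    by (auto simp: P_def)
  obtain i s where i: "v = (i, s)" "0 \<le> i" "i < int n"
    using v(1) by (cases v) (auto simp: carrier_dihedral)
  have e: "\<not> e" and "(sgn_pow m * i + (if s then - m else m)) mod int n = i mod int n"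
    using v(2) i by (auto simp: p aff_apply)
  then have dvd_m: "int n dvd sgn_pow m * i + (if s then - m else m) - i"
    by (simp add: mod_eq_dvd_iff)
  \<comment> \<open>For odd \<open>m\<close> the parity of every exponent changes, so no vertex
    could be fixed.\<close>
  from even_n_if[OF this even_n] have "even m"
    by (auto simp: sgn_pow_def split: if_splits)
  then have "int n dvd m" using dvd_m by (auto simp: sgn_pow_def split: if_splits)
  then have "p = aff n 1 0 0 False"
    using n2 e \<open>even m\<close> by (simp add: p aff_eq_iff cong_iff_dvd_diff sgn_pow_def)
  then show "p = \<one>\<^bsub>Aut \<Gamma>\<^esub>" by (simp add: Aut_one pverts_Cay aff_one)
qed

text \<open>Two features of elements of \<open>P\<close> that survive reduction modulo the even
  number \<open>n\<close>; conjugates lacking one lie outside \<open>P\<close>.\<close>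

lemma P_parity:
  assumes "aff n r c c' e \<in> P" "r \<in> {1, - 1}"
  shows "int n dvd c + c'" "even c \<longleftrightarrow> r = 1"
proof -
  obtain m where m: "[r = sgn_pow m] (mod int n)" "[c = m] (mod int n)" "[c' = - m] (mod int n)"
    using assms(1) n2 by (auto simp: P_def aff_eq_iff)
  from cong_add[OF m(2,3)] show "int n dvd c + c'" by (simp add: cong_iff_dvd_diff)
  have "even (c - m)"
    using m(2) even_n unfolding cong_iff_dvd_diff by (rule even_n_if)
  moreover have "r = 1 \<longleftrightarrow> even m"
    using m(1) assms(2) n_dvd_small[of 2] n_dvd_small[of "- 2"]
    by (auto simp: sgn_pow_def cong_iff_dvd_diff split: if_splits)
  ultimately show "even c \<longleftrightarrow> r = 1" by auto
qed

text \<open>Conjugation by \<open>\<tau>\<close> gives the exchange a shift by \<open>d\<close> at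
  multiplier \<open>1\<close>, impossible in \<open>P\<close> for odd \<open>d\<close>. It changes
  the sum of the shifts of an element with multiplier \<open>- 1\<close> by
  \<open>2 * d\<close>.\<close>

lemma P_not_normal:
  assumes "odd d \<or> \<not> n dvd 2 * d"
  shows "\<not> P \<lhd> Aut \<Gamma>"
proof
  assume "P \<lhd> Aut \<Gamma>"
  then have conj: "f \<otimes>\<^bsub>Aut \<Gamma>\<^esub> p \<otimes>\<^bsub>Aut \<Gamma>\<^esub> inv\<^bsub>Aut \<Gamma>\<^esub> f \<in> P"
    if "f \<in> carrier (Aut \<Gamma>)" "p \<in> P" for f p
    using that by (simp add: A.normal_inv_iff)
  define \<tau> where "\<tau> = aff n 1 0 (int d) False"
  have \<tau>: "\<tau> \<in> carrier (Aut \<Gamma>)" unfolding \<tau>_def by (rule aff_automorphism) simp_all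
  show False
  proof (cases "odd d")
    case True
    define p q where "p = aff n 1 0 0 True" and "q = aff n 1 (int d) (- int d) True"
    have pq: "p \<in> carrier (Aut \<Gamma>)" "q \<in> carrier (Aut \<Gamma>)"
      unfolding p_def q_def by (rule aff_automorphism; simp)+
    have "p = aff n (sgn_pow 0) 0 (- 0) True" by (simp add: p_def sgn_pow_def)
    then have "p \<in> P" unfolding P_def by blast
    moreover have "\<tau> \<otimes>\<^bsub>Aut \<Gamma>\<^esub> p = q \<otimes>\<^bsub>Aut \<Gamma>\<^esub> \<tau>"
      using \<tau> pq by (simp add: \<tau>_def p_def q_def Aut_aff_mult)
    ultimately have "q \<in> P" using conj[OF \<tau>] conj_in_if[OF \<tau> pq] by metis
    then show False using P_parity(2)[of 1 "int d" "- int d" True] True by (simp add: q_def)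
  next
    case False
    define p q where "p = aff n (- 1) 1 (- 1) False" and "q = aff n (- 1) 1 (- 1 + 2 * int d) False"
    have pq: "p \<in> carrier (Aut \<Gamma>)" "q \<in> carrier (Aut \<Gamma>)"
      unfolding p_def q_def by (rule aff_automorphism; simp)+
    have "p = aff n (sgn_pow 1) 1 (- 1) False" by (simp add: p_def sgn_pow_def)
    then have "p \<in> P" unfolding P_def by blast
    moreover have "\<tau> \<otimes>\<^bsub>Aut \<Gamma>\<^esub> p = q \<otimes>\<^bsub>Aut \<Gamma>\<^esub> \<tau>"
      using \<tau> pq by (simp add: \<tau>_def p_def q_def Aut_aff_mult)
    ultimately have "q \<in> P" using conj[OF \<tau>] conj_in_if[OF \<tau> pq] by metis
    then have "int n dvd 2 * int d"
      using P_parity(1)[of "- 1" 1 "- 1 + 2 * int d" False] by (simp add: q_def)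
    then have "n dvd 2 * d" by (metis int_dvd_int_iff of_nat_mult of_nat_numeral)
    then show False using False assms by simp
  qed
qed

lemma S_inverse: "S = m_inv (dihedral n) ` S"
proof -
  interpret G: group "dihedral n" using n0 by (intro dihedral_group) simp
  have inv: "inv\<^bsub>dihedral n\<^esub> (i, s) = (if s then i else - i mod int n, s)" if "(i, s) \<in> V" for i s
    using that n0
    by (intro G.inv_equality) (auto simp: mult_dihedral carrier_dihedral mod_simps, auto simp: dihedral_def)
  have S_V: "S \<subseteq> V" by (auto simp: S_def carrier_dihedral)
  have "inv\<^bsub>dihedral n\<^esub> v \<in> S" if v: "v \<in> S" for v
  proof -
    obtain i s where i: "v = (i, s)" by (cases v)
    show ?thesis
    proof (cases s)
      case True
      then show ?thesis using v S_V inv[of i s] i by auto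
    next
      case False
      then have range: "0 \<le> i" "i < int n" and i': "int d dvd i \<and> i \<noteq> 0 \<or> i = 1 \<or> i = int n - 1"
        using v by (auto simp: i S_def)
      then have "i > 0" using n6 by auto
      then have "- i mod int n = int n - i" using range by (simp add: zmod_zminus1_eq_if)
      moreover have "(int n - i, s) \<in> S"
        using range i' \<open>i > 0\<close> False int_dvd by (auto simp: S_def)
      ultimately show ?thesis using inv[of i s] v S_V i False by auto
    qed
  qed
  then have sub: "m_inv (dihedral n) ` S \<subseteq> S" by blast
  have "v \<in> m_inv (dihedral n) ` S" if v: "v \<in> S" for v
  proof -
    have "v = inv\<^bsub>dihedral n\<^esub> (inv\<^bsub>dihedral n\<^esub> v)" using v S_V by auto
    then show ?thesis using sub v by blast
  qed
  then show ?thesis using sub by blast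
qed

lemma NNN_dihedral:
  assumes "odd d \<or> \<not> n dvd 2 * d"
  shows "NNN_group (dihedral n)"
  unfolding NNN_group_def
proof (intro conjI exI)
  have G: "group (dihedral n)" using n0 by (intro dihedral_group) simp
  then show "group (dihedral n)" .
  show "finite V" by (simp add: carrier_dihedral)
  show "S \<subseteq> V" by (auto simp: S_def carrier_dihedral)
  show "\<one>\<^bsub>dihedral n\<^esub> \<notin> S" using n6 by (auto simp: S_def dihedral_def)
  show "S = m_inv (dihedral n) ` S" by (rule S_inverse)
  have "Aut \<Gamma>\<lparr>carrier := P\<rparr> \<cong> dihedral n"
    using group.iso_sym[OF G] rot_iso by (auto simp: is_iso_def)
  then show "NNN_Cayley (dihedral n) S"
    unfolding NNN_Cayley_def using normal P_regular P_not_normal[OF assms] by blast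
qed

end

end

section \<open>Sufficiency and the equivalence\<close>

lemma NNN_dihedral_if:
  assumes "n \<ge> 6" "even n" "n \<noteq> 8"
  shows "NNN_group (dihedral n)"
proof -
  obtain m where m: "n = 2 * m" using assms(2) by (rule evenE)
  show ?thesis
  proof (cases "odd m")
    case True
    interpret cycle_clique_graph n m
      using assms(1) by unfold_locales (simp_all add: m)
    show ?thesis using NNN_dihedral assms(2) True by blast
  next
    case False
    then obtain k where k: "m = 2 * k" using evenE by blast
    \<comment> \<open>Excluding \<open>n = 8\<close> leaves \<open>n = 4 * k\<close> with
      \<open>12 \<le> n\<close>, so \<open>n\<close> cannot divide \<open>2 * 4\<close>.\<close>
    have "k \<ge> 3" using assms(1,3) by (simp add: m k)
    interpret cycle_clique_graph n 4
      using \<open>k \<ge> 3\<close> by unfold_locales (simp_all add: m k)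
    have "\<not> n dvd 2 * 4" using \<open>k \<ge> 3\<close> by (auto simp: m k dest: dvd_imp_le)
    then show ?thesis using NNN_dihedral assms(2) by blast
  qed
qed

theorem theorem1p2:
  fixes n :: nat
  assumes "n \<ge> 2"
  shows "(NNN_group (dihedral n) \<longleftrightarrow> NNND_group (dihedral n)) \<and>
         (NNND_group (dihedral n) \<longleftrightarrow> n \<ge> 6 \<and> even n \<and> n \<noteq> 8)"
proof -
  have "NNN_group (dihedral n) \<Longrightarrow> NNND_group (dihedral n)"
    by (auto simp: NNN_group_def NNND_group_def)
  then show ?thesis
    using NNND_dihedral_only_if[OF assms] NNN_dihedral_if by blast
qed

end
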